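(* Suppose that assumption ( * ) is satisfied. There exists a nonnegative function $Z(t,x)$, $t>0$, $x\in \mathbb R^n$, $x\ne 0$, locally integrable in $t$ and infinitely differentiable in $x\ne 0$, such that $$\int_{\mathbb R^n}Z(t,x)\,dx=1,\quad t>0,$$ and for any bounded globally Hölder continuous function $w_0$ (i.e. $|w_0(\xi)-w_0(\eta)|\le C|\xi-\eta|^\gamma$, $0<\gamma\le 1$, for all $\xi,\eta\in\mathbb R^n$), the function $$w(t,x)=\int_{\mathbb R^n}Z(t,x-\xi)w_0(\xi)\,d\xi$$ is an LT-solution of the Cauchy problem $(\mathbb D_{(k)} w)(t,x)=\Delta w(t,x)$, $t>0$, $x\in\mathbb R^n$; $w(0,x)=w_0(x)$.
   Context: Let $k$ be a nonnegative function in $L_1^{\mathrm{loc}}(\mathbb R_+)$, and define the operator $(\mathbb D_{(k)}u)(t)=\frac{d}{dt}\int_0^t k(t-\tau)u(\tau)\,d\tau - k(t)u(0)$. Let $\mathcal K(p)=\int_0^\infty e^{-pt}k(t)\,dt$ be the Laplace transform of $k$. A Stieltjes function is a function of the form $\varphi(\lambda)=\frac{a}{\lambda}+b+\int_0^\infty \frac{1}{\lambda+t}\,\sigma(dt)$ with $a,b\ge 0$ and $\sigma$ a Borel measure on $[0,\infty)$ with $\int_0^\infty (1+t)^{-1}\sigma(dt)<\infty$. Assumption ( * ): the Laplace transform $\mathcal K(p)$ exists for all $p>0$, $\mathcal K$ is a Stieltjes function, $\mathcal K(p)\to\infty$ as $p\to 0$, $\mathcal K(p)\to 0$ as $p\to\infty$,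 $p\mathcal K(p)\to 0$ as $p\to 0$, and $p\mathcal K(p)\to\infty$ as $p\to\infty$. Applying the Laplace transform in $t$ to the problem $\mathbb D_{(k)} w=\Delta w$, $w(0,x)=w_0(x)$, gives for the Laplace transform $\tilde w(p,x)$ the equation $p\mathcal K(p)\tilde w(p,x)-\mathcal K(p)w_0(x)=\Delta \tilde w(p,x)$, $p>0$, $x\in\mathbb R^n$. A bounded function $w(t,x)$ is called an LT-solution of this Cauchy problem if $w$ is continuous in $t$ on $[0,\infty)$ uniformly with respect to $x\in\mathbb R^n$, $w(0,x)=w_0(x)$, and its Laplace transform in $t$, $\tilde w(p,x)$, is twice continuously differentiable in $x$ for each $p>0$ and satisfies the equation $p\mathcal K(p)\tilde w(p,x)-\mathcal K(p)w_0(x)=\Delta \tilde w(p,x)$. *)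

theory Defs
  imports "HOL-Analysis.Analysis"
begin

definition laplace :: "(real \<Rightarrow> real) \<Rightarrow> real \<Rightarrow> real" where
  "laplace f p = (\<integral>t\<in>{0<..}. exp (- p * t) * f t \<partial>lborel)"

definition stieltjes_fun :: "(real \<Rightarrow> real) \<Rightarrow> bool" where
  "stieltjes_fun \<phi> \<longleftrightarrow>
    (\<exists>a b (\<sigma>::real measure). a \<ge> 0 \<and> b \<ge> 0 \<and> sets \<sigma> = sets borel \<and>
       emeasure \<sigma> {..<0} = 0 \<and>
       set_integrable \<sigma> {0..} (\<lambda>t. 1 / (1 + t)) \<and>
       (\<forall>s>0. \<phi> s = a / s + b + (\<integral>t\<in>{0..}. 1 / (s + t) \<partial>\<sigma>)))"

coinductive smooth_on :: "'a::euclidean_space set \<Rightarrow> ('a \<Rightarrow> real) \<Rightarrow> bool" where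
  "(\<forall>x\<in>S. f differentiable (at x)) \<Longrightarrow>
   (\<forall>v. smooth_on S (\<lambda>x. frechet_derivative f (at x) v)) \<Longrightarrow> smooth_on S f"

definition C2 :: "('a::euclidean_space \<Rightarrow> real) \<Rightarrow> bool" where
  "C2 f \<longleftrightarrow> (\<forall>x. f differentiable (at x)) \<and>
     (\<forall>v x. (\<lambda>y. frechet_derivative f (at y) v) differentiable (at x)) \<and>
     (\<forall>v u. continuous_on UNIV
        (\<lambda>x. frechet_derivative (\<lambda>y. frechet_derivative f (at y) v) (at x) u))"

definition laplacian :: "('a::euclidean_space \<Rightarrow> real) \<Rightarrow> 'a \<Rightarrow> real" where
  "laplacian f x = (\<Sum>b\<in>Basis. frechet_derivative (\<lambda>y. frechet_derivative f (at y) b) (at x) b)"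

text \<open>LT-solution of D_(k) w = Delta w, w(0) = w0, where K is the Laplace transform of k.\<close>
definition LT_solution :: "(real \<Rightarrow> real) \<Rightarrow> ('a::euclidean_space \<Rightarrow> real) \<Rightarrow> (real \<Rightarrow> 'a \<Rightarrow> real) \<Rightarrow> bool" where
  "LT_solution K w0 w \<longleftrightarrow>
     bounded ((\<lambda>(t, x). w t x) ` ({0..} \<times> UNIV)) \<and>
     (\<forall>t\<ge>0. \<forall>\<epsilon>>0. \<exists>\<delta>>0. \<forall>s\<ge>0. \<bar>s - t\<bar> < \<delta> \<longrightarrow> (\<forall>x. \<bar>w s x - w t x\<bar> < \<epsilon>)) \<and>
     (\<forall>x. w 0 x = w0 x) \<and>
     (\<forall>p>0. \<forall>x. set_integrable lborel {0<..} (\<lambda>t. exp (- p * t) * w t x)) \<and>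
     (\<forall>p>0. C2 (\<lambda>x. laplace (\<lambda>t. w t x) p) \<and>
        (\<forall>x. p * K p * laplace (\<lambda>t. w t x) p - K p * w0 x
              = laplacian (\<lambda>y. laplace (\<lambda>t. w t y) p) x))"

end

(* Idea of the proof. Only K = laplace k matters: by the limit hypotheses K(p) is the integral of
   1/(p+t) against a measure sigma on (0,oo), and p K(p) is the Laplace exponent of a subordinator.
   The kernel is Z(t,x) = \<integral> heat(s,x) nu_t(ds), where nu_t is the law at time t of the inverse
   subordinator, characterised by
     \<integral>_0^oo e^{-pt} (\<integral> e^{-ls} nu_t(ds)) dt = K(p) / (p K(p) + l).
   To construct nu_t, truncate sigma to (0,R]. Then K/(pK+l) is the Laplace transform in t of
   u_l(t) = z <1/x, e^{-tB} 1>, with z = 1/(c+l), c = sigma(0,R] and B the symmetric operator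
   B f = x f - z <1, f> on L^2(x dsigma). Since R - B has a positive kernel that is
   polynomial in z, u_l(t) is a mixture over the s^i e^{-cs}, i.e. the Laplace transform in l of a law;
   since 0 <= B <= R, u_l is decreasing and convex in t, which yields a modulus of continuity
   uniform in R. A diagonal argument and Helly's theorem remove the truncation.
   At an exponential time of rate p the law nu is exponential of rate q = p K(p), so the Laplace
   transform of w(t,x) = \<integral> (P_s w0)(x) nu_t(ds), P_s the heat semigroup, is K(p) times the resolvent
   of the Laplacian at q applied to w0. The bound |D^2 P_s w0| <= C s^{gamma/2 - 1} for Hoelder data
   shows that the resolvent is twice continuously differentiable. *)

theory Submission
  imports Defs
    "HOL-Probability.Probability"
    "HOL-Real_Asymp.Real_Asymp"
    "HOL-Complex_Analysis.Great_Picard"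
begin

section \<open>Truncated kernels\<close>

text \<open>The obstacle is to see that, for each fixed t, inverting K/(pK+l) in p leaves the
  Laplace transform in l of a law. Truncation turns this into algebra. On (0,R] one has p K(p) = c -
  \<integral> x/(p+x) dsigma, hence pK+l = (c+l) (1 - z \<integral> x/(p+x) dsigma), the denominator
  of a rank-one perturbation. Solving (p+B) g = 1 gives g = 1/((p+x) z (pK+l)), so that z <1/x, g> =
  K/(pK+l). This is the origin of z and B: time enters through the exponential of a bounded
  operator, and l only through powers of z. Two defects of the limit must be excluded. Escape of
  mass to infinity is prevented by the same bound on 1 - u_l(h) that gives equicontinuity. An atom
  of nu_t at 0 would make the integral of Z smaller than 1; it is excluded by the decay of the limit
  transform for large l. Weak continuity of nu_t tests one function at a time, while continuity of w
  is required uniformly in x. This is bridged by a coupling and a modulus of continuity of s -> P_s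
  w0 that does not depend on x.\<close>

lemma nn_integral_power_exp:
  fixes l :: real
  assumes "l > 0"
  shows "(\<integral>\<^sup>+t. ennreal (t ^ j / fact j * exp (- l * t)) * indicator {0<..} t \<partial>lborel) = ennreal (1 / l ^ Suc j)"
proof -
  interpret prob_space "density lborel (erlang_density j l)"
    by (rule prob_space_erlang_density[OF assms])
  have 1: "(\<integral>\<^sup>+t. ennreal (erlang_density j l t) \<partial>lborel) = 1"
    using emeasure_space_1 by (simp add: emeasure_density)
  have "AE t in lborel. ennreal (t ^ j / fact j * exp (- l * t)) * indicator {0<..} t
      = ennreal (1 / l ^ Suc j) * ennreal (erlang_density j l t)"
    using AE_lborel_singleton[of 0]
  proof eventually_elim
    case (elim t)
    have "t ^ j / fact j * exp (- l * t) = 1 / l ^ Suc j * (l ^ Suc j * t ^ j * exp (- l * t) / fact j)"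
      using assms by (simp add: field_simps)
    then show ?case
      using elim assms unfolding erlang_density_def
      by (cases "t > 0") (simp_all add: ennreal_mult[symmetric] del: power_Suc)
  qed
  then show ?thesis
    by (subst nn_integral_cong_AE, assumption, subst nn_integral_cmult) (simp_all add: 1 del: power_Suc)
qed

text \<open>For \<open>s j\<close> of the form <g, (R - B)^j h> the function is <g, exp(- t B) h>.
  Passing to \<open>s (Suc j) - R * s j\<close> is the action of - B on the coefficients, so
  derivatives in t never leave this class of series.\<close>

lemma has_real_derivative_exp_series:
  fixes s :: "nat \<Rightarrow> real" and R :: real
  assumes "\<And>j. \<bar>s j\<bar> \<le> A * B ^ j"
  shows "((\<lambda>t. exp (- R * t) * (\<Sum>j. s j / fact j * t ^ j)) has_real_derivative
     exp (- R * t) * (\<Sum>j. (s (Suc j) - R * s j) / fact j * t ^ j)) (at t)"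
    and "summable (\<lambda>j. s j / fact j * t ^ j)"
proof -
  have sm: "summable (\<lambda>j. s j / fact j * t ^ j)" if "\<And>j. \<bar>s j\<bar> \<le> A * B ^ j" for s :: "nat \<Rightarrow> real" and A B t
  proof (rule summable_comparison_test'[of "\<lambda>j. A * (inverse (fact j) * \<bar>B * t\<bar> ^ j)" 0])
    show "summable (\<lambda>j. A * (inverse (fact j) * \<bar>B * t\<bar> ^ j))"
      by (intro summable_mult summable_exp)
    fix j :: nat
    have A0: "0 \<le> A" using that[of 0] by simp
    have "\<bar>s j\<bar> \<le> A * \<bar>B\<bar> ^ j"
      using that[of j] A0 by (metis abs_ge_self mult_left_mono order_trans power_abs)
    then show "norm (s j / fact j * t ^ j) \<le> A * (inverse (fact j) * \<bar>B * t\<bar> ^ j)"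
      by (simp add: abs_mult power_mult_distrib power_abs field_simps mult_left_mono)
        (metis mult.assoc mult_right_mono abs_ge_zero zero_le_power power_abs mult.commute)
  qed
  show "summable (\<lambda>j. s j / fact j * t ^ j)" using sm[OF assms] .
  have s1: "\<bar>s (Suc j)\<bar> \<le> (A * B) * B ^ j" for j using assms[of "Suc j"] by (simp add: ac_simps)
  have d: "diffs (\<lambda>j. s j / fact j) = (\<lambda>j. s (Suc j) / fact j)"
    by (auto simp: diffs_def fun_eq_iff divide_simps simp del: of_nat_Suc)
  have "((\<lambda>t. (\<Sum>j. s j / fact j * t ^ j)) has_real_derivative (\<Sum>j. s (Suc j) / fact j * t ^ j)) (at t)"
    using termdiffs_strong_converges_everywhere[of "\<lambda>j. s j / fact j" t] sm[OF assms] unfolding d by simp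
  then have "((\<lambda>t. exp (- R * t) * (\<Sum>j. s j / fact j * t ^ j)) has_real_derivative
     exp (- R * t) * (\<Sum>j. s (Suc j) / fact j * t ^ j) - R * exp (- R * t) * (\<Sum>j. s j / fact j * t ^ j)) (at t)"
    by (auto intro!: derivative_eq_intros)
  moreover have "(\<Sum>j. (s (Suc j) - R * s j) / fact j * t ^ j) =
     (\<Sum>j. s (Suc j) / fact j * t ^ j) - R * (\<Sum>j. s j / fact j * t ^ j)"
    unfolding suminf_mult[OF sm[OF assms], symmetric]
    by (subst suminf_diff[OF sm[OF s1] summable_mult[OF sm[OF assms]]]) (simp add: field_simps)
  ultimately show "((\<lambda>t. exp (- R * t) * (\<Sum>j. s j / fact j * t ^ j)) has_real_derivative
     exp (- R * t) * (\<Sum>j. (s (Suc j) - R * s j) / fact j * t ^ j)) (at t)"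
    by (simp only: right_diff_distrib mult.assoc mult.left_commute[of R])
qed

section \<open>The rank-one perturbation of multiplication by x, and its moments\<close>

locale truncated_stieltjes = finite_measure M for M :: "real measure" +
  fixes R :: real
  assumes sets_M [measurable_cong, simp]: "sets M = sets borel"
    and R_pos: "R > 0"
    and supp: "AE x in M. 0 < x \<and> x \<le> R"
    and mass_pos: "measure M UNIV > 0"
begin

definition c where "c = measure M UNIV"
definition K where "K p = (\<integral>x. 1 / (p + x) \<partial>M)"
definition z where "z l = 1 / (c + l)"

text \<open>\<open>G w j = (R - B)\<^sup>j 1\<close> for the operator \<open>B f = x f - w \<integral>y f(y) dM\<close>, and \<open>F j i\<close> is its coefficient of \<open>w\<^sup>i\<close>;
  at the end \<open>w = z l\<close>, a Laplace transform in \<open>l\<close> with positive powers.\<close>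

primrec F :: "nat \<Rightarrow> nat \<Rightarrow> real \<Rightarrow> real" where
  "F 0 = (\<lambda>i x. if i = 0 then 1 else 0)"
| "F (Suc j) = (\<lambda>i x. (R - x) * F j i x + (if i = 0 then 0 else \<integral>y. y * F j (i - 1) y \<partial>M))"

primrec G :: "real \<Rightarrow> nat \<Rightarrow> real \<Rightarrow> real" where
  "G w 0 = (\<lambda>x. 1)"
| "G w (Suc j) = (\<lambda>x. (R - x) * G w j x + w * (\<integral>y. y * G w j y \<partial>M))"

text \<open>\<open>al\<close> integrates against M, that is, it pairs (R - B)^j 1 formally with 1/x
  in L^2(x dM); \<open>e\<close> pairs it with 1.\<close>

definition al where "al w j = (\<integral>x. G w j x \<partial>M)"
definition e where "e w j = (\<integral>x. x * G w j x \<partial>M)"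

lemma space_M [simp]: "space M = UNIV"
  using sets_eq_imp_space_eq[OF sets_M] by simp

lemma c_pos: "c > 0" unfolding c_def by (rule mass_pos)

lemma z_pos: "l \<ge> 0 \<Longrightarrow> z l > 0" unfolding z_def using c_pos by simp

lemma z_c: "l \<ge> 0 \<Longrightarrow> 1 - z l * c = l * z l"
  unfolding z_def using c_pos by (simp add: field_simps)

lemma z_c_le: "l \<ge> 0 \<Longrightarrow> z l * c \<le> 1"
  using z_c[of l] z_pos[of l] by (smt (verit) mult_nonneg_nonneg)

lemma integrable_bdd:
  fixes g :: "real \<Rightarrow> real"
  assumes "g \<in> borel_measurable borel" "\<And>x. 0 < x \<Longrightarrow> x \<le> R \<Longrightarrow> \<bar>g x\<bar> \<le> B"
  shows "integrable M g"
proof (rule integrable_const_bound[where B = B])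
  show "AE x in M. norm (g x) \<le> B" using supp by eventually_elim (use assms in auto)
qed (use assms in simp)

lemma integrable_cont:
  fixes g :: "real \<Rightarrow> real"
  assumes "continuous_on UNIV g"
  shows "integrable M g"
proof -
  have "compact (g ` {0..R})"
    by (intro compact_continuous_image continuous_on_subset[OF assms]) auto
  then obtain B where B: "\<And>x. x \<in> {0..R} \<Longrightarrow> norm (g x) \<le> B"
    by (meson bounded_iff compact_imp_bounded image_eqI)
  show ?thesis
    by (rule integrable_bdd[where B = B])
      (use B assms in \<open>auto intro: borel_measurable_continuous_onI\<close>)
qed

lemma integral_le_supp:
  fixes g h :: "real \<Rightarrow> real"
  assumes "continuous_on UNIV g" "continuous_on UNIV h" "\<And>x. 0 < x \<Longrightarrow> x \<le> R \<Longrightarrow> g x \<le> h x"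
  shows "(\<integral>x. g x \<partial>M) \<le> (\<integral>x. h x \<partial>M)"
proof (rule integral_mono_AE[OF integrable_cont integrable_cont])
  show "AE x in M. g x \<le> h x" using supp by eventually_elim (use assms in auto)
qed (use assms in auto)

lemma integral_nonneg_supp:
  fixes g :: "real \<Rightarrow> real"
  assumes "continuous_on UNIV g" "\<And>x. 0 < x \<Longrightarrow> x \<le> R \<Longrightarrow> 0 \<le> g x"
  shows "0 \<le> (\<integral>x. g x \<partial>M)"
  using integral_le_supp[of "\<lambda>_. 0" g] assms by simp

lemma F_cont [continuous_intros]: "continuous_on S (F j i)"
  by (induction j arbitrary: i) (auto intro!: continuous_intros)

lemma G_cont [continuous_intros]: "continuous_on S (G w j)"
  by (induction j) (auto intro!: continuous_intros)

lemma measure_UNIV [simp]: "measure M UNIV = c"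
  by (simp add: c_def)

lemma G_measurable [measurable]: "G w j \<in> borel_measurable borel"
  by (intro borel_measurable_continuous_onI G_cont)

lemma F_0: "i > j \<Longrightarrow> F j i x = 0"
  by (induction j arbitrary: i x) auto

lemma F_nonneg: "0 < x \<Longrightarrow> x \<le> R \<Longrightarrow> 0 \<le> F j i x"
proof (induction j arbitrary: i x)
  case (Suc j)
  then show ?case
    by (auto intro!: add_nonneg_nonneg mult_nonneg_nonneg integral_nonneg_supp continuous_intros)
qed auto

lemma G_eq: "G w j x = (\<Sum>i\<le>j. F j i x * w ^ i)"
proof (induction j arbitrary: x)
  case (Suc j)
  have "(\<integral>y. y * G w j y \<partial>M) = (\<integral>y. (\<Sum>i\<le>j. y * F j i y * w ^ i) \<partial>M)"
    by (simp add: Suc sum_distrib_left mult.assoc)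
  also have "\<dots> = (\<Sum>i\<le>j. (\<integral>y. y * F j i y \<partial>M) * w ^ i)"
    by (subst Bochner_Integration.integral_sum) (auto intro!: integrable_cont continuous_intros)
  finally have 1: "w * (\<integral>y. y * G w j y \<partial>M) = (\<Sum>i\<le>j. (\<integral>y. y * F j i y \<partial>M) * w ^ Suc i)"
    by (simp add: sum_distrib_left mult_ac)
  have "(\<Sum>i\<le>Suc j. F (Suc j) i x * w ^ i) = (\<Sum>i\<le>Suc j. (R - x) * F j i x * w ^ i)
      + (\<Sum>i\<le>Suc j. (if i = 0 then 0 else \<integral>y. y * F j (i - 1) y \<partial>M) * w ^ i)"
    by (simp only: F.simps distrib_right sum.distrib)
  also have "(\<Sum>i\<le>Suc j. (R - x) * F j i x * w ^ i) = (R - x) * G w j x"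
    by (simp add: Suc F_0 sum_distrib_left mult.assoc)
  also have "(\<Sum>i\<le>Suc j. (if i = 0 then 0 else \<integral>y. y * F j (i - 1) y \<partial>M) * w ^ i)
      = (\<Sum>i\<le>j. (\<integral>y. y * F j i y \<partial>M) * w ^ Suc i)"
    by (subst sum.atMost_Suc_shift) simp
  finally show ?case using 1 by simp
qed auto

lemma e_nonneg: "w \<ge> 0 \<Longrightarrow> 0 \<le> e w j"
  and G_nonneg: "w \<ge> 0 \<Longrightarrow> 0 < x \<Longrightarrow> x \<le> R \<Longrightarrow> 0 \<le> G w j x"
  and al_nonneg: "w \<ge> 0 \<Longrightarrow> 0 \<le> al w j"
proof -
  have *: "0 \<le> G w j x" if "w \<ge> 0" "0 < x" "x \<le> R" for x
    unfolding G_eq using that by (auto intro!: sum_nonneg mult_nonneg_nonneg F_nonneg)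
  show "w \<ge> 0 \<Longrightarrow> 0 < x \<Longrightarrow> x \<le> R \<Longrightarrow> 0 \<le> G w j x" by (rule *)
  show "w \<ge> 0 \<Longrightarrow> 0 \<le> e w j" "w \<ge> 0 \<Longrightarrow> 0 \<le> al w j"
    unfolding e_def al_def
    by (intro integral_nonneg_supp; auto intro!: continuous_intros mult_nonneg_nonneg simp: *)+
qed

text \<open>B applied to 1/x gives the constant 1 - w c, so by symmetry the pairing with 1/x drops
  to the pairing with 1. At w = z l this constant is \<open>l * z l\<close>: it is the source of the
  factor in \<open>f\<close> and vanishes at l = 0.\<close>

lemma al_Suc: "al w (Suc j) = R * al w j - (1 - w * c) * e w j"
proof -
  have "al w (Suc j) = (\<integral>x. (R * G w j x - x * G w j x) + w * e w j \<partial>M)"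
    unfolding al_def e_def by (simp add: algebra_simps)
  also have "\<dots> = R * al w j - e w j + c * (w * e w j)"
    unfolding al_def e_def
    by (subst Bochner_Integration.integral_add Bochner_Integration.integral_diff,
        (intro integrable_cont continuous_intros)+)+ simp
  finally show ?thesis by (simp add: algebra_simps)
qed

lemma e_le_al: "w \<ge> 0 \<Longrightarrow> e w j \<le> R * al w j"
proof -
  assume w: "w \<ge> 0"
  have "e w j \<le> (\<integral>x. R * G w j x \<partial>M)" unfolding e_def
    by (intro integral_le_supp continuous_intros mult_right_mono G_nonneg w)
  then show ?thesis by (simp add: al_def)
qed

lemma al_le: "w \<ge> 0 \<Longrightarrow> w * c \<le> 1 \<Longrightarrow> al w j \<le> c * R ^ j"
proof (induction j)
  case (Suc j)
  have "al w (Suc j) \<le> R * al w j"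
    unfolding al_Suc using Suc.prems e_nonneg[of w j] by simp
  also have "\<dots> \<le> R * (c * R ^ j)" using Suc R_pos by simp
  finally show ?case by (simp add: ac_simps)
qed (simp add: al_def)

text \<open>The factor R - x costs at most R per step, while the rank-one term adds at most
  \<open>R ^ Suc j\<close>, since \<open>w * c \<le> 1\<close>. Hence the linear factor
  \<open>Suc j\<close>, harmless for a geometric series of ratio R / (p + R).\<close>

lemma G_le:
  assumes "w \<ge> 0" "w * c \<le> 1" "0 < x" "x \<le> R"
  shows "G w j x \<le> real (Suc j) * R ^ j"
proof (induction j)
  case (Suc j)
  have "w * e w j \<le> w * (R * (c * R ^ j))"
    using e_le_al[of w j] al_le[of w j] assms R_pos
    by (intro mult_left_mono) (auto intro: order_trans mult_left_mono)
  also have "\<dots> = (w * c) * R ^ Suc j" by simp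
  also have "\<dots> \<le> 1 * R ^ Suc j"
    using assms R_pos by (intro mult_right_mono) auto
  finally have 1: "w * e w j \<le> R ^ Suc j" by simp
  have "(R - x) * G w j x \<le> R * (real (Suc j) * R ^ j)"
    using assms Suc R_pos G_nonneg[of w x j] by (intro mult_mono) auto
  then show ?case using 1 by (simp add: e_def algebra_simps)
qed simp

text \<open>Self-adjointness of R - B in L^2(x dM): its multiplication part and its rank-one part
  are both symmetric, so one factor R - B moves across the inner product at each induction
  step.\<close>

lemma e_add: "e w (i + k) = (\<integral>x. x * G w i x * G w k x \<partial>M)"
proof (induction i arbitrary: k)
  case (Suc i)
  have *: "(\<integral>x. x * G w (Suc a) x * G w b x \<partial>M) = (\<integral>x. x * (R - x) * G w a x * G w b x \<partial>M) + w * e w a * e w b" for a b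
  proof -
    have "(\<integral>x. x * G w (Suc a) x * G w b x \<partial>M) =
       (\<integral>x. x * (R - x) * G w a x * G w b x + w * e w a * (x * G w b x) \<partial>M)"
      unfolding e_def by (simp add: algebra_simps)
    also have "\<dots> = (\<integral>x. x * (R - x) * G w a x * G w b x \<partial>M) + (\<integral>x. w * e w a * (x * G w b x) \<partial>M)"
      by (subst Bochner_Integration.integral_add)
        (intro integrable_cont continuous_intros refl)+
    also have "(\<integral>x. w * e w a * (x * G w b x) \<partial>M) = w * e w a * e w b"
      unfolding e_def[of w b] by simp
    finally show ?thesis .
  qed
  have "e w (Suc i + k) = (\<integral>x. x * G w (Suc k) x * G w i x \<partial>M)"
    using Suc[of "Suc k"] by (simp add: mult_ac del: G.simps)
  also have "\<dots> = (\<integral>x. x * G w (Suc i) x * G w k x \<partial>M)"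
    unfolding * by (simp add: mult_ac)
  finally show ?case .
qed (simp add: e_def)

text \<open>Expand the square of h - w m, with m the integral of h; \<open>w * c \<le> 1\<close>
  absorbs the quadratic term. For h(x) = x g(x) this is <g, B g> \<ge> 0.\<close>

lemma Cauchy_Schwarz_M:
  fixes h :: "real \<Rightarrow> real"
  assumes h: "continuous_on UNIV h" and "0 \<le> w" "w * c \<le> 1"
  shows "w * (\<integral>x. h x \<partial>M)\<^sup>2 \<le> (\<integral>x. (h x)\<^sup>2 \<partial>M)"
proof -
  define m where "m = (\<integral>x. h x \<partial>M)"
  have "0 \<le> (\<integral>x. (h x - w * m)\<^sup>2 \<partial>M)" by simp
  also have "\<dots> = (\<integral>x. (h x)\<^sup>2 - 2 * w * m * h x + (w * m)\<^sup>2 \<partial>M)"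
    by (simp add: power2_diff algebra_simps)
  also have "\<dots> = (\<integral>x. (h x)\<^sup>2 \<partial>M) - 2 * w * m * m + c * (w * m)\<^sup>2"
    unfolding m_def
    by (subst Bochner_Integration.integral_add Bochner_Integration.integral_diff,
        (intro integrable_cont continuous_intros h)+)+ simp
  finally have "2 * w * m\<^sup>2 - (w * c) * (w * m\<^sup>2) \<le> (\<integral>x. (h x)\<^sup>2 \<partial>M)"
    by (simp add: power2_eq_square algebra_simps)
  moreover have "(w * c) * (w * m\<^sup>2) \<le> 1 * (w * m\<^sup>2)"
    by (intro mult_right_mono) (use assms in auto)
  ultimately show ?thesis by (simp add: m_def)
qed

text \<open>\<open>B\<close> is symmetric on \<open>L\<^sup>2(x dM)\<close> with \<open>0 \<le> B \<le> R\<close>, and \<open>e w j = \<langle>1, (R - B)\<^sup>j 1\<rangle>\<close>, so the claim is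
  \<open>\<langle>1, B (R - B)\<^sup>j 1\<rangle> \<ge> 0\<close>. For odd \<open>j\<close> use \<open>R B (R - B) = B (R - B) B + (R - B) B (R - B)\<close>.\<close>

lemma e_Suc_le:
  assumes w: "0 \<le> w" "w * c \<le> 1"
  shows "e w (Suc j) \<le> R * e w j"
proof -
  have even: "e w (Suc (i + i)) \<le> R * e w (i + i)" for i
  proof -
    have "R * e w (i + i) - e w (i + Suc i) =
      (\<integral>x. R * (x * G w i x * G w i x) - (x * G w i x * G w (Suc i) x) \<partial>M)"
      unfolding e_add
      by (subst Bochner_Integration.integral_diff) ((intro integrable_cont continuous_intros refl)+, simp)
    also have "\<dots> = (\<integral>x. (x * G w i x)\<^sup>2 - w * e w i * (x * G w i x) \<partial>M)"
      unfolding e_def by (intro Bochner_Integration.integral_cong refl) (simp add: algebra_simps power2_eq_square)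
    also have "\<dots> = (\<integral>x. (x * G w i x)\<^sup>2 \<partial>M) - w * e w i * e w i"
      by (subst Bochner_Integration.integral_diff) ((intro integrable_cont continuous_intros refl)+, simp add: e_def)
    also have "\<dots> \<ge> 0"
      using Cauchy_Schwarz_M[of "\<lambda>x. x * G w i x" w] w
      by (simp add: e_def power2_eq_square continuous_intros mult.assoc)
    finally show ?thesis by simp
  qed
  have odd: "e w (Suc (Suc (i + i))) \<le> R * e w (Suc (i + i))" for i
  proof -
    \<comment> \<open>\<open>b\<close> is B (R - B)^i 1. The first expression below is <b, (R - B)
      b>, nonnegative because R - x \<ge> 0 on the support and the rank-one part contributes w
      m^2.\<close>
    define b where "b x = R * G w i x - G w (Suc i) x" for x
    have bc[continuous_intros]: "continuous_on UNIV b" unfolding b_def by (intro continuous_intros)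
    define m where "m = (\<integral>x. x * b x \<partial>M)"
    have m: "m = R * e w i - e w (Suc i)"
      unfolding m_def b_def e_def right_diff_distrib
      by (subst Bochner_Integration.integral_diff)
        ((intro integrable_cont continuous_intros refl)+, simp add: mult.left_commute[of _ R] del: G.simps)
    have "0 \<le> (\<integral>x. x * (R - x) * (b x)\<^sup>2 \<partial>M) + w * m * m"
      using w by (intro add_nonneg_nonneg integral_nonneg_supp continuous_intros) (auto simp: mult.assoc)
    also have "\<dots> = (\<integral>x. x * (R - x) * (b x)\<^sup>2 + w * m * (x * b x) \<partial>M)"
      by (subst Bochner_Integration.integral_add) ((intro integrable_cont continuous_intros refl)+, simp add: m_def)
    also have "\<dots> = (\<integral>x. (R * R) * (x * G w i x * G w (Suc i) x) - R * (x * G w i x * G w (Suc (Suc i)) x)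
         - R * (x * G w (Suc i) x * G w (Suc i) x) + x * G w (Suc i) x * G w (Suc (Suc i)) x \<partial>M)"
    proof (intro Bochner_Integration.integral_cong refl)
      fix x
      have "(R - x) * b x + w * m = R * G w (Suc i) x - G w (Suc (Suc i)) x"
        unfolding m b_def G.simps(2)[of w "Suc i"] e_def[symmetric] by (simp add: e_def algebra_simps)
      then have "x * b x * ((R - x) * b x + w * m) = x * b x * (R * G w (Suc i) x - G w (Suc (Suc i)) x)"
        by simp
      then show "x * (R - x) * (b x)\<^sup>2 + w * m * (x * b x) = (R * R) * (x * G w i x * G w (Suc i) x) - R * (x * G w i x * G w (Suc (Suc i)) x)
         - R * (x * G w (Suc i) x * G w (Suc i) x) + x * G w (Suc i) x * G w (Suc (Suc i)) x"
        unfolding b_def power2_eq_square by (simp add: algebra_simps del: G.simps)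
    qed
    also have "\<dots> = R * R * e w (i + Suc i) - R * e w (i + Suc (Suc i)) - R * e w (Suc i + Suc i) + e w (Suc i + Suc (Suc i))"
      unfolding e_add
      by (subst Bochner_Integration.integral_add Bochner_Integration.integral_diff,
        (intro integrable_cont continuous_intros)+)+ simp
    finally have "0 \<le> R * (R * e w (Suc (i + i)) - e w (Suc (Suc (i + i)))) - (R * e w (Suc i + Suc i) - e w (Suc (Suc i + Suc i)))"
      by (simp add: algebra_simps)
    then have "0 \<le> R * (R * e w (Suc (i + i)) - e w (Suc (Suc (i + i))))"
      using even[of "Suc i"] by linarith
    then show ?thesis using R_pos by (simp add: zero_le_mult_iff)
  qed
  show ?thesis
  proof (cases "even j")
    case True
    then obtain i where "j = i + i" by (metis evenE mult_2)
    then show ?thesis using even by simp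
  next
    case False
    then obtain i where "j = Suc (i + i)" by (metis oddE mult_2 Suc_eq_plus1)
    then show ?thesis using odd by simp
  qed
qed


section \<open>The time evolution: monotonicity, convexity and Laplace transforms\<close>

text \<open>Factoring exp(- t B) = exp(- R t) exp(t (R - B)) expands around the operator R - B with
  positive kernel. The coefficients \<open>al\<close> and \<open>e\<close> are then nonnegative, and
  sums can be exchanged with integrals by monotone convergence.\<close>

definition S :: "(nat \<Rightarrow> real) \<Rightarrow> real \<Rightarrow> real" where
  "S s t = exp (- R * t) * (\<Sum>j. s j / fact j * t ^ j)"

definition u where "u l t = z l * S (al (z l)) t"
definition f where "f l t = l * (z l)\<^sup>2 * S (e (z l)) t"

lemma S_summable:
  fixes t :: real
  assumes "\<And>j. \<bar>s j\<bar> \<le> A * B ^ j"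
  shows "summable (\<lambda>j. s j / fact j * t ^ j)"
  using has_real_derivative_exp_series(2)[of s A B t] assms by blast

lemma S_nonneg: "(\<And>j. \<bar>s j\<bar> \<le> A * B ^ j) \<Longrightarrow> (\<And>j. 0 \<le> s j) \<Longrightarrow> 0 \<le> t \<Longrightarrow> 0 \<le> S s t"
  unfolding S_def by (intro mult_nonneg_nonneg suminf_nonneg S_summable) auto

lemma S_deriv: "(\<And>j. \<bar>s j\<bar> \<le> A * B ^ j) \<Longrightarrow>
    (S s has_real_derivative S (\<lambda>j. s (Suc j) - R * s j) t) (at t)"
  unfolding S_def by (rule has_real_derivative_exp_series(1))

lemma S_cmult: "S (\<lambda>j. a * s j) t = a * S s t" if "\<And>j. \<bar>s j\<bar> \<le> A * B ^ j"
  unfolding S_def using suminf_mult[OF S_summable[OF that], of a t] by (simp add: mult.assoc)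

lemma al_bound: "l \<ge> 0 \<Longrightarrow> \<bar>al (z l) j\<bar> \<le> c * R ^ j"
  using al_nonneg[of "z l" j] al_le[of "z l" j] z_pos[of l] z_c_le[of l] by simp

lemma e_bound: assumes "l \<ge> 0" shows "\<bar>e (z l) j\<bar> \<le> (R * c) * R ^ j"
proof -
  have "R * al (z l) j \<le> R * (c * R ^ j)"
    using al_bound[OF assms, of j] R_pos by (intro mult_left_mono) auto
  then show ?thesis
    using e_nonneg[of "z l" j] e_le_al[of "z l" j] z_pos[OF assms] by (simp only: mult.assoc) linarith
qed

lemma u_deriv: assumes "l \<ge> 0" shows "(u l has_real_derivative - f l t) (at t)"
proof -
  have "(u l has_real_derivative z l * S (\<lambda>j. al (z l) (Suc j) - R * al (z l) j) t) (at t)"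
    unfolding u_def using S_deriv[OF al_bound[OF assms]] by (rule DERIV_cmult)
  also have "(\<lambda>j. al (z l) (Suc j) - R * al (z l) j) = (\<lambda>j. (- l * z l) * e (z l) j)"
    unfolding al_Suc z_c[OF assms] by auto
  also have "z l * S \<dots> t = - f l t"
    unfolding f_def by (subst S_cmult[OF e_bound[OF assms]]) (simp add: power2_eq_square)
  finally show ?thesis .
qed

lemma f_nonneg: "l \<ge> 0 \<Longrightarrow> t \<ge> 0 \<Longrightarrow> 0 \<le> f l t"
  unfolding f_def using S_nonneg[OF e_bound[of l], of t] e_nonneg z_pos[of l] by simp

text \<open>The coefficients of - f' are multiples of \<open>R * e w j - e w (Suc j)\<close>,
  nonnegative by \<open>e_Suc_le\<close>. Together with \<open>u_deriv\<close> this is convexity of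
  \<open>u\<close> in time.\<close>

lemma f_antimono: assumes l: "l \<ge> 0" and "0 \<le> r" "r \<le> t" shows "f l t \<le> f l r"
proof (rule DERIV_nonpos_imp_nonincreasing[OF assms(3)])
  have Re: "R * e (z l) j \<le> (R * R * c) * R ^ j" for j
  proof -
    have "R * e (z l) j \<le> R * ((R * c) * R ^ j)"
      using e_bound[OF l, of j] R_pos by (intro mult_left_mono) auto
    then show ?thesis by (simp only: mult.assoc)
  qed
  fix x assume x: "r \<le> x" "x \<le> t"
  have "(f l has_real_derivative l * (z l)\<^sup>2 * S (\<lambda>j. e (z l) (Suc j) - R * e (z l) j) x) (at x)"
    unfolding f_def using S_deriv[OF e_bound[OF l]] by (rule DERIV_cmult)
  moreover have "S (\<lambda>j. e (z l) (Suc j) - R * e (z l) j) x = - S (\<lambda>j. R * e (z l) j - e (z l) (Suc j)) x"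
  proof -
    have "\<bar>e (z l) (Suc j) - R * e (z l) j\<bar> \<le> (R * R * c) * R ^ j" for j
      using Re[of j] e_nonneg[of "z l" "Suc j"] e_Suc_le[of "z l" j] z_pos[OF l] z_c_le[OF l] by linarith
    from S_cmult[of _ _ _ "-1", OF this] show ?thesis by simp
  qed
  moreover have "0 \<le> S (\<lambda>j. R * e (z l) j - e (z l) (Suc j)) x"
  proof (rule S_nonneg)
    fix j show "0 \<le> R * e (z l) j - e (z l) (Suc j)"
      using e_Suc_le[of "z l" j] z_pos[OF l] z_c_le[OF l] by simp
    then show "\<bar>R * e (z l) j - e (z l) (Suc j)\<bar> \<le> (R * R * c) * R ^ j"
      using Re[of j] e_nonneg[of "z l" "Suc j"] z_pos[OF l] by linarith
  qed (use x assms in auto)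
  ultimately show "\<exists>y. (f l has_real_derivative y) (at x) \<and> y \<le> 0"
    using l z_pos[OF l] by (intro exI conjI) auto
qed

lemma u_antimono: assumes l: "l \<ge> 0" and "0 \<le> r" "r \<le> t" shows "u l t \<le> u l r"
proof (rule DERIV_nonpos_imp_nonincreasing[OF assms(3)])
  fix x assume "r \<le> x" "x \<le> t"
  then show "\<exists>y. (u l has_real_derivative y) (at x) \<and> y \<le> 0"
    using u_deriv[OF l, of x] f_nonneg[OF l, of x] assms by (intro exI conjI) auto
qed

text \<open>Convexity makes the decrement over a window of length h largest when the window starts
  at 0. A bound near time 0 thus becomes a modulus of continuity at all times.\<close>

lemma u_increment: assumes l: "l \<ge> 0" and "0 \<le> t" "0 \<le> h"
  shows "u l t - u l (t + h) \<le> u l 0 - u l h"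
proof -
  define d where "d t = u l t - u l (t + h)" for t
  have "d t \<le> d 0"
  proof (rule DERIV_nonpos_imp_nonincreasing[OF assms(2)])
    fix x :: real assume x: "0 \<le> x" "x \<le> t"
    have "(d has_real_derivative (- f l x - (- f l (x + h)))) (at x)"
      unfolding d_def
      by (intro derivative_intros u_deriv[OF l])
        (use DERIV_shift[of "u l" "- f l (x + h)" x h] u_deriv[OF l] in auto)
    moreover have "f l (x + h) \<le> f l x" using f_antimono[OF l, of x "x + h"] x assms by simp
    ultimately show "\<exists>y. (d has_real_derivative y) (at x) \<and> y \<le> 0"
      by (intro exI conjI) auto
  qed
  then show ?thesis by (simp add: d_def)
qed

lemma u_at_0: "u l 0 = z l * c"
  unfolding u_def S_def using powser_zero[of "\<lambda>j. al (z l) j / fact j"] by (simp add: al_def)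

text \<open>The factor l in \<open>f\<close> makes the time derivative vanish. This is what gives
  total mass 1 to the mixture in \<open>u_mixture\<close>.\<close>

lemma u_0_eq_1: "u 0 t = 1"
proof -
  have "(u 0 has_real_derivative 0) (at x)" for x using u_deriv[of 0 x] by (simp add: f_def)
  then have "u 0 t = u 0 0" by (intro DERIV_isconst_all) auto
  then show ?thesis using c_pos by (simp add: u_at_0 z_def)
qed

lemma u_nonneg: "l \<ge> 0 \<Longrightarrow> t \<ge> 0 \<Longrightarrow> 0 \<le> u l t"
  unfolding u_def using S_nonneg[OF al_bound[of l], of t] al_nonneg z_pos[of l] by simp

lemma u_le_1: "l \<ge> 0 \<Longrightarrow> t \<ge> 0 \<Longrightarrow> u l t \<le> 1"
  using u_antimono[of l 0 t] z_c_le[of l] by (simp add: u_at_0)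

lemma u_isCont: "l \<ge> 0 \<Longrightarrow> isCont (u l) t"
  using u_deriv DERIV_isCont by blast

lemma nn_integral_S:
  assumes s: "\<And>j. s j \<le> A * B ^ j" "\<And>j. 0 \<le> s j" and p: "p > 0"
    and sm: "summable (\<lambda>j. s j / (p + R) ^ Suc j)"
  shows "(\<integral>\<^sup>+t. ennreal (exp (- p * t) * S s t) * indicator {0<..} t \<partial>lborel) = ennreal (\<Sum>j. s j / (p + R) ^ Suc j)"
proof -
  have *: "ennreal (exp (- p * t) * S s t) * indicator {0<..} t
     = (\<Sum>j. ennreal (s j) * (ennreal (t ^ j / fact j * exp (- (p + R) * t)) * indicator {0<..} t))" for t
  proof (cases "t > 0")
    case True
    have sm': "summable (\<lambda>j. s j / fact j * t ^ j)" using S_summable[of s A B t] s by simp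
    have "(\<Sum>j. ennreal (s j) * (ennreal (t ^ j / fact j * exp (- (p + R) * t)) * indicator {0<..} t))
       = (\<Sum>j. ennreal (exp (- (p + R) * t) * (s j / fact j * t ^ j)))"
      using True s by (intro suminf_cong) (simp add: ennreal_mult[symmetric] field_simps)
    also have "\<dots> = ennreal (\<Sum>j. exp (- (p + R) * t) * (s j / fact j * t ^ j))"
      using True s by (intro suminf_ennreal2 summable_mult sm') auto
    also have "\<dots> = ennreal (exp (- p * t) * S s t)"
      unfolding suminf_mult[OF sm'] S_def by (simp add: mult_exp_exp mult.assoc[symmetric] ring_distribs)
    finally show ?thesis using True by simp
  qed simp
  have "(\<integral>\<^sup>+t. ennreal (exp (- p * t) * S s t) * indicator {0<..} t \<partial>lborel) =
     (\<Sum>j. ennreal (s j) * ennreal (1 / (p + R) ^ Suc j))"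
    unfolding * using p R_pos
    by (subst nn_integral_suminf, simp, intro suminf_cong)
      (subst nn_integral_cmult, simp, subst nn_integral_power_exp, auto)
  also have "\<dots> = (\<Sum>j. ennreal (s j / (p + R) ^ Suc j))"
    using s p R_pos by (intro suminf_cong) (simp add: ennreal_mult[symmetric])
  also have "\<dots> = ennreal (\<Sum>j. s j / (p + R) ^ Suc j)"
    using s p R_pos by (intro suminf_ennreal2 sm) auto
  finally show ?thesis .
qed

text \<open>Neumann series of (p + B)^(-1) 1 around p + R, paired with 1/x. Its sum solves a
  rank-one equation that is closed by integrating it once against x.\<close>

lemma resolvent_series:
  assumes l: "l \<ge> 0" and p: "p > 0"
  shows "(\<lambda>j. al (z l) j / (p + R) ^ Suc j) sums (K p / (p * K p + l) / z l)"
proof -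
  let ?w = "z l"
  define P where "P = p + R"
  define q where "q = R / P"
  have P: "P > 0" and q: "0 < q" "q < 1" using p R_pos by (auto simp: P_def q_def)
  have qs: "summable (\<lambda>j. real (Suc j) * q ^ j)"
    using geometric_deriv_sums[of q] q by (auto simp: sums_iff)
  have w: "?w \<ge> 0" "?w * c \<le> 1" using z_pos[OF l] z_c_le[OF l] by auto
  define Fs where "Fs j x = G ?w j x / P ^ Suc j" for j x
  have Fs_le: "\<bar>Fs j x\<bar> \<le> 1 / P * (real (Suc j) * q ^ j)" if "0 < x" "x \<le> R" for j x
  proof -
    have "\<bar>G ?w j x\<bar> \<le> real (Suc j) * R ^ j" using G_le[OF w that] G_nonneg[OF w(1) that] by simp
    then show ?thesis unfolding Fs_def q_def using P by (simp add: field_simps power_divide)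
  qed
  have Fs_cont [continuous_intros]: "continuous_on UNIV (Fs j)" for j
    unfolding Fs_def by (intro continuous_intros) (use P in auto)
  have sm: "summable (\<lambda>j. Fs j x)" if "0 < x" "x \<le> R" for x
    by (rule summable_comparison_test'[OF summable_mult[OF qs, of "1 / P"], of 0]) (use Fs_le[OF that] in auto)
  have smn: "summable (\<lambda>j. norm (Fs j x))" if "0 < x" "x \<le> R" for x
    by (rule summable_comparison_test'[OF summable_mult[OF qs, of "1 / P"], of 0]) (use Fs_le[OF that] in auto)
  have int_Fs: "(\<lambda>j. \<integral>x. g x * Fs j x \<partial>M) sums (\<integral>x. (\<Sum>j. g x * Fs j x) \<partial>M)"
    if g: "continuous_on UNIV g" "\<And>x. 0 < x \<Longrightarrow> x \<le> R \<Longrightarrow> \<bar>g x\<bar> \<le> D" for g D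
  proof (rule sums_integral)
    show "AE x in M. summable (\<lambda>j. norm (g x * Fs j x))"
      using supp by eventually_elim (use smn summable_mult in \<open>simp add: abs_mult\<close>)
    have D: "D \<ge> 0" using g(2)[of R] R_pos by simp
    have "norm (\<integral>x. norm (g x * Fs j x) \<partial>M) \<le> c * D * (1 / P) * (real (Suc j) * q ^ j)" for j
    proof -
      have "(\<integral>x. norm (g x * Fs j x) \<partial>M) \<le> (\<integral>x. D * (1 / P * (real (Suc j) * q ^ j)) \<partial>M)"
        by (intro integral_le_supp continuous_intros g(1))
          (auto simp: abs_mult simp del: of_nat_Suc intro!: mult_mono[OF g(2) Fs_le[unfolded times_divide_eq_left mult_1], simplified times_divide_eq_right] D)
      then show ?thesis by (simp add: mult_ac)
    qed
    then show "summable (\<lambda>j. \<integral>x. norm (g x * Fs j x) \<partial>M)"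
      by (intro summable_comparison_test'[OF summable_mult[OF qs, of "c * D * (1 / P)"], of 0]) blast
  qed (intro integrable_cont continuous_intros g)
  define E where "E = (\<Sum>j. e ?w j / P ^ Suc j)"
  have e_sums0: "(\<lambda>j. e ?w j / P ^ Suc j) sums (\<integral>x. (\<Sum>j. x * Fs j x) \<partial>M)"
    using int_Fs[of "\<lambda>x. x" R] by (simp add: Fs_def e_def)
  then have e_sums: "(\<lambda>j. e ?w j / P ^ Suc j) sums E" unfolding E_def by (simp add: sums_iff)
  have al_sums: "(\<lambda>j. al ?w j / P ^ Suc j) sums (\<integral>x. (\<Sum>j. Fs j x) \<partial>M)"
    using int_Fs[of "\<lambda>x. 1" 1] by (simp add: Fs_def al_def)
  \<comment> \<open>Shifting the index turns the recursion of \<open>G\<close> into (p + x) g = 1 +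
    w E for the sum g, where E is the integral of x g.\<close>
  have Fx: "(\<Sum>j. Fs j x) = (1 + ?w * E) / (p + x)" if x: "0 < x" "x \<le> R" for x
  proof -
    have "(\<lambda>j. (R - x) * Fs j x + ?w * (e ?w j / P ^ Suc j)) sums ((R - x) * (\<Sum>j. Fs j x) + ?w * E)"
      by (intro sums_add sums_mult e_sums summable_sums sm x)
    moreover have "(R - x) * Fs j x + ?w * (e ?w j / P ^ Suc j) = P * Fs (Suc j) x" for j
      unfolding Fs_def using P by (simp add: field_simps e_def)
    ultimately have "(\<lambda>j. P * Fs (Suc j) x) sums ((R - x) * (\<Sum>j. Fs j x) + ?w * E)" by simp
    moreover have "(\<lambda>j. P * Fs (Suc j) x) sums (P * ((\<Sum>j. Fs j x) - Fs 0 x))"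
      by (intro sums_mult) (use summable_sums[OF sm[OF x]] in \<open>subst sums_Suc_iff, simp\<close>)
    ultimately have "P * (\<Sum>j. Fs j x) - 1 = (R - x) * (\<Sum>j. Fs j x) + ?w * E"
      using P by (simp add: sums_iff Fs_def right_diff_distrib)
    then show ?thesis using p x by (simp add: P_def field_simps)
  qed
  have int1: "integrable M (\<lambda>x. 1 / (p + x))"
    by (rule integrable_bdd[where B = "1 / p"]) (use p in \<open>auto simp: field_simps\<close>)
  have "(\<integral>x. (\<Sum>j. Fs j x) \<partial>M) = (\<integral>x. (1 + ?w * E) * (1 / (p + x)) \<partial>M)"
  proof (rule integral_cong_AE)
    show "AE x in M. (\<Sum>j. Fs j x) = (1 + ?w * E) * (1 / (p + x))"
      using supp by eventually_elim (simp add: Fx)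
  qed (simp_all add: Fs_def)
  also have "\<dots> = (1 + ?w * E) * K p" unfolding K_def by (rule integral_mult_right_zero)
  finally have A: "(\<integral>x. (\<Sum>j. Fs j x) \<partial>M) = (1 + ?w * E) * K p" .
  have "E = (\<integral>x. (\<Sum>j. x * Fs j x) \<partial>M)" using e_sums e_sums0 sums_unique2 by blast
  also have "\<dots> = (\<integral>x. (1 + ?w * E) * (1 - p * (1 / (p + x))) \<partial>M)"
  proof (rule integral_cong_AE)
    show "AE x in M. (\<Sum>j. x * Fs j x) = (1 + ?w * E) * (1 - p * (1 / (p + x)))"
      using supp
    proof eventually_elim
      case (elim x)
      then have "(\<Sum>j. x * Fs j x) = x * ((1 + ?w * E) / (p + x))"
        using Fx[of x] by (simp add: suminf_mult sm)
      then show ?case using elim p by (simp add: field_simps)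
    qed
  qed (simp_all add: Fs_def)
  also have "\<dots> = (1 + ?w * E) * (c - p * K p)"
    unfolding K_def
    by (subst integral_mult_right_zero, subst Bochner_Integration.integral_diff,
        simp, rule integrable_mult_right[OF int1], subst integral_mult_right_zero, simp)
  finally have E: "E = (1 + ?w * E) * (c - p * K p)" .
  have "(1 + ?w * E) * (1 - ?w * (c - p * K p)) = 1"
    using arg_cong[OF E, of "\<lambda>y. ?w * y"] by (simp add: algebra_simps)
  moreover have "1 - ?w * (c - p * K p) = ?w * (l + p * K p)"
    using z_c[OF l] by (simp add: algebra_simps)
  ultimately have 1: "(1 + ?w * E) * ?w * (l + p * K p) = 1" by simp
  then have "l + p * K p \<noteq> 0" "?w \<noteq> 0" by auto
  then have "1 + ?w * E = 1 / (?w * (l + p * K p))"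
    using 1 by (simp add: eq_divide_eq mult.assoc)
  then have "(1 + ?w * E) * K p = K p / (p * K p + l) / ?w"
    by (simp add: add.commute mult.commute)
  then show ?thesis using al_sums A by (simp add: P_def)
qed

lemma u_laplace:
  assumes l: "l \<ge> 0" and p: "p > 0"
  shows "(\<integral>\<^sup>+t. ennreal (exp (- p * t) * u l t) * indicator {0<..} t \<partial>lborel) = ennreal (K p / (p * K p + l))"
proof -
  have "(\<integral>\<^sup>+t. ennreal (exp (- p * t) * u l t) * indicator {0<..} t \<partial>lborel)
     = (\<integral>\<^sup>+t. ennreal (z l) * (ennreal (exp (- p * t) * S (al (z l)) t) * indicator {0<..} t) \<partial>lborel)"
    unfolding u_def
    by (intro nn_integral_cong) (use z_pos[OF l] in \<open>simp add: ennreal_mult'[symmetric] mult_ac split: split_indicator\<close>)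
  also have "\<dots> = ennreal (z l) * (\<integral>\<^sup>+t. (ennreal (exp (- p * t) * S (al (z l)) t) * indicator {0<..} t) \<partial>lborel)"
  proof (rule nn_integral_cmult)
    have "S (al (z l)) \<in> borel_measurable borel"
      using S_deriv[OF al_bound[OF l]] DERIV_isCont
      by (intro borel_measurable_continuous_onI) (auto intro!: continuous_at_imp_continuous_on)
    then show "(\<lambda>t. ennreal (exp (- p * t) * S (al (z l)) t) * indicator {0<..} t) \<in> borel_measurable lborel"
      by simp
  qed
  also have "\<dots> = ennreal (z l) * ennreal (K p / (p * K p + l) / z l)"
    using resolvent_series[OF l p] al_bound[OF l] al_nonneg z_pos[OF l]
    by (subst nn_integral_S[where A = c and B = R, OF _ _ p]) (auto simp: sums_iff abs_le_iff simp del: power_Suc)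
  also have "\<dots> = ennreal (K p / (p * K p + l))"
    using z_pos[OF l] by (simp add: ennreal_mult'[symmetric])
  finally show ?thesis .
qed

text \<open>\<open>u l t\<close> is a power series in z = 1/(c + l) whose coefficients are
  nonnegative by \<open>F_nonneg\<close>, and z^(i+1) is the Laplace transform of s^i exp(- c s) /
  i!. The prefactor z in \<open>u\<close> leaves no constant term, so the law has a density on (0,
  oo) and no atom at 0.\<close>

lemma u_mixture:
  assumes t: "t \<ge> 0"
  shows "\<exists>N. real_distribution N \<and> (AE s in N. s > 0) \<and> (\<forall>l\<ge>0. (\<integral>s. exp (- l * s) \<partial>N) = u l t)"
proof -
  define a where "a j i = exp (- R * t) * (t ^ j / fact j) * (\<integral>x. F j i x \<partial>M)" for j i
  have a0: "a j i \<ge> 0" for j i unfolding a_def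
    using t by (intro mult_nonneg_nonneg integral_nonneg_supp continuous_intros F_nonneg) auto
  define D :: "real \<Rightarrow> ennreal" where "D s = (\<Sum>j. \<Sum>i\<le>j. ennreal (a j i) * (ennreal (s ^ i / fact i * exp (- c * s)) * indicator {0<..} s))" for s
  have D_meas [measurable]: "D \<in> borel_measurable borel" unfolding D_def by measurable
  define N where "N = density lborel D"
  have nn: "(\<integral>\<^sup>+s. ennreal (exp (- l * s)) \<partial>N) = ennreal (u l t)" if l: "l \<ge> 0" for l
  proof -
    have cl: "c + l > 0" using c_pos l by simp
    have "(\<integral>\<^sup>+s. ennreal (exp (- l * s)) \<partial>N) = (\<integral>\<^sup>+s. D s * ennreal (exp (- l * s)) \<partial>lborel)"
      unfolding N_def by (subst nn_integral_density) auto
    also have "\<dots> = (\<integral>\<^sup>+s. (\<Sum>j. \<Sum>i\<le>j. ennreal (a j i) * (ennreal (s ^ i / fact i * exp (- (c + l) * s)) * indicator {0<..} s)) \<partial>lborel)"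
    proof (rule nn_integral_cong)
      fix s :: real
      have "(\<Sum>j. (\<Sum>i\<le>j. ennreal (a j i) * (ennreal (s ^ i / fact i * exp (- (c + l) * s)) * indicator {0<..} s)))
        = (\<Sum>j. (\<Sum>i\<le>j. ennreal (a j i) * (ennreal (s ^ i / fact i * exp (- c * s)) * indicator {0<..} s)) * ennreal (exp (- l * s)))"
        unfolding sum_distrib_right
        by (intro suminf_cong sum.cong refl)
          (auto simp: ennreal_mult'[symmetric] a0 mult_exp_exp algebra_simps split: split_indicator)
      then show "D s * ennreal (exp (- l * s)) = (\<Sum>j. \<Sum>i\<le>j. ennreal (a j i) * (ennreal (s ^ i / fact i * exp (- (c + l) * s)) * indicator {0<..} s))"
        unfolding D_def by (simp add: ennreal_suminf_multc)
    qed
    also have "\<dots> = (\<Sum>j. \<Sum>i\<le>j. ennreal (a j i) * ennreal (1 / (c + l) ^ Suc i))"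
      using nn_integral_power_exp[OF cl]
      by (subst nn_integral_suminf, simp, intro suminf_cong, subst nn_integral_sum, simp)
        (intro sum.cong refl, subst nn_integral_cmult, auto)
    also have "\<dots> = (\<Sum>j. ennreal (z l * exp (- R * t) * (al (z l) j / fact j * t ^ j)))"
    proof (rule suminf_cong)
      fix j
      have "(\<Sum>i\<le>j. ennreal (a j i) * ennreal (1 / (c + l) ^ Suc i)) = ennreal (\<Sum>i\<le>j. a j i * (1 / (c + l) ^ Suc i))"
        using a0 cl by (subst sum_ennreal[symmetric]) (auto simp: ennreal_mult'[symmetric] simp del: power_Suc intro!: mult_nonneg_nonneg)
      also have "al (z l) j = (\<Sum>i\<le>j. (\<integral>x. F j i x \<partial>M) * z l ^ i)"
        unfolding al_def G_eq by (subst Bochner_Integration.integral_sum) (auto intro!: integrable_cont continuous_intros)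
      then have "(\<Sum>i\<le>j. a j i * (1 / (c + l) ^ Suc i)) = z l * exp (- R * t) * (al (z l) j / fact j * t ^ j)"
        by (simp add: a_def z_def power_divide sum_distrib_left sum_distrib_right sum_divide_distrib mult_ac)
      finally show "(\<Sum>i\<le>j. ennreal (a j i) * ennreal (1 / (c + l) ^ Suc i)) = ennreal (z l * exp (- R * t) * (al (z l) j / fact j * t ^ j))" .
    qed
    also have "\<dots> = ennreal (\<Sum>j. z l * exp (- R * t) * (al (z l) j / fact j * t ^ j))"
      using z_pos[OF l] al_nonneg[of "z l"] t
      by (intro suminf_ennreal2 summable_mult S_summable[OF al_bound[OF l]]) auto
    also have "\<dots> = ennreal (u l t)"
      unfolding u_def S_def by (subst suminf_mult[OF S_summable[OF al_bound[OF l]]]) (simp add: mult.assoc)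
    finally show ?thesis .
  qed
  have "emeasure N (space N) = 1"
    using nn[of 0] by (simp add: u_0_eq_1)
  then interpret N: prob_space N by (rule prob_spaceI)
  have N_sets: "sets N = sets borel" by (simp add: N_def)
  have rd: "real_distribution N"
    by (intro real_distribution.intro N.prob_space_axioms real_distribution_axioms.intro)
       (simp_all add: N_def)
  have AE: "AE s in N. s > 0"
    unfolding N_def by (subst AE_density) (auto simp: D_def split: split_indicator)
  have "(\<integral>s. exp (- l * s) \<partial>N) = u l t" if l: "l \<ge> 0" for l
  proof -
    have "(\<integral>s. exp (- l * s) \<partial>N) = enn2real (\<integral>\<^sup>+s. ennreal (exp (- l * s)) \<partial>N)"
      by (rule integral_eq_nn_integral) (auto simp: N_def)
    then show ?thesis using nn[OF l] u_nonneg[OF l t] by simp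
  qed
  then show ?thesis using rd AE by blast
qed


lemma K_pos: "p > 0 \<Longrightarrow> 0 < K p"
proof -
  assume p: "p > 0"
  have "c * (1 / (p + R)) = (\<integral>x. 1 / (p + R) \<partial>M)" by simp
  also have "\<dots> \<le> K p" unfolding K_def
  proof (rule integral_mono_AE)
    show "integrable M (\<lambda>x. 1 / (p + x))"
      by (rule integrable_bdd[where B = "1 / p"]) (use p in \<open>auto simp: field_simps\<close>)
    show "AE x in M. 1 / (p + R) \<le> 1 / (p + x)"
      using supp by eventually_elim (use p in \<open>simp add: frac_le\<close>)
  qed simp
  finally show ?thesis using c_pos p R_pos by (smt (verit) divide_pos_pos mult_pos_pos)
qed

text \<open>Put p = 1/h. By monotonicity 1 - u \<ge> 1 - u(h) on [h, oo), so (1 - u(h)) exp(- 1) / p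
  is at most the Laplace transform of 1 - u at p, which is l / (p (p K + l)). This is where exp 1
  comes from. The truncation enters the bound only through K(1/h), which converges when the
  truncation is removed.\<close>

lemma u_deficit:
  assumes l: "l \<ge> 0" and h: "h > 0"
  shows "1 - u l h \<le> exp 1 * l / (1 / h * K (1 / h) + l)"
proof -
  define p where "p = 1 / h"
  have p: "p > 0" "p * h = 1" using h by (auto simp: p_def)
  have K: "K p > 0" using K_pos p by simp
  have D: "p * K p + l > 0" using K p l by (intro add_pos_nonneg mult_pos_pos) auto
  have [measurable]: "u l \<in> borel_measurable borel"
    by (intro borel_measurable_continuous_onI) (simp add: continuous_at_imp_continuous_on u_isCont l)
  have I: "(\<integral>\<^sup>+t. ennreal (exp (- p * t)) * indicator {a..} t \<partial>lborel) = ennreal (exp (- p * a) / p)" for a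
  proof -
    have "(\<integral>\<^sup>+t. ennreal (exp (- p * t)) * indicator {a..} t \<partial>lborel) = ennreal (0 - (- (exp (- p * a) / p)))"
    proof (rule nn_integral_FTC_atLeast)
      show "((\<lambda>t. - (exp (- p * t) / p)) \<longlongrightarrow> 0) at_top" using p by real_asymp
    qed (use p in \<open>auto intro!: derivative_eq_intros\<close>)
    then show ?thesis by simp
  qed
  have u1: "u l h \<le> 1" using u_le_1 l h by simp
  have "ennreal (K p / (p * K p + l)) + ennreal (1 - u l h) * ennreal (exp (- 1) / p)
     = (\<integral>\<^sup>+t. ennreal (exp (- p * t) * u l t) * indicator {0<..} t \<partial>lborel) +
       (\<integral>\<^sup>+t. ennreal (1 - u l h) * (ennreal (exp (- p * t)) * indicator {h..} t) \<partial>lborel)"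
    using u_laplace[OF l p(1)] I[of h] p by (simp add: nn_integral_cmult)
  also have "\<dots> = (\<integral>\<^sup>+t. ennreal (exp (- p * t) * u l t) * indicator {0<..} t +
       ennreal (1 - u l h) * (ennreal (exp (- p * t)) * indicator {h..} t) \<partial>lborel)"
    by (rule nn_integral_add[symmetric]) auto
  also have "\<dots> \<le> (\<integral>\<^sup>+t. ennreal (exp (- p * t)) * indicator {0..} t \<partial>lborel)"
  proof (rule nn_integral_mono)
    fix t
    show "ennreal (exp (- p * t) * u l t) * indicator {0<..} t + ennreal (1 - u l h) * (ennreal (exp (- p * t)) * indicator {h..} t)
       \<le> ennreal (exp (- p * t)) * indicator {0..} t"
    proof (cases "t \<ge> h")
      case True
      then have "u l t \<le> u l h" "0 \<le> u l t" using u_antimono[of l h t] u_nonneg[of l t] l h by auto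
      then have "exp (- p * t) * u l t + (1 - u l h) * exp (- p * t) \<le> exp (- p * t)"
        by (simp add: algebra_simps)
      then show ?thesis using True h u1 \<open>0 \<le> u l t\<close>
        by (simp add: ennreal_mult[symmetric] ennreal_plus[symmetric] del: ennreal_plus)
    next
      case False
      then show ?thesis using u_le_1[of l t] l by (auto simp: mult_left_le split: split_indicator intro!: ennreal_leI)
    qed
  qed
  also have "\<dots> = ennreal (1 / p)" using I[of 0] by simp
  finally have 1: "K p / (p * K p + l) + (1 - u l h) * (exp (- 1) / p) \<le> 1 / p"
    using u1 K D p by (simp add: ennreal_mult[symmetric] ennreal_plus[symmetric] del: ennreal_plus)
  have "(1 - u l h) * exp (- 1) \<le> 1 - p * K p / (p * K p + l)"
    using p(1) mult_left_mono[OF 1, of p] by (simp add: distrib_left)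
  also have "\<dots> = l / (p * K p + l)" using D by (simp add: field_simps)
  finally have "exp 1 * ((1 - u l h) * exp (- 1)) \<le> exp 1 * (l / (p * K p + l))"
    by (rule mult_left_mono) simp
  moreover have "exp 1 * ((1 - u l h) * exp (- 1)) = 1 - u l h" by (simp add: exp_minus)
  ultimately show ?thesis by (simp add: p_def)
qed

end

section \<open>Removing the truncation\<close>

lemma stieltjes_kernel_le:
  fixes p t :: real
  assumes "p > 0" "t \<ge> 0"
  shows "1 / (p + t) \<le> (1 + 1 / p) / (1 + t)"
proof -
  have "(1 + 1 / p) * (p + t) = 1 + t + p + t / p" using assms by (simp add: field_simps)
  then show ?thesis using assms by (simp add: divide_le_eq pos_le_divide_eq mult.commute)
qed

locale stieltjes_kernel =
  fixes \<sigma> :: "real measure" and K :: "real \<Rightarrow> real"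
  assumes sets_sigma [measurable_cong, simp]: "sets \<sigma> = sets borel"
    and sigma_pos: "AE t in \<sigma>. t > 0"
    and sigma_int: "integrable \<sigma> (\<lambda>t. 1 / (1 + t))"
    and K_eq: "\<And>p. p > 0 \<Longrightarrow> K p = (\<integral>t. 1 / (p + t) \<partial>\<sigma>)"
    and pK_top: "filterlim (\<lambda>p. p * K p) at_top at_top"
begin

lemma space_sigma [simp]: "space \<sigma> = UNIV"
  using sets_eq_imp_space_eq[OF sets_sigma] by simp

lemma sigma_int_p: assumes "p > 0" shows "integrable \<sigma> (\<lambda>t. 1 / (p + t))"
proof (rule Bochner_Integration.integrable_bound)
  show "integrable \<sigma> (\<lambda>t. (1 + 1 / p) * (1 / (1 + t)))"
    by (intro integrable_mult_right sigma_int)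
  show "AE t in \<sigma>. norm (1 / (p + t)) \<le> norm ((1 + 1 / p) * (1 / (1 + t)))"
    using sigma_pos
    by eventually_elim (use stieltjes_kernel_le[OF assms] assms in simp)
qed simp

lemma K_nonneg: "p > 0 \<Longrightarrow> 0 \<le> K p"
  unfolding K_eq using sigma_pos
  by (intro integral_nonneg_AE) (auto elim!: eventually_mono)

text \<open>If K vanished at one point, sigma would be null and K zero everywhere, against p K(p) ->
  oo.\<close>

lemma K_pos: assumes "p > 0" shows "0 < K p"
proof (rule ccontr)
  assume "\<not> 0 < K p"
  then have "(\<integral>t. 1 / (p + t) \<partial>\<sigma>) = 0" using K_nonneg[OF assms] K_eq[OF assms] by simp
  then have "AE t in \<sigma>. 1 / (p + t) = 0"
    using sigma_int_p[OF assms] sigma_pos assms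
    by (subst (asm) integral_nonneg_eq_0_iff_AE) (auto elim!: eventually_mono)
  then have "AE t in \<sigma>. False" using sigma_pos by eventually_elim (use assms in auto)
  then have "K q = 0" if "q > 0" for q
    unfolding K_eq[OF that] by (intro integral_eq_zero_AE) (auto elim: eventually_mono)
  moreover have "eventually (\<lambda>q. 1 \<le> q * K q) at_top"
    using pK_top by (auto simp: filterlim_at_top)
  then have "\<exists>q>0. 1 \<le> q * K q"
    by (auto dest!: eventually_happens[OF eventually_conj[OF eventually_gt_at_top[of 0]]])
  ultimately show False by auto
qed

definition Mn where "Mn n = density \<sigma> (indicator {..real n + 1})"

lemma integral_Mn: "g \<in> borel_measurable borel \<Longrightarrow> (\<integral>t. g t \<partial>Mn n) = (\<integral>t. indicator {..real n + 1} t * g t \<partial>\<sigma>)" for g :: "real \<Rightarrow> real"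
  unfolding Mn_def ennreal_indicator[symmetric] by (subst integral_density) auto

lemma Mn_finite: "finite_measure (Mn n)"
proof
  have "emeasure (Mn n) (space (Mn n)) = (\<integral>\<^sup>+t. indicator {..real n + 1} t \<partial>\<sigma>)"
    unfolding Mn_def by (simp add: emeasure_density)
  also have "\<dots> \<le> (\<integral>\<^sup>+t. ennreal (real n + 2) * ennreal (1 / (1 + t)) \<partial>\<sigma>)"
  proof (rule nn_integral_mono_AE, use sigma_pos in eventually_elim)
    fix t :: real assume t: "0 < t"
    have "ennreal 1 \<le> ennreal ((real n + 2) * (1 / (1 + t)))" if "t \<le> real n + 1"
      using that t by (intro ennreal_leI) (simp add: pos_le_divide_eq)
    then show "indicator {..real n + 1} t \<le> ennreal (real n + 2) * ennreal (1 / (1 + t))"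
      using t by (subst ennreal_mult[symmetric]) (auto split: split_indicator)
  qed
  also have "\<dots> = ennreal (real n + 2) * ennreal (\<integral>t. 1 / (1 + t) \<partial>\<sigma>)"
    using sigma_pos
    by (subst nn_integral_cmult, simp, subst nn_integral_eq_integral[OF sigma_int]) (auto elim!: eventually_mono)
  finally show "emeasure (Mn n) (space (Mn n)) \<noteq> \<infinity>"
    by (auto simp: ennreal_mult_eq_top_iff top_unique)
qed

lemma Mn_mass: "eventually (\<lambda>n. measure (Mn n) UNIV > 0) sequentially"
proof -
  obtain n0 where n0: "emeasure \<sigma> {..real n0 + 1} \<noteq> 0"
  proof (rule ccontr)
    assume "\<not> thesis"
    then have z: "emeasure \<sigma> {..real n + 1} = 0" for n using that by blast
    have "AE t in \<sigma>. \<forall>n. \<not> t \<le> real n + 1"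
      unfolding AE_all_countable
      by (intro allI AE_I'[of "{..real _ + 1}"]) (auto simp: z null_sets_def)
    then have "AE t in \<sigma>. False"
      by eventually_elim (metis add.commute add_increasing real_arch_simple zero_le_one)
    then have "K 1 = 0" unfolding K_eq[OF zero_less_one]
      by (intro integral_eq_zero_AE) (auto elim: eventually_mono)
    then show False using K_pos[of 1] by simp
  qed
  have "measure (Mn n) UNIV > 0" if "n \<ge> n0" for n
  proof -
    interpret finite_measure "Mn n" by (rule Mn_finite)
    have "emeasure \<sigma> {..real n0 + 1} \<le> emeasure \<sigma> {..real n + 1}"
      using that by (intro emeasure_mono) auto
    also have "\<dots> = emeasure (Mn n) UNIV" by (simp add: Mn_def emeasure_density)
    finally have "emeasure (Mn n) UNIV \<noteq> 0" using n0 by auto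
    then show ?thesis
      by (metis emeasure_eq_measure ennreal_0 zero_less_measure_iff)
  qed
  then show ?thesis by (auto simp: eventually_sequentially)
qed

text \<open>Early truncations may be zero, against \<open>mass_pos\<close>; starting at
  \<open>n0\<close> makes every member of the sequence an instance of the locale.\<close>

definition n0 where "n0 = (SOME n. \<forall>m\<ge>n. measure (Mn m) UNIV > 0)"
definition M where "M n = Mn (n0 + n)"
definition R where "R n = real (n0 + n) + 1"

lemma n0: "m \<ge> n0 \<Longrightarrow> measure (Mn m) UNIV > 0"
proof -
  have "\<exists>n. \<forall>m\<ge>n. measure (Mn m) UNIV > 0" using Mn_mass by (simp add: eventually_sequentially)
  from someI_ex[OF this] show "m \<ge> n0 \<Longrightarrow> measure (Mn m) UNIV > 0" unfolding n0_def by blast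
qed

sublocale T: truncated_stieltjes "M n" "R n" for n
proof -
  interpret finite_measure "M n" unfolding M_def by (rule Mn_finite)
  show "truncated_stieltjes (M n) (R n)"
  proof
    show "AE x in M n. 0 < x \<and> x \<le> R n"
      unfolding M_def R_def Mn_def
      by (subst AE_density, simp, use sigma_pos in eventually_elim) (auto split: split_indicator_asm)
    show "sets (M n) = sets borel" by (simp add: M_def Mn_def)
  qed (use n0 in \<open>auto simp: M_def R_def\<close>)
qed

abbreviation "Kn n p \<equiv> T.K n p"
abbreviation "un n l t \<equiv> T.u n l t"

lemma Kn_lim: assumes "p > 0" shows "(\<lambda>n. Kn n p) \<longlonglongrightarrow> K p"
  unfolding T.K_def K_eq[OF assms] unfolding M_def
proof (subst integral_Mn, simp, rule integral_dominated_convergence[where w = "\<lambda>t. 1 / (p + t)"])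
  show "AE t in \<sigma>. (\<lambda>n. indicator {..real (n0 + n) + 1} t * (1 / (p + t))) \<longlonglongrightarrow> 1 / (p + t)"
  proof (rule AE_I2, rule tendsto_eventually)
    fix t :: real
    obtain N :: nat where "t \<le> real N" using real_arch_simple by blast
    then show "\<forall>\<^sub>F n in sequentially. indicator {..real (n0 + n) + 1} t * (1 / (p + t)) = 1 / (p + t)"
      by (auto simp: eventually_sequentially intro!: exI[of _ N])
  qed
  show "AE t in \<sigma>. norm (indicator {..real (n0 + n) + 1} t * (1 / (p + t))) \<le> 1 / (p + t)" for n
    using sigma_pos by eventually_elim (use assms in \<open>auto split: split_indicator\<close>)
qed (use sigma_int_p[OF assms] in auto)

lemma deficit_lim:
  assumes "h > 0" "l > 0"
  shows "(\<lambda>n. exp 1 * l / (1 / h * Kn n (1 / h) + l)) \<longlonglongrightarrow> exp 1 * l / (1 / h * K (1 / h) + l)"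
  using assms K_pos[of "1 / h"]
  by (intro tendsto_intros Kn_lim) (auto simp: add_nonneg_eq_0_iff)

text \<open>Here p K(p) -> oo enters: it makes the modulus of continuity for a fixed l tend to 0
  with h.\<close>

lemma small_deficit:
  assumes "l > 0" "\<epsilon> > 0"
  obtains h where "h > 0" "exp 1 * l / (1 / h * K (1 / h) + l) < \<epsilon>"
proof -
  have "eventually (\<lambda>p. exp 1 * l / \<epsilon> \<le> p * K p) at_top"
    using pK_top by (auto simp: filterlim_at_top)
  then obtain p where p: "p > 0" "exp 1 * l / \<epsilon> \<le> p * K p"
    by (auto dest!: eventually_happens[OF eventually_conj[OF eventually_gt_at_top[of 0]]])
  have 1: "exp 1 * l \<le> \<epsilon> * (p * K p)" using p(2) assms by (simp add: pos_divide_le_eq mult.commute)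
  have "0 < p * K p + l" "0 < \<epsilon> * l" using assms K_pos[OF p(1)] p(1) by (auto intro!: add_pos_pos)
  with 1 have "exp 1 * l / (p * K p + l) < \<epsilon>"
    by (simp add: pos_divide_less_eq distrib_left)
  then show ?thesis using p by (intro that[of "1 / p"]) auto
qed

lemma un_dist:
  assumes l: "l \<ge> 0" and "0 \<le> a" "a \<le> b" "b \<le> a + h" "h > 0"
  shows "un n l b \<le> un n l a" "un n l a - un n l b \<le> exp 1 * l / (1 / h * Kn n (1 / h) + l)"
proof -
  show "un n l b \<le> un n l a" using T.u_antimono l assms by simp
  have "un n l a - un n l b \<le> un n l a - un n l (a + h)" using T.u_antimono[of l b "a + h" n] assms by simp
  also have "\<dots> \<le> un n l 0 - un n l h" using T.u_increment[of l a h n] assms by simp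
  also have "\<dots> \<le> 1 - un n l h" using T.u_le_1[of l 0 n] l by simp
  also have "\<dots> \<le> exp 1 * l / (1 / h * Kn n (1 / h) + l)" using T.u_deficit l assms by simp
  finally show "un n l a - un n l b \<le> exp 1 * l / (1 / h * Kn n (1 / h) + l)" .
qed

section \<open>The limit along a subsequence of truncations\<close>

text \<open>Diagonal extraction over rational times and l = 1, 2, ...; the modulus from
  \<open>un_dist\<close>, eventually below one common bound, extends convergence to real times.
  Positive integers l keep the index set countable and still determine a law on [0, oo).\<close>

lemma subseq_ex: "\<exists>k::nat\<Rightarrow>nat. strict_mono k \<and> (\<forall>j t. t > 0 \<longrightarrow> convergent (\<lambda>n. un (k n) (real (Suc j)) t))"
proof -
  let ?S = "(UNIV :: nat set) \<times> (\<rat> \<inter> {0<..} :: real set)"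
  have cnt: "countable ?S" by (intro countable_SIGMA) (auto intro: countable_rat countable_subset)
  have bnd: "norm (case x of (j, q) \<Rightarrow> un n (real (Suc j)) q) \<le> 1" if "x \<in> ?S" for n x
    using that T.u_nonneg T.u_le_1 by (auto simp del: of_nat_Suc)
  obtain k where k: "strict_mono (k::nat\<Rightarrow>nat)" and
    kc: "\<And>x. x \<in> ?S \<Longrightarrow> \<exists>l. (\<lambda>n. (case x of (j, q) \<Rightarrow> un (k n) (real (Suc j)) q)) \<longlonglongrightarrow> l"
    using function_convergent_subsequence[OF cnt, of "\<lambda>n (j, q). un n (real (Suc j)) q" 1, OF bnd] by blast
  have "convergent (\<lambda>n. un (k n) (real (Suc j)) t)" if t: "t > 0" for j t
  proof (rule Cauchy_convergent, rule metric_CauchyI)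
    fix \<epsilon> :: real assume "\<epsilon> > 0"
    define l where "l = real (Suc j)"
    have l: "l > 0" by (simp add: l_def)
    obtain h where h: "h > 0" "exp 1 * l / (1 / h * K (1 / h) + l) < \<epsilon> / 3"
      using small_deficit[OF l, of "\<epsilon> / 3"] \<open>\<epsilon> > 0\<close> by auto
    have "(\<lambda>n. exp 1 * l / (1 / h * Kn (k n) (1 / h) + l)) \<longlonglongrightarrow> exp 1 * l / (1 / h * K (1 / h) + l)"
      using LIMSEQ_subseq_LIMSEQ[OF deficit_lim[OF h(1) l] k] by (simp add: o_def)
    from order_tendstoD(2)[OF this h(2)] obtain N1 where
      N1: "\<And>n. n \<ge> N1 \<Longrightarrow> exp 1 * l / (1 / h * Kn (k n) (1 / h) + l) < \<epsilon> / 3"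
      by (auto simp: eventually_sequentially)
    obtain q where q: "q \<in> \<rat>" "t < q" "q < t + h" using Rats_dense_in_real[of t "t + h"] h by auto
    have "convergent (\<lambda>n. un (k n) l q)"
      using kc[of "(j, q)"] q t by (auto simp: convergent_def l_def)
    from convergent_Cauchy[OF this] have "\<exists>N2. \<forall>m\<ge>N2. \<forall>n\<ge>N2. dist (un (k m) l q) (un (k n) l q) < \<epsilon> / 3"
      by (rule metric_CauchyD) (use \<open>\<epsilon> > 0\<close> in simp)
    then obtain N2 where N2: "\<And>m n. m \<ge> N2 \<Longrightarrow> n \<ge> N2 \<Longrightarrow> dist (un (k m) l q) (un (k n) l q) < \<epsilon> / 3"
      by blast
    have near: "\<bar>un (k m) l t - un (k m) l q\<bar> < \<epsilon> / 3" if "m \<ge> N1" for m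
    proof -
      have "un (k m) l q \<le> un (k m) l t" "un (k m) l t - un (k m) l q \<le> exp 1 * l / (1 / h * Kn (k m) (1 / h) + l)"
        by (rule un_dist[of l t q h]; use q t h l in simp)+
      then show ?thesis using N1[OF that] by linarith
    qed
    have "dist (un (k m) l t) (un (k n) l t) < \<epsilon>" if "m \<ge> max N1 N2" "n \<ge> max N1 N2" for m n
    proof -
      have "\<bar>un (k m) l q - un (k n) l q\<bar> < \<epsilon> / 3"
        using N2[of m n] that by (simp add: dist_real_def)
      then show ?thesis using near[of m] near[of n] that unfolding dist_real_def by linarith
    qed
    then show "\<exists>N. \<forall>m\<ge>N. \<forall>n\<ge>N. dist (un (k m) (real (Suc j)) t) (un (k n) (real (Suc j)) t) < \<epsilon>"
      unfolding l_def by blast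
  qed
  then show ?thesis using k by blast
qed

definition k where "k = (SOME k::nat\<Rightarrow>nat. strict_mono k \<and> (\<forall>j t. t > 0 \<longrightarrow> convergent (\<lambda>n. un (k n) (real (Suc j)) t)))"

lemma k_mono: "strict_mono k" and k_conv: "t > 0 \<Longrightarrow> convergent (\<lambda>n. un (k n) (real (Suc j)) t)"
  using someI_ex[OF subseq_ex] unfolding k_def by blast+

text \<open>At time 0 the truncated values \<open>z l * c\<close> are still below 1, so the value 1,
  the transform of the point mass at 0, is set by hand. \<open>v_dist\<close> shows that it is also
  the limit from the right.\<close>

definition v where "v j t = (if t = 0 then 1 else lim (\<lambda>n. un (k n) (real (Suc j)) t))"

lemma v_lim: "t > 0 \<Longrightarrow> (\<lambda>n. un (k n) (real (Suc j)) t) \<longlonglongrightarrow> v j t"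
  using k_conv[of t j] unfolding v_def by (simp add: convergent_LIMSEQ_iff)

lemma v_nonneg: "t \<ge> 0 \<Longrightarrow> 0 \<le> v j t"
  using LIMSEQ_le_const[OF v_lim[of t j], of 0] T.u_nonneg by (cases "t = 0") (auto simp: v_def simp del: of_nat_Suc)

lemma v_le_1: "t \<ge> 0 \<Longrightarrow> v j t \<le> 1"
  using LIMSEQ_le_const2[OF v_lim[of t j], of 1] T.u_le_1 by (cases "t = 0") (auto simp: v_def simp del: of_nat_Suc)

lemma v_dist:
  assumes ab: "0 \<le> a" "a \<le> b" "b \<le> a + h" and h: "h > 0"
  shows "v j b \<le> v j a"
    "v j a - v j b \<le> exp 1 * real (Suc j) / (1 / h * K (1 / h) + real (Suc j))"
proof -
  let ?l = "real (Suc j)"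
  have lim: "(\<lambda>n. exp 1 * ?l / (1 / h * Kn (k n) (1 / h) + ?l)) \<longlonglongrightarrow> exp 1 * ?l / (1 / h * K (1 / h) + ?l)"
    using LIMSEQ_subseq_LIMSEQ[OF deficit_lim[OF h, of ?l] k_mono] by (simp add: o_def del: of_nat_Suc)
  have nn: "0 \<le> exp 1 * ?l / (1 / h * K (1 / h) + ?l)"
    using h K_pos[of "1 / h"] by (intro divide_nonneg_nonneg add_nonneg_nonneg mult_nonneg_nonneg) auto
  have "v j b \<le> v j a \<and> v j a - v j b \<le> exp 1 * ?l / (1 / h * K (1 / h) + ?l)"
  proof (cases "b = 0 \<or> a = b")
    case True then show ?thesis using ab nn by (auto simp del: of_nat_Suc)
  next
    case False
    then have b: "b > 0" "a < b" using ab by auto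
    show ?thesis
    proof (cases "a = 0")
      case True
      \<comment> \<open>The value at time 0 is imposed rather than obtained as a limit, so the
        deficit bound is applied directly instead of \<open>un_dist\<close>.\<close>
      have "1 - v j b \<le> exp 1 * ?l / (1 / h * K (1 / h) + ?l)"
      proof (rule LIMSEQ_le[OF tendsto_diff[OF tendsto_const v_lim[OF b(1)]] lim], intro exI allI impI)
        fix n
        have "un (k n) ?l h \<le> un (k n) ?l b" using T.u_antimono[of ?l b h "k n"] ab True by (simp del: of_nat_Suc)
        then show "1 - un (k n) ?l b \<le> exp 1 * ?l / (1 / h * Kn (k n) (1 / h) + ?l)"
          using T.u_deficit[of ?l h "k n"] h by (simp del: of_nat_Suc)
      qed
      then show ?thesis using True v_le_1[of b j] b by (simp add: v_def del: of_nat_Suc)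
    next
      case False
      then have a: "a > 0" using ab by simp
      have "v j b \<le> v j a"
        by (rule LIMSEQ_le[OF v_lim[OF b(1)] v_lim[OF a]], intro exI allI impI, rule un_dist(1)[OF _ ab h]) simp
      moreover have "v j a - v j b \<le> exp 1 * ?l / (1 / h * K (1 / h) + ?l)"
        by (rule LIMSEQ_le[OF tendsto_diff[OF v_lim[OF a] v_lim[OF b(1)]] lim], intro exI allI impI,
            rule un_dist(2)[OF _ ab h]) simp
      ultimately show ?thesis by blast
    qed
  qed
  then show "v j b \<le> v j a"
    "v j a - v j b \<le> exp 1 * ?l / (1 / h * K (1 / h) + ?l)" by auto
qed

lemma v_antimono: "0 \<le> a \<Longrightarrow> a \<le> b \<Longrightarrow> v j b \<le> v j a"
  using v_dist(1)[of a b "b - a + 1" j] by simp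

lemma v_uniform:
  assumes "\<epsilon> > 0"
  obtains h where "h > 0" "\<And>a b. 0 \<le> a \<Longrightarrow> 0 \<le> b \<Longrightarrow> \<bar>a - b\<bar> \<le> h \<Longrightarrow> \<bar>v j a - v j b\<bar> < \<epsilon>"
proof -
  obtain h where h: "h > 0" "exp 1 * real (Suc j) / (1 / h * K (1 / h) + real (Suc j)) < \<epsilon>"
    using small_deficit[of "real (Suc j)" \<epsilon>] assms by auto
  show ?thesis
  proof (rule that[OF h(1)])
    fix a b :: real assume "0 \<le> a" "0 \<le> b" "\<bar>a - b\<bar> \<le> h"
    then show "\<bar>v j a - v j b\<bar> < \<epsilon>"
      using v_dist[of a b h j] v_dist[of b a h j] h by (cases "a \<le> b") auto
  qed
qed

lemma v_continuous: "continuous_on {0..} (v j)"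
  unfolding continuous_on_iff
proof safe
  fix x \<epsilon> :: real assume "0 < \<epsilon>" "0 \<le> x"
  obtain h where h: "h > 0" "\<And>a b. 0 \<le> a \<Longrightarrow> 0 \<le> b \<Longrightarrow> \<bar>a - b\<bar> \<le> h \<Longrightarrow> \<bar>v j a - v j b\<bar> < \<epsilon>"
    using v_uniform[OF \<open>0 < \<epsilon>\<close>] by blast
  then show "\<exists>d>0. \<forall>x'\<in>{0..}. dist x' x < d \<longrightarrow> dist (v j x') (v j x) < \<epsilon>"
    using \<open>0 \<le> x\<close> by (intro exI[of _ h]) (auto simp: dist_real_def)
qed

lemma v_laplace:
  assumes p: "p > 0"
  shows "set_integrable lborel {0<..} (\<lambda>t. exp (- p * t) * v j t)"
    and "(LINT t:{0<..}|lborel. exp (- p * t) * v j t) = K p / (p * K p + real (Suc j))"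
proof -
  let ?l = "real (Suc j)"
  have [measurable]: "un n ?l \<in> borel_measurable borel" for n
    by (intro borel_measurable_continuous_onI continuous_at_imp_continuous_on ballI T.u_isCont) simp
  have vm: "set_borel_measurable lborel {0<..} (v j)"
    using borel_measurable_continuous_on_indicator[OF _ continuous_on_subset[OF v_continuous, of "{0<..}" j]]
    by (simp add: set_borel_measurable_def subset_eq)
  have exp_int: "integrable lborel (\<lambda>t. indicator {0<..} t * exp (- p * t))"
  proof (rule integrableI_nonneg)
    show "(\<integral>\<^sup>+ x. ennreal (indicator {0<..} x * exp (- p * x)) \<partial>lborel) < \<infinity>"
      using nn_integral_power_exp[OF p, of 0] by (simp add: ennreal_mult' ennreal_indicator mult.commute)
  qed auto
  have lim: "(\<lambda>n. \<integral>t. indicator {0<..} t * (exp (- p * t) * un (k n) ?l t) \<partial>lborel) \<longlonglongrightarrow>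
      (\<integral>t. indicator {0<..} t * (exp (- p * t) * v j t) \<partial>lborel)"
    and int: "integrable lborel (\<lambda>t. indicator {0<..} t * (exp (- p * t) * v j t))"
  proof -
    have m: "(\<lambda>t. indicator {0<..} t * (exp (- p * t) * v j t)) \<in> borel_measurable lborel"
    proof -
      have "(\<lambda>t. exp (- p * t) * (indicator {0<..} t *\<^sub>R v j t)) \<in> borel_measurable lborel"
        using vm unfolding set_borel_measurable_def by measurable
      then show ?thesis by (simp add: mult_ac)
    qed
    have c: "AE t in lborel. (\<lambda>n. indicator {0<..} t * (exp (- p * t) * un (k n) ?l t)) \<longlonglongrightarrow> indicator {0<..} t * (exp (- p * t) * v j t)"
    proof (rule AE_I2)
      fix t :: real show "(\<lambda>n. indicator {0<..} t * (exp (- p * t) * un (k n) ?l t)) \<longlonglongrightarrow> indicator {0<..} t * (exp (- p * t) * v j t)"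
        by (cases "t > 0") (auto intro!: tendsto_intros v_lim simp del: of_nat_Suc)
    qed
    have b: "AE t in lborel. norm (indicator {0<..} t * (exp (- p * t) * un n ?l t)) \<le> indicator {0<..} t * exp (- p * t)" for n
      using T.u_nonneg[of ?l _ n] T.u_le_1[of ?l _ n]
      by (intro AE_I2) (auto simp: abs_mult mult_left_le simp del: of_nat_Suc split: split_indicator)
    show "(\<lambda>n. \<integral>t. indicator {0<..} t * (exp (- p * t) * un (k n) ?l t) \<partial>lborel) \<longlonglongrightarrow>
      (\<integral>t. indicator {0<..} t * (exp (- p * t) * v j t) \<partial>lborel)"
      by (rule integral_dominated_convergence[OF m _ exp_int c b]) measurable
    show "integrable lborel (\<lambda>t. indicator {0<..} t * (exp (- p * t) * v j t))"
      by (rule integrable_dominated_convergence[OF m _ exp_int c b]) measurable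
  qed
  have "(\<integral>t. indicator {0<..} t * (exp (- p * t) * un n ?l t) \<partial>lborel) = Kn n p / (p * Kn n p + ?l)" for n
  proof -
    have "(\<integral>t. indicator {0<..} t * (exp (- p * t) * un n ?l t) \<partial>lborel) =
      enn2real (\<integral>\<^sup>+t. ennreal (indicator {0<..} t * (exp (- p * t) * un n ?l t)) \<partial>lborel)"
      using T.u_nonneg[of ?l _ n] by (intro integral_eq_nn_integral) (auto simp del: of_nat_Suc split: split_indicator)
    also have "(\<integral>\<^sup>+t. ennreal (indicator {0<..} t * (exp (- p * t) * un n ?l t)) \<partial>lborel) = ennreal (Kn n p / (p * Kn n p + ?l))"
      unfolding T.u_laplace[OF of_nat_0_le_iff p, symmetric]
      by (intro nn_integral_cong) (simp split: split_indicator)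
    finally show ?thesis using T.K_pos[OF p, of n] p by (simp del: of_nat_Suc add: divide_nonneg_nonneg add_nonneg_nonneg)
  qed
  moreover have "(\<lambda>n. Kn (k n) p / (p * Kn (k n) p + ?l)) \<longlonglongrightarrow> K p / (p * K p + ?l)"
  proof -
    have "(\<lambda>n. Kn (k n) p) \<longlonglongrightarrow> K p"
      using LIMSEQ_subseq_LIMSEQ[OF Kn_lim[OF p] k_mono] by (simp add: o_def)
    moreover have "p * K p + ?l \<noteq> 0" using K_pos[OF p] p by (smt (verit) mult_pos_pos of_nat_0_less_iff zero_less_Suc)
    ultimately show ?thesis by (intro tendsto_intros)
  qed
  ultimately show "(LINT t:{0<..}|lborel. exp (- p * t) * v j t) = K p / (p * K p + ?l)"
    using LIMSEQ_unique[OF lim] unfolding set_lebesgue_integral_def by simp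
  show "set_integrable lborel {0<..} (\<lambda>t. exp (- p * t) * v j t)"
    using int by (simp add: set_integrable_def)
qed

end

section \<open>The laws of the inverse subordinator\<close>

text \<open>With X = exp(- s) the hypothesis says that all moments of X converge. X lies in [0, 1],
  so the Taylor polynomials approximate the characteristic function uniformly over all laws, and the
  convergence of moments passes to it. The \<open>min 1\<close> keeps X bounded at negative
  s.\<close>

lemma char_conv_of_laplace:
  assumes M: "\<And>n. real_distribution (M n)" and N: "real_distribution N"
    and M_pos: "\<And>n. AE s in M n. (0::real) \<le> s" and N_pos: "AE s in N. 0 \<le> s"
    and conv: "\<And>j. (\<lambda>n. \<integral>s. exp (- real (Suc j) * s) \<partial>M n) \<longlonglongrightarrow> (\<integral>s. exp (- real (Suc j) * s) \<partial>N)"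
  defines "X \<equiv> \<lambda>s::real. min 1 (exp (- s))"
  shows "(\<lambda>n. char (distr (M n) borel X) t) \<longlonglongrightarrow> char (distr N borel X) t"
proof -
  have X_meas [measurable]: "X \<in> borel_measurable borel" unfolding X_def by measurable
  have X01: "0 \<le> X s" "X s \<le> 1" for s by (auto simp: X_def)
  have mom: "(\<integral>s. X s ^ Suc j \<partial>L) = (\<integral>s. exp (- real (Suc j) * s) \<partial>L)"
    if "real_distribution L" "AE s in L. 0 \<le> s" for L j
  proof (rule integral_cong_AE)
    interpret real_distribution L by fact
    show "AE s in L. X s ^ Suc j = exp (- real (Suc j) * s)"
      using that(2) by eventually_elim (simp add: X_def exp_of_nat_mult[symmetric] del: power_Suc of_nat_Suc)
  qed (use that(1)[THEN real_distribution.events_eq_borel] in \<open>auto cong: measurable_cong_sets\<close>)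
  have approx: "cmod (char (distr L borel X) t - (\<Sum>k\<le>m. ((\<i> * t) ^ k / fact k) * (\<integral>s. X s ^ k \<partial>L))) \<le> 2 * \<bar>t\<bar> ^ m / fact m"
    if "real_distribution L" for L m
  proof -
    interpret real_distribution L by fact
    have int: "integrable L (\<lambda>s. X s ^ k)" for k
      by (rule integrable_const_bound[where B = 1]) (auto intro!: AE_I2 power_le_one simp: X01)
    have "cmod (char (distr L borel X) t - (\<Sum>k\<le>m. ((\<i> * t) ^ k / fact k) * expectation (\<lambda>s. X s ^ k))) \<le>
      (2 * \<bar>t\<bar> ^ m / fact m) * expectation (\<lambda>s. \<bar>X s\<bar> ^ m)"
      by (rule char_approx1'[OF int]) auto
    also have "expectation (\<lambda>s. \<bar>X s\<bar> ^ m) \<le> expectation (\<lambda>s. 1)"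
      using int[of m] by (intro integral_mono) (auto simp: X01 intro: power_le_one)
    then have "(2 * \<bar>t\<bar> ^ m / fact m) * expectation (\<lambda>s. \<bar>X s\<bar> ^ m) \<le> (2 * \<bar>t\<bar> ^ m / fact m) * 1"
      using prob_space[simplified] by (intro mult_left_mono) auto
    finally show ?thesis by simp
  qed
  show ?thesis
  proof (rule LIMSEQ_I)
    fix r :: real assume r: "0 < r"
    have "(\<lambda>m. 2 * (inverse (fact m) * \<bar>t\<bar> ^ m)) \<longlonglongrightarrow> 2 * 0"
      by (intro tendsto_intros summable_LIMSEQ_zero summable_exp)
    then have "(\<lambda>m. 2 * (\<bar>t\<bar> ^ m / fact m)) \<longlonglongrightarrow> 2 * 0"
      by (simp add: field_simps)
    then have "eventually (\<lambda>m. 2 * (\<bar>t\<bar> ^ m / fact m) < r / 3) sequentially"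
      using r by (intro order_tendstoD(2)[of _ "0::real"]) auto
    then obtain m where m: "2 * \<bar>t\<bar> ^ m / fact m < r / 3" by (auto simp: eventually_sequentially)
    let ?S = "\<lambda>L. (\<Sum>k\<le>m. ((\<i> * t) ^ k / fact k) * complex_of_real (\<integral>s. X s ^ k \<partial>L))"
    have "(\<lambda>n. ?S (M n)) \<longlonglongrightarrow> ?S N"
    proof (intro tendsto_sum tendsto_mult tendsto_const tendsto_of_real)
      fix k
      show "(\<lambda>n. \<integral>s. X s ^ k \<partial>M n) \<longlonglongrightarrow> (\<integral>s. X s ^ k \<partial>N)"
      proof (cases k)
        case 0
        then show ?thesis
          using prob_space.prob_space[OF real_distribution.axioms(1)[OF M]]
            prob_space.prob_space[OF real_distribution.axioms(1)[OF N]] by simp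
      next
        case (Suc j)
        show ?thesis unfolding Suc mom[OF M M_pos] mom[OF N N_pos] by (rule conv)
      qed
    qed
    from LIMSEQ_D[OF this, of "r / 3"] r obtain n0 where
      n0: "\<And>n. n \<ge> n0 \<Longrightarrow> cmod (?S (M n) - ?S N) < r / 3" by auto
    have "cmod (char (distr (M n) borel X) t - char (distr N borel X) t) < r" if "n \<ge> n0" for n
    proof -
      have tri: "cmod (a - b) \<le> cmod (a - c) + cmod (c - d) + cmod (b - d)" for a b c d
        by (smt (verit) norm_minus_commute norm_triangle_ineq4 norm_triangle_sub diff_add_cancel add_diff_eq norm_diff_triangle_le order_refl)
      have "cmod (char (distr (M n) borel X) t - char (distr N borel X) t) \<le>
          cmod (char (distr (M n) borel X) t - ?S (M n)) + cmod (?S (M n) - ?S N) + cmod (char (distr N borel X) t - ?S N)"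
        by (rule tri)
      also have "\<dots> < r / 3 + r / 3 + r / 3"
        by (intro add_strict_mono le_less_trans[OF approx[OF M] m] le_less_trans[OF approx[OF N] m] n0[OF that])
      finally show ?thesis by simp
    qed
    then show "\<exists>no. \<forall>n\<ge>no. cmod (char (distr (M n) borel X) t - char (distr N borel X) t) < r" by blast
  qed
qed

text \<open>Levy continuity applies to the images under X, and - ln carries the weak convergence
  back. The transported function \<open>g\<close> is continuous on x > 0, and X is positive, so its
  discontinuities are null for the limit law.\<close>

lemma weak_conv_of_laplace:
  assumes M: "\<And>n. real_distribution (M n)" and N: "real_distribution N"
    and M_pos: "\<And>n. AE s in M n. (0::real) \<le> s" and N_pos: "AE s in N. 0 \<le> s"
    and conv: "\<And>j. (\<lambda>n. \<integral>s. exp (- real (Suc j) * s) \<partial>M n) \<longlonglongrightarrow> (\<integral>s. exp (- real (Suc j) * s) \<partial>N)"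
  shows "weak_conv_m M N"
proof -
  define X where "X = (\<lambda>s::real. min 1 (exp (- s)))"
  have X_meas [measurable]: "X \<in> borel_measurable borel" unfolding X_def by measurable
  have mM [simp]: "X \<in> borel_measurable (M n)" for n
    using real_distribution.events_eq_borel[OF M] by (simp cong: measurable_cong_sets)
  have mN [simp]: "X \<in> borel_measurable N"
    using real_distribution.events_eq_borel[OF N] by (simp cong: measurable_cong_sets)
  have rdM: "real_distribution (distr (M n) borel X)" for n
    using prob_space.real_distribution_distr[OF real_distribution.axioms(1)[OF M] mM] .
  have rdN: "real_distribution (distr N borel X)"
    using prob_space.real_distribution_distr[OF real_distribution.axioms(1)[OF N] mN] .
  have wc: "weak_conv_m (\<lambda>n. distr (M n) borel X) (distr N borel X)"
    by (rule levy_continuity[OF rdM rdN]) (use char_conv_of_laplace[OF M N M_pos N_pos conv] in \<open>simp add: X_def\<close>)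
  show ?thesis
  proof (rule integral_bdd_continuous_conv_imp_weak_conv[OF M N])
    fix f :: "real \<Rightarrow> real" assume f: "\<And>x. isCont f x" "\<And>x. \<bar>f x\<bar> \<le> 1"
    have [measurable]: "f \<in> borel_measurable borel"
      using f by (intro borel_measurable_continuous_onI continuous_at_imp_continuous_on) auto
    define g where "g x = f (if x \<le> 0 then 0 else - ln x)" for x
    have g_meas [measurable]: "g \<in> borel_measurable borel" unfolding g_def by measurable
    have "(\<lambda>n. integral\<^sup>L (distr (M n) borel X) g) \<longlonglongrightarrow> integral\<^sup>L (distr N borel X) g"
    proof (rule weak_conv_imp_bdd_ae_continuous_conv[OF rdM rdN wc, where B = 1])
      have "{x. \<not> isCont g x} \<subseteq> {..0}"
      proof
        fix x assume "x \<in> {x. \<not> isCont g x}"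
        then have "\<not> isCont g x" by simp
        show "x \<in> {..0}"
        proof (rule ccontr)
          assume "x \<notin> {..0}" then have x: "x > 0" by simp
          have "isCont (\<lambda>x. f (- ln x)) x"
            using x by (intro isCont_o2[OF _ f(1)] continuous_intros) auto
          moreover have "eventually (\<lambda>y. g y = f (- ln y)) (nhds x)"
            using eventually_nhds_in_open[of "{0<..}" x] x by (auto simp: g_def elim!: eventually_mono)
          ultimately have "isCont g x" by (simp add: isCont_cong)
          then show False using \<open>\<not> isCont g x\<close> by simp
        qed
      qed
      moreover have "emeasure (distr N borel X) {..0} = 0"
      proof -
        have "X -` {..0} = {}" by (auto simp: X_def min_le_iff_disj)
        then show ?thesis by (simp add: emeasure_distr)
      qed
      ultimately show "emeasure (distr N borel X) {x. \<not> isCont g x} = 0"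
        by (intro emeasure_eq_0[of "{..0}" "distr N borel X" "{x. \<not> isCont g x}"]) (simp_all only: sets_distr atMost_borel)
    qed (use f in \<open>auto simp: g_def\<close>)
    moreover have "integral\<^sup>L (distr L borel X) g = integral\<^sup>L L f"
      if "real_distribution L" "AE s in L. 0 \<le> s" for L
    proof -
      have sL[measurable_cong]: "sets L = sets borel" using real_distribution.events_eq_borel[OF that(1)] .
      have "integral\<^sup>L (distr L borel X) g = (\<integral>s. g (X s) \<partial>L)"
        by (rule integral_distr) auto
      also have "\<dots> = integral\<^sup>L L f"
      proof (rule integral_cong_AE)
        show "AE s in L. g (X s) = f s"
          using that(2) by eventually_elim (auto simp: g_def X_def not_le[symmetric])
      qed auto
      finally show ?thesis .
    qed
    ultimately show "(\<lambda>n. integral\<^sup>L (M n) f) \<longlonglongrightarrow> integral\<^sup>L N f"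
      using M N M_pos N_pos by simp
  qed
qed

lemma laplace_unique:
  assumes M: "real_distribution M" and N: "real_distribution N"
    and "AE s in M. (0::real) \<le> s" and "AE s in N. 0 \<le> s"
    and "\<And>j. (\<integral>s. exp (- real (Suc j) * s) \<partial>M) = (\<integral>s. exp (- real (Suc j) * s) \<partial>N)"
  shows "M = N"
proof (rule Levy_uniqueness[OF M N])
  have "weak_conv_m (\<lambda>n. M) N" by (rule weak_conv_of_laplace) (use assms in auto)
  from levy_continuity1[OF M N this] show "char M = char N"
    by (auto intro!: ext LIMSEQ_unique[OF tendsto_const])
qed

section \<open>The limit law at a fixed positive time\<close>

context stieltjes_kernel
begin

text \<open>With p = 1/t, monotonicity bounds t exp(- 1) v(t) by the Laplace transform of v at p,
  which is at most K(p) / l for l = \<open>real (Suc j)\<close>. The decay in l later excludes an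
  atom of the limit law at 0.\<close>

lemma v_small: assumes t: "t > 0" shows "v j t \<le> exp 1 * K (1 / t) / t / real (Suc j)"
proof -
  define p where "p = 1 / t"
  have p: "p > 0" "p * t = 1" using t by (auto simp: p_def)
  have "(\<integral>r. indicator {0<..t} r *\<^sub>R (exp (- 1) * v j t) \<partial>lborel) \<le> (LINT r:{0<..}|lborel. exp (- p * r) * v j r)"
    unfolding set_lebesgue_integral_def
  proof (rule integral_mono)
    fix r
    have "exp (- 1) * v j t \<le> exp (- p * r) * v j r" if "0 < r" "r \<le> t"
      using v_antimono[of r t j] v_nonneg[of t j] that t p mult_left_mono[of r t p] by (intro mult_mono) auto
    then show "indicator {0<..t} r *\<^sub>R (exp (- 1) * v j t) \<le> indicator {0<..} r *\<^sub>R (exp (- p * r) * v j r)"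
      using v_nonneg[of r j] by (auto split: split_indicator)
    show "integrable lborel (\<lambda>r. indicator {0<..t} r *\<^sub>R (exp (- 1) * v j t))"
      by (rule integrable_scaleR_left) (use t in simp)
  qed (use v_laplace(1)[OF p(1), of j] in \<open>simp add: set_integrable_def\<close>)
  also have "\<dots> = K p / (p * K p + real (Suc j))" by (rule v_laplace[OF p(1)])
  also have "\<dots> \<le> K p / real (Suc j)"
    using K_pos[OF p(1)] p
    by (intro divide_left_mono mult_pos_pos add_pos_pos) (auto simp del: of_nat_Suc)
  finally have "t * (exp (- 1) * v j t) \<le> K p / real (Suc j)" using t by simp
  then have "exp 1 / t * (t * (exp (- 1) * v j t)) \<le> exp 1 / t * (K p / real (Suc j))"
    using t by (intro mult_left_mono) auto
  moreover have "exp 1 / t * (t * (exp (- 1) * v j t)) = v j t" using t by (simp add: exp_minus)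
  ultimately show ?thesis by (simp add: p_def)
qed

text \<open>Tightness comes from \<open>u_deficit\<close> at h = t with l small, because 1 - exp(- l
  s) \<ge> 1 - exp(- 1) for s \<ge> 1/l; a weak limit then has transform \<open>v\<close>. Laws on
  (0, oo) may converge to one that charges 0, which \<open>v_small\<close> forbids.\<close>

lemma nu_ex:
  assumes t: "t > 0"
  shows "\<exists>\<nu>. real_distribution \<nu> \<and> (AE s in \<nu>. s > 0) \<and> (\<forall>j. (\<integral>s. exp (- real (Suc j) * s) \<partial>\<nu>) = v j t)"
proof -
  have "\<exists>N. real_distribution N \<and> (AE s in N. s > 0) \<and> (\<forall>l\<ge>0. (\<integral>s. exp (- l * s) \<partial>N) = un n l t)" for n
    using T.u_mixture t by simp
  then obtain N where N: "\<And>n. real_distribution (N n)" "\<And>n. AE s in N n. s > 0"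
    "\<And>n l. l \<ge> 0 \<Longrightarrow> (\<integral>s. exp (- l * s) \<partial>N n) = un n l t" by metis
  define p where "p = 1 / t"
  have p: "p > 0" using t by (auto simp: p_def)
  \<comment> \<open>Half the limiting value of p K(p) bounds the truncated values from below for
    large n. Dropping the first \<open>N0\<close> indices makes the bound hold for all n, as
    \<open>tight\<close> requires.\<close>
  define d where "d = p * K p / 2"
  have d: "d > 0" "d < p * K p" using K_pos[OF p] p by (auto simp: d_def)
  have "(\<lambda>n. p * Kn (k n) p) \<longlonglongrightarrow> p * K p"
    using LIMSEQ_subseq_LIMSEQ[OF Kn_lim[OF p] k_mono] by (intro tendsto_intros) (simp add: o_def)
  from order_tendstoD(1)[OF this d(2)] obtain N0 where N0: "\<And>n. n \<ge> N0 \<Longrightarrow> d < p * Kn (k n) p"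
    by (auto simp: eventually_sequentially)
  define \<mu> where "\<mu> n = N (k (n + N0))" for n
  have tight: "tight \<mu>"
    unfolding tight_def
  proof (intro conjI allI impI)
    show "real_distribution (\<mu> n)" for n by (simp add: \<mu>_def N)
    fix \<epsilon> :: real assume \<epsilon>: "\<epsilon> > 0"
    define c where "c = 1 - exp (- 1 :: real)"
    have c: "c > 0" by (simp add: c_def)
    \<comment> \<open>Chosen so that the deficit bound exp 1 * l / d equals c times half of
      \<epsilon>; the factor c cancels against the Markov-type inequality below.\<close>
    define l where "l = \<epsilon> / 2 * c * d / exp 1"
    have l: "l > 0" using \<epsilon> c d by (simp add: l_def)
    have "measure (\<mu> n) {-1<..1 / l} > 1 - \<epsilon>" for n
    proof -
      let ?n = "k (n + N0)"
      interpret real_distribution "\<mu> n" by (simp add: \<mu>_def N)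
      have pos: "AE s in \<mu> n. s > 0" unfolding \<mu>_def by (rule N(2))
      have int: "integrable (\<mu> n) (\<lambda>s. exp (- l * s))"
        by (rule integrable_const_bound[where B = 1]) (use pos l in \<open>auto elim!: eventually_mono\<close>)
      have "c * measure (\<mu> n) {1 / l<..} = (\<integral>s. c * indicator {1 / l<..} s \<partial>\<mu> n)" by simp
      also have "\<dots> \<le> (\<integral>s. 1 - exp (- l * s) \<partial>\<mu> n)"
      proof (rule integral_mono_AE)
        show "AE s in \<mu> n. c * indicator {1 / l<..} s \<le> 1 - exp (- l * s)"
          using pos by eventually_elim (use l in \<open>auto simp: c_def field_simps split: split_indicator\<close>)
      qed (use int in \<open>auto simp: emeasure_eq_measure\<close>)
      also have "\<dots> = 1 - un ?n l t"
        using N(3)[of l ?n] l int prob_space[simplified] by (subst Bochner_Integration.integral_diff) (auto simp: \<mu>_def[symmetric])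
      also have "\<dots> \<le> exp 1 * l / (p * Kn ?n p + l)" unfolding p_def using T.u_deficit l t by simp
      also have "\<dots> \<le> exp 1 * l / d"
        using N0[of "n + N0"] d l by (intro divide_left_mono) (auto intro!: mult_pos_pos)
      also have "\<dots> = c * (\<epsilon> / 2)" using d by (simp add: l_def)
      finally have "measure (\<mu> n) {1 / l<..} \<le> \<epsilon> / 2" using c by simp
      moreover have "measure (\<mu> n) {-1<..1 / l} = measure (\<mu> n) (space (\<mu> n) - {1 / l<..})"
        by (rule finite_measure_eq_AE) (use pos in \<open>auto elim!: eventually_mono\<close>)
      ultimately show ?thesis using \<epsilon> prob_compl[of "{1 / l<..}"] by simp
    qed
    moreover have "-1 < 1 / l" using l by (simp add: less_divide_eq)
    ultimately show "\<exists>a b. a < b \<and> (\<forall>n. 1 - \<epsilon> < measure (\<mu> n) {a<..b})" by blast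
  qed
  obtain r \<nu> where r: "strict_mono (r :: nat \<Rightarrow> nat)" and \<nu>: "real_distribution \<nu>"
    and wc: "weak_conv_m (\<mu> \<circ> id \<circ> r) \<nu>"
    using tight_imp_convergent_subsubsequence[OF tight strict_mono_id] by blast
  have rd: "real_distribution ((\<mu> \<circ> id \<circ> r) n)" for n by (simp add: \<mu>_def N)
  interpret \<nu>: real_distribution \<nu> by (rule \<nu>)
  \<comment> \<open>This bounded continuous test function is positive exactly on the negative axis,
    so the limit has no mass there.\<close>
  have "(\<lambda>n. \<integral>s. min 1 (max 0 (- s)) \<partial>(\<mu> \<circ> id \<circ> r) n) \<longlonglongrightarrow> (\<integral>s. min 1 (max 0 (- s)) \<partial>\<nu>)"
    by (rule weak_conv_imp_integral_bdd_continuous_conv[OF rd \<nu> wc, where B = 1]) (auto intro!: continuous_intros)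
  moreover have "(\<integral>s. min 1 (max 0 (- s)) \<partial>(\<mu> \<circ> id \<circ> r) n) = 0" for n
    unfolding \<mu>_def o_def id_def
    by (rule integral_eq_zero_AE, use N(2)[of "k (r n + N0)"] in eventually_elim) simp
  ultimately have "(\<integral>s. min 1 (max 0 (- s)) \<partial>\<nu>) = 0" by (simp add: LIMSEQ_const_iff)
  moreover have "integrable \<nu> (\<lambda>s. min 1 (max 0 (- s)))"
    by (rule \<nu>.integrable_const_bound[where B = 1]) auto
  ultimately have "AE s in \<nu>. min 1 (max 0 (- s)) = 0"
    by (subst (asm) integral_nonneg_eq_0_iff_AE) auto
  then have nonneg: "AE s in \<nu>. 0 \<le> s" by eventually_elim (auto simp: min_def max_def split: if_splits)
  have lap: "(\<integral>s. exp (- real (Suc j) * s) \<partial>\<nu>) = v j t" for j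
  proof -
    let ?l = "real (Suc j)"
    \<comment> \<open>The exponential is unbounded at negative s; clipping with
      \<open>max 0 s\<close> makes it an admissible test function and changes it only on null
      sets.\<close>
    have "(\<lambda>n. \<integral>s. exp (- ?l * max 0 s) \<partial>(\<mu> \<circ> id \<circ> r) n) \<longlonglongrightarrow> (\<integral>s. exp (- ?l * max 0 s) \<partial>\<nu>)"
      by (rule weak_conv_imp_integral_bdd_continuous_conv[OF rd \<nu> wc, where B = 1])
        (auto intro!: continuous_intros mult_nonpos_nonneg)
    also have "(\<integral>s. exp (- ?l * max 0 s) \<partial>\<nu>) = (\<integral>s. exp (- ?l * s) \<partial>\<nu>)"
      by (rule integral_cong_AE) (use nonneg in \<open>auto elim!: eventually_mono\<close>)
    also have "(\<lambda>n. \<integral>s. exp (- ?l * max 0 s) \<partial>(\<mu> \<circ> id \<circ> r) n) = (\<lambda>n. un (k (r n + N0)) ?l t)"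
    proof
      fix n
      have [measurable_cong]: "sets (N m) = sets borel" for m using real_distribution.events_eq_borel[OF N(1)] .
      have "(\<integral>s. exp (- ?l * max 0 s) \<partial>(\<mu> \<circ> id \<circ> r) n) = (\<integral>s. exp (- ?l * s) \<partial>N (k (r n + N0)))"
        unfolding \<mu>_def o_def id_def
      proof (rule integral_cong_AE)
        show "AE s in N (k (r n + N0)). exp (- ?l * max 0 s) = exp (- ?l * s)"
          using N(2)[of "k (r n + N0)"] by eventually_elim simp
      qed auto
      then show "(\<integral>s. exp (- ?l * max 0 s) \<partial>(\<mu> \<circ> id \<circ> r) n) = un (k (r n + N0)) ?l t"
        using N(3)[of ?l] by simp
    qed
    finally have 1: "(\<lambda>n. un (k (r n + N0)) ?l t) \<longlonglongrightarrow> (\<integral>s. exp (- ?l * s) \<partial>\<nu>)" .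
    have "strict_mono (\<lambda>n. r n + N0)" using r by (auto simp: strict_mono_def)
    from LIMSEQ_subseq_LIMSEQ[OF v_lim[OF t] this, of j]
    have "(\<lambda>n. un (k (r n + N0)) ?l t) \<longlonglongrightarrow> v j t" by (simp add: o_def)
    with 1 show ?thesis by (rule LIMSEQ_unique)
  qed
  have "measure \<nu> {0} \<le> 0"
  proof (rule LIMSEQ_le[OF tendsto_const])
    have "(\<lambda>j. exp 1 * K (1 / t) / t * inverse (real (Suc j))) \<longlonglongrightarrow> exp 1 * K (1 / t) / t * 0"
      by (intro tendsto_intros LIMSEQ_inverse_real_of_nat)
    then show "(\<lambda>j. exp 1 * K (1 / t) / t / real (Suc j)) \<longlonglongrightarrow> 0" by (simp add: divide_inverse)
    have "measure \<nu> {0} \<le> v j t" for j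
    proof -
      have "measure \<nu> {0} = (\<integral>s. indicator {0} s \<partial>\<nu>)" by simp
      also have "\<dots> \<le> (\<integral>s. exp (- real (Suc j) * s) \<partial>\<nu>)"
      proof (rule integral_mono_AE)
        show "integrable \<nu> (\<lambda>s. exp (- real (Suc j) * s))"
          by (rule \<nu>.integrable_const_bound[where B = 1]) (use nonneg in \<open>auto elim!: eventually_mono simp del: of_nat_Suc\<close>)
      qed (auto simp: \<nu>.emeasure_eq_measure split: split_indicator)
      finally show ?thesis by (simp only: lap)
    qed
    then show "\<exists>N. \<forall>n\<ge>N. measure \<nu> {0} \<le> exp 1 * K (1 / t) / t / real (Suc n)"
      using v_small[OF t] order_trans by blast
  qed
  then have "measure \<nu> {0} = 0" by (simp add: antisym)
  then have "AE s in \<nu>. s \<noteq> 0" by (simp add: AE_iff_measurable[of "{0}"] \<nu>.emeasure_eq_measure)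
  with nonneg have "AE s in \<nu>. 0 < s" by eventually_elim auto
  then show ?thesis using \<nu> lap by blast
qed

end

section \<open>The laws \<open>nu\<close> as a family in time\<close>

context stieltjes_kernel
begin

definition nu where
  "nu t = (if t = 0 then return borel 0 else
     (SOME \<nu>. real_distribution \<nu> \<and> (AE s in \<nu>. s > 0) \<and> (\<forall>j. (\<integral>s. exp (- real (Suc j) * s) \<partial>\<nu>) = v j t)))"

lemma nu_0 [simp]: "nu 0 = return borel 0"
  by (simp add: nu_def)

lemma
  assumes "t > 0"
  shows nu_rd_pos: "real_distribution (nu t)" and nu_pos: "AE s in nu t. s > 0"
    and nu_laplace_pos: "(\<integral>s. exp (- real (Suc j) * s) \<partial>nu t) = v j t"
  using someI_ex[OF nu_ex[OF assms]] assms unfolding nu_def by (auto simp del: of_nat_Suc)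

lemma nu_rd: "t \<ge> 0 \<Longrightarrow> real_distribution (nu t)"
  using nu_rd_pos[of t]
  by (cases "t = 0") (auto intro!: real_distribution.intro prob_space_return simp: real_distribution_axioms_def)

lemma nu_sets [simp]: "t \<ge> 0 \<Longrightarrow> sets (nu t) = sets borel"
  using real_distribution.events_eq_borel[OF nu_rd] .

lemma nu_nonneg: "t \<ge> 0 \<Longrightarrow> AE s in nu t. 0 \<le> s"
proof (cases "t = 0")
  case True
  then show ?thesis unfolding True nu_0 by (subst AE_return) auto
qed (use nu_pos[of t] in \<open>auto elim!: eventually_mono\<close>)

lemma nu_laplace: "t \<ge> 0 \<Longrightarrow> (\<integral>s. exp (- real (Suc j) * s) \<partial>nu t) = v j t"
  using nu_laplace_pos[of t j] by (cases "t = 0") (auto simp: integral_return v_def)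

lemma nu_weak_conv:
  assumes "\<And>n. a n \<ge> 0" "t \<ge> 0" "a \<longlonglongrightarrow> t"
  shows "weak_conv_m (\<lambda>n. nu (a n)) (nu t)"
proof (rule weak_conv_of_laplace[OF nu_rd nu_rd nu_nonneg nu_nonneg])
  fix j
  have "(\<lambda>n. v j (a n)) \<longlonglongrightarrow> v j t"
    using v_continuous[of j] assms unfolding continuous_on_sequentially by (auto simp: o_def)
  then show "(\<lambda>n. \<integral>s. exp (- real (Suc j) * s) \<partial>nu (a n)) \<longlonglongrightarrow> (\<integral>s. exp (- real (Suc j) * s) \<partial>nu t)"
    using assms by (simp only: nu_laplace)
qed (use assms in auto)

lemma nu_continuous:
  fixes f :: "real \<Rightarrow> real"
  assumes f: "\<And>x. isCont f x" "\<And>x. \<bar>f x\<bar> \<le> B"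
  shows "continuous_on {0..} (\<lambda>t. \<integral>s. f s \<partial>nu t)"
  unfolding continuous_on_sequentially
proof (intro allI ballI impI)
  fix a t assume a: "(t::real) \<in> {0..}" "(\<forall>n. a n \<in> {0..}) \<and> a \<longlonglongrightarrow> t"
  then have a': "\<And>n. a n \<ge> 0" "t \<ge> 0" by auto
  show "((\<lambda>t. \<integral>s. f s \<partial>nu t) \<circ> a) \<longlonglongrightarrow> (\<integral>s. f s \<partial>nu t)"
    unfolding o_def
    by (rule weak_conv_imp_integral_bdd_continuous_conv[OF nu_rd nu_rd nu_weak_conv])
      (use a a' f in auto)
qed

text \<open>Half-lines generate the Borel sets, and their indicators are limits of bounded
  continuous functions, whose integrals are continuous in t by \<open>nu_continuous\<close>. The
  clipping \<open>max 0 t\<close> avoids negative times, where \<open>nu\<close> has no prescribed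
  meaning.\<close>

lemma nu_measurable: "(\<lambda>t. nu (max 0 t)) \<in> measurable borel (subprob_algebra borel)"
proof (rule measurable_subprob_algebra_generated[where \<Omega> = UNIV and G = "range (\<lambda>a. {..a})"])
  show "sets borel = sigma_sets UNIV (range (\<lambda>a. {..a::real}))"
    by (subst borel_eq_atMost) (simp add: sets_measure_of)
  show "Int_stable (range (\<lambda>a. {..a::real}))"
    by (auto simp: Int_stable_def)
  show "subprob_space (nu (max 0 t))" for t
    using real_distribution.axioms(1)[OF nu_rd, of "max 0 t"] by (simp add: prob_space_imp_subprob_space)
  have meas: "(\<lambda>t. emeasure (nu (max 0 t)) A) \<in> borel_measurable borel"
    if "(\<lambda>t. measure (nu (max 0 t)) A) \<in> borel_measurable borel" for A
  proof -
    have "emeasure (nu (max 0 t)) A = ennreal (measure (nu (max 0 t)) A)" for t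
    proof -
      interpret real_distribution "nu (max 0 t)" by (rule nu_rd) simp
      show ?thesis by (rule emeasure_eq_measure)
    qed
    then show ?thesis using that by simp
  qed
  have "(\<lambda>t. emeasure (nu (max 0 t)) UNIV) = (\<lambda>t. 1)"
    using prob_space.emeasure_space_1[OF real_distribution.axioms(1)[OF nu_rd]]
      real_distribution.space_eq_univ[OF nu_rd] by (metis max.cobounded1)
  then show "(\<lambda>t. emeasure (nu (max 0 t)) UNIV) \<in> borel_measurable borel" by simp
  fix A :: "real set" assume "A \<in> range (\<lambda>a. {..a})"
  then obtain a where A: "A = {..a}" by auto
  have "(\<lambda>t. measure (nu (max 0 t)) A) \<in> borel_measurable borel"
  proof (rule borel_measurable_LIMSEQ_real)
    define f where "f n s = min 1 (max 0 (1 - real n * (s - a)))" for n s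
    show "(\<lambda>t. \<integral>s. f n s \<partial>nu (max 0 t)) \<in> borel_measurable borel" for n
    proof (rule borel_measurable_continuous_onI)
      have "continuous_on {0..} (\<lambda>t. \<integral>s. f n s \<partial>nu t)"
        by (rule nu_continuous[of _ 1]) (auto simp: f_def intro!: continuous_intros)
      then show "continuous_on UNIV (\<lambda>t. \<integral>s. f n s \<partial>nu (max 0 t))"
        by (rule continuous_on_compose2) (auto intro!: continuous_intros)
    qed
    fix t :: real
    interpret real_distribution "nu (max 0 t)" by (rule nu_rd) simp
    have "(\<lambda>n. \<integral>s. f n s \<partial>nu (max 0 t)) \<longlonglongrightarrow> (\<integral>s. indicator {..a} s \<partial>nu (max 0 t))"
    proof (rule integral_dominated_convergence[where w = "\<lambda>_. 1"])
      show "AE s in nu (max 0 t). (\<lambda>n. f n s) \<longlonglongrightarrow> indicator {..a} s"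
      proof (rule AE_I2, rule tendsto_eventually)
        fix s :: real
        show "\<forall>\<^sub>F n in sequentially. f n s = indicator {..a} s"
        proof (cases "s \<le> a")
          case True
          then have "real n * (s - a) \<le> 0" for n by (intro mult_nonneg_nonpos) auto
          then have "f n s = 1" for n unfolding f_def by (smt (verit))
          then show ?thesis using True by simp
        next
          case False
          obtain N :: nat where N: "1 / (s - a) \<le> real N" using real_arch_simple by blast
          have "f n s = 0" if "n \<ge> N" for n
          proof -
            have "1 / (s - a) \<le> real n" using N that by (meson of_nat_mono order_trans)
            then have "1 \<le> real n * (s - a)" using False by (simp add: pos_divide_le_eq)
            then show ?thesis by (simp add: f_def)
          qed
          then show ?thesis using False by (auto simp: eventually_sequentially)
        qed
      qed
      show "f n \<in> borel_measurable (nu (max 0 t))" for n unfolding f_def by measurable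
    qed (auto simp: f_def)
    then show "(\<lambda>n. \<integral>s. f n s \<partial>nu (max 0 t)) \<longlonglongrightarrow> measure (nu (max 0 t)) A"
      by (simp add: A)
  qed
  then show "(\<lambda>t. emeasure (nu (max 0 t)) A) \<in> borel_measurable borel" by (rule meas)
qed auto

text \<open>By \<open>laplace_unique\<close> it is enough to compare the two laws on exp(- l s) with
  l = 1, 2, ...: both give p K / (p K + l), the mixture by \<open>v_laplace\<close>, the exponential
  law by direct integration.\<close>

lemma nu_time_laplace:
  fixes f :: "real \<Rightarrow> real"
  assumes p: "p > 0" and f: "\<And>x. isCont f x" "\<And>x. \<bar>f x\<bar> \<le> B"
  shows "(LINT t:{0<..}|lborel. exp (- p * t) * (\<integral>s. f s \<partial>nu t)) = K p * (LINT s:{0<..}|lborel. exp (- (p * K p) * s) * f s)"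
proof -
  define E where "E q = density lborel (exponential_density q)" for q
  define Q where "Q = E p \<bind> (\<lambda>t. nu (max 0 t))"
  have E_prob: "prob_space (E q)" if "q > 0" for q
    unfolding E_def by (rule prob_space_exponential_density[OF that])
  have E_sets [measurable_cong, simp]: "sets (E q) = sets borel" for q by (simp add: E_def)
  have E_space [simp]: "space (E q) = UNIV" for q by (simp add: E_def)
  have E_int: "(\<integral>t. g t \<partial>E q) = q * (LINT t:{0<..}|lborel. exp (- q * t) * g t)"
    if "q > 0" "g \<in> borel_measurable borel" for g :: "real \<Rightarrow> real" and q
  proof -
    have "(\<integral>t. g t \<partial>E q) = (\<integral>t. exponential_density q t * g t \<partial>lborel)"
      unfolding E_def using that by (subst integral_density) auto
    also have "\<dots> = (\<integral>t. q * (indicator {0<..} t *\<^sub>R (exp (- q * t) * g t)) \<partial>lborel)"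
    proof (rule integral_cong_AE)
      show "AE t in lborel. exponential_density q t * g t = q * (indicator {0<..} t *\<^sub>R (exp (- q * t) * g t))"
        using AE_lborel_singleton[of 0]
        by eventually_elim (auto simp: exponential_density_def mult_ac split: split_indicator)
    qed (use that in auto)
    finally show ?thesis by (simp add: set_lebesgue_integral_def)
  qed
  interpret Ep: prob_space "E p" by (rule E_prob[OF p])
  have \<kappa>: "(\<lambda>t. nu (max 0 t)) \<in> measurable (E p) (subprob_algebra borel)"
    using nu_measurable by (simp cong: measurable_cong_sets)
  have prob: "prob_space (nu (max 0 t))" for t using real_distribution.axioms(1)[OF nu_rd] by simp
  have Q_sets: "sets Q = sets borel" unfolding Q_def by (rule sets_bind) auto
  have "prob_space Q" unfolding Q_def by (rule Ep.prob_space_bind[OF _ \<kappa>]) (simp add: prob)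
  then have Q_rd: "real_distribution Q"
    by (intro real_distribution.intro real_distribution_axioms.intro) (simp_all add: Q_sets)
  have Q_nonneg: "AE s in Q. 0 \<le> s"
    unfolding Q_def by (subst AE_bind[OF \<kappa>]) (auto intro!: AE_I2 nu_nonneg)
  have Q_int: "(\<integral>s. g s \<partial>Q) = p * (LINT t:{0<..}|lborel. exp (- p * t) * (\<integral>s. g s \<partial>nu t))"
    if g: "\<And>x. isCont g x" "\<And>x. \<bar>g x\<bar> \<le> B" for g :: "real \<Rightarrow> real" and B
  proof -
    have gm: "g \<in> borel_measurable borel"
      using g by (intro borel_measurable_continuous_onI continuous_at_imp_continuous_on) auto
    have "(\<integral>s. g s \<partial>Q) = (\<integral>t. (\<integral>s. g s \<partial>nu (max 0 t)) \<partial>E p)"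
      unfolding Q_def
    proof (rule integral_bind[OF gm _ \<kappa>])
      show "AE x in E p. emeasure (nu (max 0 x)) (space (nu (max 0 x))) \<le> ennreal 1"
        using prob_space.emeasure_space_1[OF prob] by simp
    qed (use g Ep.finite_measure_axioms in auto)
    also have "\<dots> = p * (LINT t:{0<..}|lborel. exp (- p * t) * (\<integral>s. g s \<partial>nu (max 0 t)))"
    proof (rule E_int[OF p])
      have "continuous_on UNIV (\<lambda>t. \<integral>s. g s \<partial>nu (max 0 t))"
        by (rule continuous_on_compose2[OF nu_continuous[OF g]]) (auto intro!: continuous_intros)
      then show "(\<lambda>t. \<integral>s. g s \<partial>nu (max 0 t)) \<in> borel_measurable borel"
        by (rule borel_measurable_continuous_onI)
    qed
    also have "(LINT t:{0<..}|lborel. exp (- p * t) * (\<integral>s. g s \<partial>nu (max 0 t))) = (LINT t:{0<..}|lborel. exp (- p * t) * (\<integral>s. g s \<partial>nu t))"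
      by (rule set_lebesgue_integral_cong) auto
    finally show ?thesis .
  qed
  let ?q = "p * K p"
  have q: "?q > 0" using p K_pos[OF p] by simp
  interpret Eq: prob_space "E ?q" by (rule E_prob[OF q])
  have Eq_rd: "real_distribution (E ?q)"
    by (intro real_distribution.intro real_distribution_axioms.intro Eq.prob_space_axioms) (simp_all add: Q_sets)
  have Eq_nonneg: "AE s in E ?q. 0 \<le> s"
    unfolding E_def by (subst AE_density) (auto simp: exponential_density_def)
  have "Q = E ?q"
  proof (rule laplace_unique[OF Q_rd Eq_rd Q_nonneg Eq_nonneg])
    fix j
    let ?l = "real (Suc j)"
    have "(\<integral>s. exp (- ?l * s) \<partial>Q) = (\<integral>s. exp (- ?l * max 0 s) \<partial>Q)"
      by (rule integral_cong_AE) (use Q_nonneg Q_sets in \<open>auto elim!: eventually_mono cong: measurable_cong_sets\<close>)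
    also have "\<dots> = p * (LINT t:{0<..}|lborel. exp (- p * t) * (\<integral>s. exp (- ?l * max 0 s) \<partial>nu t))"
      by (rule Q_int[of _ 1]) (auto intro!: continuous_intros mult_nonpos_nonneg)
    also have "(LINT t:{0<..}|lborel. exp (- p * t) * (\<integral>s. exp (- ?l * max 0 s) \<partial>nu t)) = (LINT t:{0<..}|lborel. exp (- p * t) * v j t)"
    proof (rule set_lebesgue_integral_cong)
      show "\<forall>t. t \<in> {0<..} \<longrightarrow> exp (- p * t) * (\<integral>s. exp (- ?l * max 0 s) \<partial>nu t) = exp (- p * t) * v j t"
      proof safe
        fix t :: real assume t: "0 < t"
        have "(\<integral>s. exp (- ?l * max 0 s) \<partial>nu t) = (\<integral>s. exp (- ?l * s) \<partial>nu t)"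
          by (rule integral_cong_AE)
            (use nu_nonneg[of t] nu_sets[of t] t in \<open>auto elim!: eventually_mono cong: measurable_cong_sets\<close>)
        then show "exp (- p * t) * (\<integral>s. exp (- ?l * max 0 s) \<partial>nu t) = exp (- p * t) * v j t"
          using nu_laplace[of t j] t by simp
      qed
    qed simp
    also have "\<dots> = K p / (p * K p + ?l)" by (rule v_laplace[OF p])
    finally have 1: "(\<integral>s. exp (- ?l * s) \<partial>Q) = p * (K p / (p * K p + ?l))" .
    have "(\<integral>s. exp (- ?l * s) \<partial>E ?q) = ?q * (LINT t:{0<..}|lborel. exp (- ?q * t) * exp (- ?l * t))"
      by (rule E_int[OF q]) auto
    also have "(LINT t:{0<..}|lborel. exp (- ?q * t) * exp (- ?l * t)) = 1 / (?q + ?l)"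
    proof -
      have "(LINT t:{0<..}|lborel. exp (- ?q * t) * exp (- ?l * t)) =
        enn2real (\<integral>\<^sup>+t. ennreal (indicator {0<..} t *\<^sub>R (exp (- ?q * t) * exp (- ?l * t))) \<partial>lborel)"
        unfolding set_lebesgue_integral_def by (rule integral_eq_nn_integral) auto
      also have "(\<integral>\<^sup>+t. ennreal (indicator {0<..} t *\<^sub>R (exp (- ?q * t) * exp (- ?l * t))) \<partial>lborel)
          = (\<integral>\<^sup>+t. ennreal (t ^ 0 / fact 0 * exp (- (?q + ?l) * t)) * indicator {0<..} t \<partial>lborel)"
        by (intro nn_integral_cong) (auto simp: mult_exp_exp algebra_simps split: split_indicator)
      also have "\<dots> = ennreal (1 / (?q + ?l))"
        using q by (subst nn_integral_power_exp) auto
      finally show ?thesis using q by simp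
    qed
    finally show "(\<integral>s. exp (- ?l * s) \<partial>Q) = (\<integral>s. exp (- ?l * s) \<partial>E ?q)" using 1 by simp
  qed
  moreover have "f \<in> borel_measurable borel"
    using f(1) by (intro borel_measurable_continuous_onI continuous_at_imp_continuous_on) auto
  ultimately have "p * (LINT t:{0<..}|lborel. exp (- p * t) * (\<integral>s. f s \<partial>nu t)) = p * (K p * (LINT s:{0<..}|lborel. exp (- ?q * s) * f s))"
    using Q_int[OF f, symmetric] E_int[OF q, of f] by (simp only: mult.assoc)
  then show ?thesis using p by (simp only: mult_cancel_left) simp
qed

end

section \<open>The heat kernel\<close>

text \<open>The error quotient at x0 is dominated by 2 g: the mean value inequality on the convex
  ball bounds the increment, and \<open>bnd\<close> at x0 bounds the linear term. Testing along
  sequences makes dominated convergence applicable.\<close>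

lemma has_derivative_integral_parametric:
  fixes f :: "'b \<Rightarrow> 'a::euclidean_space \<Rightarrow> real"
  assumes r: "r > 0"
    and der: "\<And>\<omega> x. \<omega> \<in> space M \<Longrightarrow> x \<in> ball x0 r \<Longrightarrow> (f \<omega> has_derivative D \<omega> x) (at x)"
    and bnd: "\<And>\<omega> x h. \<omega> \<in> space M \<Longrightarrow> x \<in> ball x0 r \<Longrightarrow> \<bar>D \<omega> x h\<bar> \<le> g \<omega> * norm h"
    and g: "integrable M g"
    and int: "\<And>x. x \<in> ball x0 r \<Longrightarrow> integrable M (\<lambda>\<omega>. f \<omega> x)"
    and meas: "\<And>h. (\<lambda>\<omega>. D \<omega> x0 h) \<in> borel_measurable M"
  shows "((\<lambda>x. \<integral>\<omega>. f \<omega> x \<partial>M) has_derivative (\<lambda>h. \<integral>\<omega>. D \<omega> x0 h \<partial>M)) (at x0)"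
proof -
  have x0: "x0 \<in> ball x0 r" using r by simp
  have lin: "linear (D \<omega> x0)" if "\<omega> \<in> space M" for \<omega>
    using der[OF that x0] by (simp add: has_derivative_linear)
  have Dint: "integrable M (\<lambda>\<omega>. D \<omega> x0 h)" for h
    by (rule Bochner_Integration.integrable_bound[OF integrable_mult_left[OF g, of "norm h"] meas])
      (use bnd[OF _ x0] in \<open>auto intro!: AE_I2 intro: order_trans[OF _ abs_ge_self]\<close>)
  have "linear (\<lambda>h. \<integral>\<omega>. D \<omega> x0 h \<partial>M)"
  proof (rule linearI)
    fix a b
    have "(\<integral>\<omega>. D \<omega> x0 (a + b) \<partial>M) = (\<integral>\<omega>. D \<omega> x0 a + D \<omega> x0 b \<partial>M)"
      by (intro Bochner_Integration.integral_cong refl linear_add lin)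
    then show "(\<integral>\<omega>. D \<omega> x0 (a + b) \<partial>M) = (\<integral>\<omega>. D \<omega> x0 a \<partial>M) + (\<integral>\<omega>. D \<omega> x0 b \<partial>M)"
      using Dint by simp
  next
    fix c b
    have "(\<integral>\<omega>. D \<omega> x0 (c *\<^sub>R b) \<partial>M) = (\<integral>\<omega>. c * D \<omega> x0 b \<partial>M)"
      by (intro Bochner_Integration.integral_cong refl) (simp add: linear_scale lin)
    then show "(\<integral>\<omega>. D \<omega> x0 (c *\<^sub>R b) \<partial>M) = c *\<^sub>R (\<integral>\<omega>. D \<omega> x0 b \<partial>M)" by simp
  qed
  then have bl: "bounded_linear (\<lambda>h. \<integral>\<omega>. D \<omega> x0 h \<partial>M)" by (rule linear_conv_bounded_linear[THEN iffD1])
  have mvt: "\<bar>f \<omega> y - f \<omega> x0\<bar> \<le> g \<omega> * norm (y - x0)" if "\<omega> \<in> space M" "y \<in> ball x0 r" for \<omega> y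
  proof -
    have "norm (f \<omega> y - f \<omega> x0) \<le> g \<omega> * norm (y - x0)"
    proof (rule differentiable_bound[OF convex_ball _ _ that(2) x0])
      fix x assume x: "x \<in> ball x0 r"
      show "(f \<omega> has_derivative D \<omega> x) (at x within ball x0 r)"
        using der[OF that(1) x] by (rule has_derivative_at_withinI)
      show "onorm (D \<omega> x) \<le> g \<omega>" using bnd[OF that(1) x] by (intro onorm_le) simp
    qed
    then show ?thesis by simp
  qed
  show ?thesis
  proof (rule has_derivativeI[OF bl], unfold tendsto_at_iff_sequentially, intro allI impI)
    fix X assume X: "\<forall>i. X i \<in> UNIV - {x0}" "X \<longlonglongrightarrow> x0"
    from X(2) r have "eventually (\<lambda>n. X n \<in> ball x0 r) sequentially"
      by (auto simp: tendsto_iff dist_commute)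
    then obtain N where N: "\<And>n. n \<ge> N \<Longrightarrow> X n \<in> ball x0 r" by (auto simp: eventually_sequentially)
    define Y where "Y n = X (n + N)" for n
    have Y: "Y n \<in> ball x0 r" "Y n \<noteq> x0" for n using N X by (auto simp: Y_def)
    have Ylim: "Y \<longlonglongrightarrow> x0" unfolding Y_def using X(2) by (rule LIMSEQ_ignore_initial_segment)
    define q where "q n \<omega> = (f \<omega> (Y n) - f \<omega> x0 - D \<omega> x0 (Y n - x0)) /\<^sub>R norm (Y n - x0)" for n \<omega>
    have "(\<lambda>n. \<integral>\<omega>. q n \<omega> \<partial>M) \<longlonglongrightarrow> (\<integral>\<omega>. 0 \<partial>M)"
    proof (rule integral_dominated_convergence[where w = "\<lambda>\<omega>. 2 * g \<omega>"])
      show "AE \<omega> in M. (\<lambda>n. q n \<omega>) \<longlonglongrightarrow> 0"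
      proof (rule AE_I2)
        fix \<omega> assume "\<omega> \<in> space M"
        from der[OF this x0] have "((\<lambda>y. ((f \<omega> y - f \<omega> x0) - D \<omega> x0 (y - x0)) /\<^sub>R norm (y - x0)) \<longlongrightarrow> 0) (at x0)"
          by (simp only: has_derivative_at_within)
        then show "(\<lambda>n. q n \<omega>) \<longlonglongrightarrow> 0"
          unfolding tendsto_at_iff_sequentially q_def using Y Ylim by (auto simp: o_def)
      qed
      show "AE \<omega> in M. norm (q n \<omega>) \<le> 2 * g \<omega>" for n
      proof (rule AE_I2)
        fix \<omega> assume w: "\<omega> \<in> space M"
        have "\<bar>f \<omega> (Y n) - f \<omega> x0 - D \<omega> x0 (Y n - x0)\<bar> \<le> 2 * g \<omega> * norm (Y n - x0)"
          using mvt[OF w Y(1), of n] bnd[OF w x0, of "Y n - x0"] by (simp add: abs_le_iff)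
        moreover have "norm (Y n - x0) > 0" using Y by simp
        ultimately show "norm (q n \<omega>) \<le> 2 * g \<omega>"
          unfolding q_def by (simp add: divide_inverse[symmetric] mult.commute[of "inverse _"] pos_divide_le_eq)
      qed
      show "q n \<in> borel_measurable M" for n
        unfolding q_def using int[OF Y(1)[of n]] int[OF x0] meas by (auto intro!: borel_measurable_scaleR borel_measurable_diff)
      show "integrable M (\<lambda>\<omega>. 2 * g \<omega>)" using g by simp
    qed simp
    moreover have "(\<integral>\<omega>. q n \<omega> \<partial>M) = ((\<integral>\<omega>. f \<omega> (Y n) \<partial>M) - (\<integral>\<omega>. f \<omega> x0 \<partial>M) - (\<integral>\<omega>. D \<omega> x0 (Y n - x0) \<partial>M)) /\<^sub>R norm (Y n - x0)" for n
      unfolding q_def using int[OF Y(1)[of n]] int[OF x0] Dint by simp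
    ultimately have "(\<lambda>n. ((\<integral>\<omega>. f \<omega> (Y n) \<partial>M) - (\<integral>\<omega>. f \<omega> x0 \<partial>M) - (\<integral>\<omega>. D \<omega> x0 (Y n - x0) \<partial>M)) /\<^sub>R norm (Y n - x0)) \<longlonglongrightarrow> 0"
      by simp
    then show "((\<lambda>y. ((\<integral>\<omega>. f \<omega> y \<partial>M) - (\<integral>\<omega>. f \<omega> x0 \<partial>M) - (\<integral>\<omega>. D \<omega> x0 (y - x0) \<partial>M)) /\<^sub>R norm (y - x0)) \<circ> X) \<longlonglongrightarrow> 0"
      unfolding Y_def o_def by (rule LIMSEQ_offset)
  qed
qed

section \<open>The heat kernel and its polynomial multiples\<close>

text \<open>For x \<noteq> 0 the value 0 at s \<le> 0 extends the kernel continuously in s to the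
  whole line, so that it can be integrated against weakly convergent laws.\<close>

definition heat :: "real \<Rightarrow> 'a::euclidean_space \<Rightarrow> real" where
  "heat s x = (if s > 0 then exp (- (norm x)\<^sup>2 / (4 * s)) / sqrt (4 * pi * s) ^ DIM('a) else 0)"

lemma heat_nonneg: "0 \<le> heat s x"
  by (simp add: heat_def)

lemma heat_measurable [measurable]: "(\<lambda>(s, x). heat s x) \<in> borel_measurable (borel \<Otimes>\<^sub>M borel)"
  unfolding heat_def by measurable

lemma heat_minus [simp]: "heat s (- x) = heat s x"
  by (simp add: heat_def)

lemma heat_eq_prod:
  fixes x :: "'a::euclidean_space"
  assumes "s > 0" shows "heat s x = (\<Prod>b\<in>Basis. normal_density 0 (sqrt (2 * s)) (x \<bullet> b))"
proof -
  have "(norm x)\<^sup>2 = x \<bullet> x" by (simp add: power2_norm_eq_inner)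
  also have "\<dots> = (\<Sum>b\<in>Basis. (x \<bullet> b)\<^sup>2)"
    by (subst euclidean_inner) (simp add: power2_eq_square)
  finally have "(norm x)\<^sup>2 = (\<Sum>b\<in>Basis. (x \<bullet> b)\<^sup>2)" .
  then show ?thesis
    using assms by (simp add: heat_def normal_density_def prod_dividef exp_sum[symmetric] sum_negf sum_divide_distrib mult_ac)
qed

lemma nn_integral_heat:
  fixes x :: "'a::euclidean_space"
  assumes s: "s > 0" shows "(\<integral>\<^sup>+y. ennreal (heat s (x - y)) \<partial>lborel) = 1"
proof -
  have "(\<integral>\<^sup>+y. ennreal (heat s (x - y)) \<partial>lborel) = (\<integral>\<^sup>+y. ennreal (heat s (x - y)) \<partial>distr lborel borel ((+) x))"
    by (simp add: lborel_distr_plus)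
  also have "\<dots> = (\<integral>\<^sup>+y. ennreal (heat s (y::'a)) \<partial>lborel)"
    by (subst nn_integral_distr) auto
  also have "\<dots> = (\<integral>\<^sup>+y. (\<Prod>b\<in>Basis. ennreal (normal_density 0 (sqrt (2 * s)) (y \<bullet> b))) \<partial>(lborel :: 'a measure))"
    by (simp add: heat_eq_prod[OF s] prod_ennreal)
  also have "\<dots> = (\<Prod>b\<in>(Basis::'a set). (\<integral>\<^sup>+t. ennreal (normal_density 0 (sqrt (2 * s)) t) \<partial>lborel))"
    by (rule nn_integral_lborel_prod) auto
  also have "\<dots> = 1"
    using s by (subst nn_integral_eq_integral) auto
  finally show ?thesis .
qed

lemma
  fixes x :: "'a::euclidean_space"
  shows heat_integrable: "integrable lborel (\<lambda>y. heat s (x - y))"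
    and heat_integral: "s > 0 \<Longrightarrow> (\<integral>y. heat s (x - y) \<partial>lborel) = 1"
proof -
  show "integrable lborel (\<lambda>y. heat s (x - y))"
  proof (cases "s > 0")
    case True
    then show ?thesis
      by (intro integrableI_nonneg) (auto simp: heat_nonneg nn_integral_heat)
  next
    case False
    then have "(\<lambda>y. heat s (x - y)) = (\<lambda>y. 0)" by (simp add: heat_def)
    then show ?thesis by simp
  qed
  show "s > 0 \<Longrightarrow> (\<integral>y. heat s (x - y) \<partial>lborel) = 1"
    by (subst integral_eq_nn_integral) (auto simp: heat_nonneg nn_integral_heat)
qed

text \<open>Functions \<open>q(s, x)\<close> polynomial in \<open>x\<close> and \<open>1/s\<close>; the products \<open>q * heat\<close> are closed under spatial derivatives.\<close>

inductive heat_poly :: "(real \<Rightarrow> 'a::euclidean_space \<Rightarrow> real) \<Rightarrow> bool" where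
  heat_poly_const: "heat_poly (\<lambda>s x. c)"
| heat_poly_inverse: "heat_poly (\<lambda>s x. 1 / s)"
| heat_poly_inner: "heat_poly (\<lambda>s x. x \<bullet> v)"
| heat_poly_add: "heat_poly p \<Longrightarrow> heat_poly q \<Longrightarrow> heat_poly (\<lambda>s x. p s x + q s x)"
| heat_poly_mult: "heat_poly p \<Longrightarrow> heat_poly q \<Longrightarrow> heat_poly (\<lambda>s x. p s x * q s x)"

lemma heat_poly_deriv:
  assumes "heat_poly q"
  shows "\<exists>D. (\<forall>s x. (q s has_derivative (\<lambda>h. D h s x)) (at x)) \<and> (\<forall>h. heat_poly (D h))"
  using assms
proof induction
  case (heat_poly_const c)
  show ?case by (rule exI[of _ "\<lambda>h s x. 0"]) (auto intro: heat_poly.intros)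
next
  case heat_poly_inverse
  show ?case by (rule exI[of _ "\<lambda>h s x. 0"]) (auto intro: heat_poly.intros)
next
  case (heat_poly_inner v)
  show ?case by (rule exI[of _ "\<lambda>h s x. h \<bullet> v"]) (auto intro: heat_poly.intros intro!: derivative_eq_intros)
next
  case (heat_poly_add p q)
  then obtain D E where D: "\<And>s x. (p s has_derivative (\<lambda>h. D h s x)) (at x)" "\<And>h. heat_poly (D h)"
    and E: "\<And>s x. (q s has_derivative (\<lambda>h. E h s x)) (at x)" "\<And>h. heat_poly (E h)" by metis
  show ?case
    by (rule exI[of _ "\<lambda>h s x. D h s x + E h s x"]) (auto intro!: heat_poly.intros derivative_intros D E)
next
  case (heat_poly_mult p q)
  then obtain D E where D: "\<And>s x. (p s has_derivative (\<lambda>h. D h s x)) (at x)" "\<And>h. heat_poly (D h)"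
    and E: "\<And>s x. (q s has_derivative (\<lambda>h. E h s x)) (at x)" "\<And>h. heat_poly (E h)" by metis
  show ?case
    by (rule exI[of _ "\<lambda>h s x. p s x * E h s x + D h s x * q s x"])
      (auto intro!: heat_poly.intros derivative_intros D E heat_poly_mult)
qed

lemma heat_poly_bound:
  assumes "heat_poly q"
  shows "\<exists>C k. C \<ge> 0 \<and> (\<forall>s>0. \<forall>x. \<bar>q s x\<bar> \<le> C * (1 + 1 / s) ^ k * (1 + norm x) ^ k)"
  using assms
proof induction
  case (heat_poly_const c)
  show ?case by (rule exI[of _ "\<bar>c\<bar>"], rule exI[of _ 0]) auto
next
  case heat_poly_inverse
  have "1 / s \<le> (1 + 1 / s) * (1 + norm x)" if "s > 0" for s and x :: 'a
    using that mult_mono[of "1 / s" "1 + 1 / s" 1 "1 + norm x"] by simp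
  then show ?case by (intro exI[of _ 1]) (auto simp: abs_if)
next
  case (heat_poly_inner v)
  have "\<bar>x \<bullet> v\<bar> \<le> norm v * (1 + 1 / s) * (1 + norm x)" if "s > 0" for s and x :: 'a
  proof -
    have "\<bar>x \<bullet> v\<bar> \<le> norm v * norm x" using Cauchy_Schwarz_ineq2[of x v] by (simp add: mult.commute)
    also have "\<dots> \<le> norm v * ((1 + 1 / s) * (1 + norm x))"
      using that mult_mono[of 1 "1 + 1 / s" "norm x" "1 + norm x"] by (intro mult_left_mono) auto
    finally show ?thesis by (simp add: mult.assoc)
  qed
  then show ?case by (intro exI[of _ "norm v"] exI[of _ 1]) auto
next
  case (heat_poly_add p q)
  then obtain C k C' k' where 1: "C \<ge> 0" "\<And>s x. s > 0 \<Longrightarrow> \<bar>p s x\<bar> \<le> C * (1 + 1 / s) ^ k * (1 + norm x) ^ k"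
    and 2: "C' \<ge> 0" "\<And>s x. s > 0 \<Longrightarrow> \<bar>q s x\<bar> \<le> C' * (1 + 1 / s) ^ k' * (1 + norm x) ^ k'" by metis
  have mono: "(1 + 1 / s) ^ k * (1 + norm x) ^ k \<le> (1 + 1 / s) ^ m * (1 + norm x) ^ m" if "k \<le> m" "s > 0" for s k m and x :: 'a
    using that by (intro mult_mono power_increasing) auto
  have "\<bar>p s x + q s x\<bar> \<le> (C + C') * (1 + 1 / s) ^ (k + k') * (1 + norm x) ^ (k + k')" if s: "s > 0" for s x
  proof -
    have "\<bar>p s x\<bar> \<le> C * ((1 + 1 / s) ^ (k + k') * (1 + norm x) ^ (k + k'))"
      using 1(2)[OF s, of x] mult_left_mono[OF mono[of k "k + k'" s x] 1(1)] s by (simp add: mult.assoc)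
    moreover have "\<bar>q s x\<bar> \<le> C' * ((1 + 1 / s) ^ (k + k') * (1 + norm x) ^ (k + k'))"
      using 2(2)[OF s, of x] mult_left_mono[OF mono[of k' "k + k'" s x] 2(1)] s by (simp add: mult.assoc)
    ultimately show ?thesis by (simp add: distrib_right mult.assoc)
  qed
  then show ?case using 1(1) 2(1) by (intro exI[of _ "C + C'"] exI[of _ "k + k'"]) auto
next
  case (heat_poly_mult p q)
  then obtain C k C' k' where 1: "C \<ge> 0" "\<And>s x. s > 0 \<Longrightarrow> \<bar>p s x\<bar> \<le> C * (1 + 1 / s) ^ k * (1 + norm x) ^ k"
    and 2: "C' \<ge> 0" "\<And>s x. s > 0 \<Longrightarrow> \<bar>q s x\<bar> \<le> C' * (1 + 1 / s) ^ k' * (1 + norm x) ^ k'" by metis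
  have "\<bar>p s x * q s x\<bar> \<le> (C * C') * (1 + 1 / s) ^ (k + k') * (1 + norm x) ^ (k + k')" if s: "s > 0" for s x
  proof -
    have "\<bar>p s x * q s x\<bar> \<le> (C * (1 + 1 / s) ^ k * (1 + norm x) ^ k) * (C' * (1 + 1 / s) ^ k' * (1 + norm x) ^ k')"
      unfolding abs_mult using 1 2 s by (intro mult_mono) auto
    then show ?thesis by (simp add: power_add mult_ac)
  qed
  then show ?case using 1(1) 2(1) by (intro exI[of _ "C * C'"] exI[of _ "k + k'"]) auto
qed

lemma heat_poly_measurable [measurable (raw)]:
  assumes "heat_poly q" shows "(\<lambda>(s, x). q s x) \<in> borel_measurable (borel \<Otimes>\<^sub>M borel)"
  using assms by induction (simp_all add: case_prod_unfold)

lemma heat_poly_diff: "heat_poly p \<Longrightarrow> heat_poly q \<Longrightarrow> heat_poly (\<lambda>s x. p s x - q s x)"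
  using heat_poly_add[OF _ heat_poly_mult[OF heat_poly_const[of "-1"]]] by fastforce

lemma heat_deriv:
  fixes x :: "'a::euclidean_space"
  shows "(heat s has_derivative (\<lambda>h. - (x \<bullet> h) / (2 * s) * heat s x)) (at x)"
proof (cases "s > 0")
  case True
  define c where "c = sqrt (4 * pi * s) ^ DIM('a)"
  have "c > 0" using True by (simp add: c_def)
  have "heat s = (\<lambda>x::'a. 1 / c * exp (- 1 / (4 * s) * (x \<bullet> x)))"
    using True by (simp add: heat_def fun_eq_iff power2_norm_eq_inner c_def)
  moreover have "((\<lambda>x::'a. 1 / c * exp (- 1 / (4 * s) * (x \<bullet> x))) has_derivative
     (\<lambda>h. 1 / c * (exp (- 1 / (4 * s) * (x \<bullet> x)) * (- 1 / (4 * s) * (x \<bullet> h + h \<bullet> x))))) (at x)"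
    using True \<open>c > 0\<close> by (auto intro!: derivative_eq_intros ext simp: field_simps)
  moreover have "(\<lambda>h. 1 / c * (exp (- 1 / (4 * s) * (x \<bullet> x)) * (- 1 / (4 * s) * (x \<bullet> h + h \<bullet> x)))) =
      (\<lambda>h. - (x \<bullet> h) / (2 * s) * heat s x)"
  proof
    fix h
    show "1 / c * (exp (- 1 / (4 * s) * (x \<bullet> x)) * (- 1 / (4 * s) * (x \<bullet> h + h \<bullet> x))) = - (x \<bullet> h) / (2 * s) * heat s x"
      unfolding calculation(1) inner_commute[of h x] using True by (simp add: field_simps)
  qed
  ultimately show ?thesis by simp
next
  case False
  then have "heat s = (\<lambda>x::'a. 0)" by (simp add: heat_def fun_eq_iff)
  then show ?thesis by simp
qed

lemma heat_poly_heat_deriv: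
  assumes "heat_poly q"
  shows "\<exists>D. (\<forall>s x. ((\<lambda>x. q s x * heat s x) has_derivative (\<lambda>h. D h s x * heat s x)) (at x)) \<and> (\<forall>h. heat_poly (D h))"
proof -
  obtain D where D: "\<And>s x. (q s has_derivative (\<lambda>h. D h s x)) (at x)" "\<And>h. heat_poly (D h)"
    using heat_poly_deriv[OF assms] by blast
  define E where "E h s x = D h s x - q s x * (1 / 2 * (1 / s) * (x \<bullet> h))" for h :: 'a and s and x :: 'a
  have "((\<lambda>x. q s x * heat s x) has_derivative (\<lambda>h. E h s x * heat s x)) (at x)" for s x
    by (rule has_derivative_eq_rhs[OF has_derivative_mult[OF D(1) heat_deriv]])
      (auto simp: E_def fun_eq_iff field_simps)
  moreover have "heat_poly (E h)" for h
    unfolding E_def by (intro heat_poly_diff D heat_poly_mult assms heat_poly.intros)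
  ultimately show ?thesis by blast
qed

section \<open>Mixtures of heat kernels\<close>

lemma power_times_exp_bounded:
  fixes a :: real
  assumes "a > 0"
  shows "\<exists>B. \<forall>y\<ge>0. (1 + y) ^ m * exp (- (a * y)) \<le> B"
proof (intro exI allI impI)
  fix y :: real assume y: "y \<ge> 0"
  let ?z = "a * (1 + y)"
  have "(\<Sum>n\<in>{m}. inverse (fact n) * ?z ^ n) \<le> (\<Sum>n. inverse (fact n) * ?z ^ n)"
    using y assms by (intro sum_le_suminf summable_exp) auto
  then have "?z ^ m / fact m \<le> exp ?z"
    by (simp add: exp_def scaleR_conv_of_real divide_inverse mult.commute)
  then have "?z ^ m \<le> exp ?z * fact m" by (simp only: pos_divide_le_eq fact_gt_zero)
  then have "a ^ m * (1 + y) ^ m \<le> fact m * exp a * exp (a * y)"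
    unfolding power_mult_distrib by (simp add: exp_add distrib_left mult_ac)
  then have "(1 + y) ^ m \<le> (fact m * exp a / a ^ m) * exp (a * y)"
    using assms by (simp add: field_simps)
  then have "(1 + y) ^ m * exp (- (a * y)) \<le> ((fact m * exp a / a ^ m) * exp (a * y)) * exp (- (a * y))"
    by (intro mult_right_mono) auto
  then show "(1 + y) ^ m * exp (- (a * y)) \<le> fact m * exp a / a ^ m"
    by (simp add: mult.assoc mult_exp_exp)
qed

text \<open>Away from the origin exp(- |x|^2 / (4 s)) beats every power of 1/s, uniformly in s. A
  constant therefore dominates each spatial derivative, and constants are integrable for every
  finite measure in s.\<close>

lemma heat_poly_heat_bounded:
  assumes q: "heat_poly (q :: real \<Rightarrow> 'a::euclidean_space \<Rightarrow> real)" and \<delta>: "0 < \<delta>"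
  shows "\<exists>B\<ge>0. \<forall>s x. \<delta> \<le> norm x \<longrightarrow> norm x \<le> \<rho> \<longrightarrow> \<bar>q s x * heat s x\<bar> \<le> B"
proof -
  obtain C k where C: "C \<ge> 0" "\<And>s x. s > 0 \<Longrightarrow> \<bar>q s x\<bar> \<le> C * (1 + 1 / s) ^ k * (1 + norm x) ^ k"
    using heat_poly_bound[OF q] by blast
  let ?n = "DIM('a)"
  have "\<delta>\<^sup>2 / 4 > 0" using \<delta> by simp
  then obtain B where B: "\<And>y. y \<ge> 0 \<Longrightarrow> (1 + y) ^ (k + ?n) * exp (- (\<delta>\<^sup>2 / 4 * y)) \<le> B"
    using power_times_exp_bounded by blast
  have B0: "B \<ge> 0" using B[of 0] by simp
  have "\<bar>q s x * heat s x\<bar> \<le> C * (1 + \<bar>\<rho>\<bar>) ^ k * B" if x: "\<delta> \<le> norm x" "norm x \<le> \<rho>" for s x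
  proof (cases "s > 0")
    case s: True
    define y where "y = 1 / s"
    have y: "y > 0" using s by (simp add: y_def)
    have "1 / (4 * pi * s) \<le> y"
      using s pi_ge_two by (simp add: y_def field_simps)
    also have "\<dots> \<le> (1 + y)\<^sup>2" using y by (simp add: power2_eq_square algebra_simps)
    finally have "sqrt (1 / (4 * pi * s)) \<le> 1 + y"
      using y by (intro real_le_lsqrt) auto
    then have "sqrt (1 / (4 * pi * s)) ^ ?n \<le> (1 + y) ^ ?n" using s by (intro power_mono) auto
    moreover have "heat s x = exp (- (norm x)\<^sup>2 / (4 * s)) * sqrt (1 / (4 * pi * s)) ^ ?n"
      using s by (simp add: heat_def real_sqrt_divide power_one_over)
    moreover have "exp (- (norm x)\<^sup>2 / (4 * s)) \<le> exp (- (\<delta>\<^sup>2 / 4 * y))"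
      using s x \<delta> by (simp add: y_def divide_right_mono power_mono)
    ultimately have h: "heat s x \<le> exp (- (\<delta>\<^sup>2 / 4 * y)) * (1 + y) ^ ?n"
      using s by (simp only:) (intro mult_mono, auto)
    have "\<bar>q s x\<bar> \<le> C * (1 + y) ^ k * (1 + norm x) ^ k" using C(2)[OF s] by (simp add: y_def)
    also have "\<dots> \<le> C * (1 + y) ^ k * (1 + \<bar>\<rho>\<bar>) ^ k"
      using C y x by (intro mult_left_mono power_mono mult_nonneg_nonneg) auto
    finally have "\<bar>q s x * heat s x\<bar> \<le> (C * (1 + y) ^ k * (1 + \<bar>\<rho>\<bar>) ^ k) * (exp (- (\<delta>\<^sup>2 / 4 * y)) * (1 + y) ^ ?n)"
      unfolding abs_mult using h C(1) y by (intro mult_mono) (auto simp: heat_nonneg)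
    also have "\<dots> = (C * (1 + \<bar>\<rho>\<bar>) ^ k) * ((1 + y) ^ (k + ?n) * exp (- (\<delta>\<^sup>2 / 4 * y)))"
      by (simp add: power_add mult_ac)
    also have "\<dots> \<le> (C * (1 + \<bar>\<rho>\<bar>) ^ k) * B"
      using B[of y] y C(1) by (intro mult_left_mono) auto
    finally show ?thesis .
  next
    case False
    then show ?thesis using C(1) B0 by (simp add: heat_def)
  qed
  then show ?thesis using C(1) B0 by (intro exI[of _ "C * (1 + \<bar>\<rho>\<bar>) ^ k * B"]) auto
qed

text \<open>The delicate point is s = 0: boundedness of heat / s, an instance of
  \<open>heat_poly_heat_bounded\<close>, gives the estimate B |s|.\<close>

lemma heat_isCont_time:
  fixes x :: "'a::euclidean_space"
  assumes x: "x \<noteq> 0"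
  shows "isCont (\<lambda>s. heat s x) s"
proof -
  consider "s > 0" | "s < 0" | "s = 0" by linarith
  then show ?thesis
  proof cases
    case 1
    have "isCont (\<lambda>s. exp (- (norm x)\<^sup>2 / (4 * s)) / sqrt (4 * pi * s) ^ DIM('a)) s"
      using 1 by (auto intro!: continuous_intros)
    moreover have "eventually (\<lambda>s. heat s x = exp (- (norm x)\<^sup>2 / (4 * s)) / sqrt (4 * pi * s) ^ DIM('a)) (nhds s)"
      using eventually_nhds_in_open[of "{0<..}" s] 1 by (auto simp: heat_def elim!: eventually_mono)
    ultimately show ?thesis by (simp add: isCont_cong)
  next
    case 2
    have "eventually (\<lambda>s. heat s x = 0) (nhds s)"
      using eventually_nhds_in_open[of "{..<0}" s] 2 by (auto simp: heat_def elim!: eventually_mono)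
    then show ?thesis by (simp add: isCont_cong)
  next
    case 3
    obtain B where B: "\<And>s. \<bar>1 / s * heat s x\<bar> \<le> B"
      using heat_poly_heat_bounded[OF heat_poly_inverse, of "norm x" "norm x"] x by auto
    have "((\<lambda>s. heat s x) \<longlongrightarrow> 0) (at 0)"
    proof (rule Lim_null_comparison)
      show "eventually (\<lambda>s. norm (heat s x) \<le> B * \<bar>s\<bar>) (at 0)"
      proof (rule eventually_at_filter[THEN iffD2], intro always_eventually allI impI)
        fix s :: real assume "s \<noteq> 0"
        then show "norm (heat s x) \<le> B * \<bar>s\<bar>"
          using B[of s] by (simp add: abs_mult field_simps pos_divide_le_eq)
      qed
      show "((\<lambda>s. B * \<bar>s\<bar>) \<longlongrightarrow> 0) (at 0)" by (auto intro!: tendsto_eq_intros)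
    qed
    then show ?thesis unfolding 3 isCont_def by (simp add: heat_def)
  qed
qed

lemma heat_bounded_time:
  fixes x :: "'a::euclidean_space"
  assumes "x \<noteq> 0" obtains B where "\<And>s. \<bar>heat s x\<bar> \<le> B"
  using heat_poly_heat_bounded[OF heat_poly_const[of 1], of "norm x" "norm x"] assms by auto

locale heat_mixture = finite_measure N for N :: "real measure" +
  assumes sets_N [measurable_cong, simp]: "sets N = sets borel"
begin

lemma heat_poly_integral_deriv:
  assumes q: "heat_poly (q :: real \<Rightarrow> 'a::euclidean_space \<Rightarrow> real)"
  shows "\<exists>D. (\<forall>h. heat_poly (D h)) \<and>
    (\<forall>x. x \<noteq> 0 \<longrightarrow> ((\<lambda>x. \<integral>s. q s x * heat s x \<partial>N) has_derivative (\<lambda>h. \<integral>s. D h s x * heat s x \<partial>N)) (at x))"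
proof -
  obtain D where D: "\<And>s x. ((\<lambda>x. q s x * heat s x) has_derivative (\<lambda>h. D h s x * heat s x)) (at x)" "\<And>h. heat_poly (D h)"
    using heat_poly_heat_deriv[OF q] by blast
  have meas: "(\<lambda>s. p s x * heat s x) \<in> borel_measurable N" if "heat_poly p" for p and x :: 'a
  proof -
    have "(\<lambda>s. p s x) \<in> borel_measurable borel"
      using measurable_compose[OF _ heat_poly_measurable[OF that], of "\<lambda>s. (s, x)" borel] by simp
    then show ?thesis by simp
  qed
  have "((\<lambda>x. \<integral>s. q s x * heat s x \<partial>N) has_derivative (\<lambda>h. \<integral>s. D h s x0 * heat s x0 \<partial>N)) (at x0)" if x0: "x0 \<noteq> 0" for x0
  proof -
    let ?r = "norm x0 / 2"
    have near: "?r \<le> norm x \<and> norm x \<le> 2 * norm x0" if "x \<in> ball x0 ?r" for x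
      using that norm_triangle_ineq2[of x0 x] norm_triangle_ineq2[of x x0] x0
      by (auto simp: dist_norm norm_minus_commute)
    have "\<exists>B\<ge>0. \<forall>s x. ?r \<le> norm x \<longrightarrow> norm x \<le> 2 * norm x0 \<longrightarrow> \<bar>D h s x * heat s x\<bar> \<le> B" for h
      by (rule heat_poly_heat_bounded[OF D(2)]) (use x0 in simp)
    then obtain B where B: "\<And>h. B h \<ge> 0" "\<And>h s x. ?r \<le> norm x \<Longrightarrow> norm x \<le> 2 * norm x0 \<Longrightarrow> \<bar>D h s x * heat s x\<bar> \<le> B h"
      by metis
    obtain A where A: "A \<ge> 0" "\<And>s x. ?r \<le> norm x \<Longrightarrow> norm x \<le> 2 * norm x0 \<Longrightarrow> \<bar>q s x * heat s x\<bar> \<le> A"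
      using heat_poly_heat_bounded[OF q, of ?r "2 * norm x0"] x0 by auto
    show ?thesis
    proof (rule has_derivative_integral_parametric[where r = ?r and g = "\<lambda>_. \<Sum>b\<in>Basis. B b"])
      fix s x h assume x: "x \<in> ball x0 ?r"
      interpret L: bounded_linear "\<lambda>h. D h s x * heat s x" using D(1) by (rule has_derivative_bounded_linear)
      \<comment> \<open>The constants \<open>B h\<close> carry no uniformity in h; linearity in h
        reduces the bound to the finitely many basis directions.\<close>
      have "D h s x * heat s x = D (\<Sum>b\<in>Basis. (h \<bullet> b) *\<^sub>R b) s x * heat s x" by (simp add: euclidean_representation)
      also have "\<dots> = (\<Sum>b\<in>Basis. (h \<bullet> b) * (D b s x * heat s x))"
        by (subst L.sum) (simp add: L.scaleR)
      finally have "\<bar>D h s x * heat s x\<bar> \<le> (\<Sum>b\<in>Basis. \<bar>(h \<bullet> b) * (D b s x * heat s x)\<bar>)" by simp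
      also have "\<dots> \<le> (\<Sum>b\<in>Basis. norm h * B b)"
        unfolding abs_mult[of "h \<bullet> _"] using near[OF x] B(2) by (intro sum_mono mult_mono Basis_le_norm) auto
      finally show "\<bar>D h s x * heat s x\<bar> \<le> (\<Sum>b\<in>Basis. B b) * norm h"
        by (simp add: sum_distrib_left mult.commute)
    next
      fix x assume x: "x \<in> ball x0 ?r"
      show "integrable N (\<lambda>s. q s x * heat s x)"
        by (rule integrable_const_bound[where B = A]) (use near[OF x] A(2) meas[OF q] in auto)
    qed (use x0 D meas in auto)
  qed
  then show ?thesis using D(2) by blast
qed

text \<open>Coinduction with the invariant that the function agrees off 0 with the mixture of some
  polynomial multiple of the heat kernel. Only values at x \<noteq> 0 are prescribed, since nothing
  is known about Frechet derivatives at 0.\<close>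

lemma smooth_on_heat_poly_integral:
  assumes "heat_poly (q :: real \<Rightarrow> 'a::euclidean_space \<Rightarrow> real)"
  shows "smooth_on (- {0}) (\<lambda>x. \<integral>s. q s x * heat s x \<partial>N)"
proof -
  define X where "X S f \<longleftrightarrow> S = - {0} \<and> (\<exists>q. heat_poly q \<and> (\<forall>x. x \<noteq> 0 \<longrightarrow> f x = (\<integral>s. q s x * heat s x \<partial>N)))" for S :: "'a set" and f :: "'a \<Rightarrow> real"
  have "X (- {0}) (\<lambda>x. \<integral>s. q s x * heat s x \<partial>N)" unfolding X_def using assms by blast
  then show ?thesis
  proof (rule smooth_on.coinduct[of X])
    fix S f assume "X S f"
    then obtain q where S: "S = - {0}" and q: "heat_poly q" and f: "\<And>x. x \<noteq> 0 \<Longrightarrow> f x = (\<integral>s. q s x * heat s x \<partial>N)"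
      unfolding X_def by blast
    obtain D where D: "\<And>h. heat_poly (D h)"
      "\<And>x. x \<noteq> 0 \<Longrightarrow> ((\<lambda>x. \<integral>s. q s x * heat s x \<partial>N) has_derivative (\<lambda>h. \<integral>s. D h s x * heat s x \<partial>N)) (at x)"
      using heat_poly_integral_deriv[OF q] by blast
    have fD: "(f has_derivative (\<lambda>h. \<integral>s. D h s x * heat s x \<partial>N)) (at x)" if "x \<noteq> 0" for x
      by (rule has_derivative_transform_within_open[OF D(2)[OF that], of "- {0}"]) (use that f in auto)
    have "frechet_derivative f (at x) v = (\<integral>s. D v s x * heat s x \<partial>N)" if "x \<noteq> 0" for x v
      using frechet_derivative_at[OF fD[OF that]] by metis
    then have "X S (\<lambda>x. frechet_derivative f (at x) v)" for v
      unfolding X_def using S D(1) by blast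
    then show "\<exists>S' f'. S = S' \<and> f = f' \<and> (\<forall>x\<in>S'. f' differentiable at x) \<and>
        (\<forall>v. X S' (\<lambda>x. frechet_derivative f' (at x) v) \<or> smooth_on S' (\<lambda>x. frechet_derivative f' (at x) v))"
      using fD S by (auto simp: differentiable_def)
  qed
qed

end

section \<open>The heat semigroup on bounded data\<close>

text \<open>Half of the Gaussian exponent is split off to absorb polynomial factors; the other half
  is again a heat kernel, at the doubled time, whose integral is known.\<close>

lemma heat_double:
  fixes y :: "'a::euclidean_space"
  assumes "t > 0"
  shows "heat t y = sqrt 2 ^ DIM('a) * exp (- (norm y)\<^sup>2 / (8 * t)) * heat (2 * t) y"
proof -
  have "sqrt (4 * pi * (2 * t)) = sqrt 2 * sqrt (4 * pi * t)"
    by (simp add: real_sqrt_mult[symmetric] mult_ac)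
  moreover have "exp (- (norm y)\<^sup>2 / (8 * t)) * exp (- (norm y)\<^sup>2 / (4 * (2 * t))) = exp (- (norm y)\<^sup>2 / (4 * t))"
    using assms by (simp add: mult_exp_exp field_simps)
  ultimately show ?thesis using assms
    by (simp add: heat_def power_mult_distrib)
qed

text \<open>Since |x0 - xi|^2 \<le> 2 |x - xi|^2 + 2 R^2, one kernel centred at x0 dominates all
  kernels centred within distance R. This supplies the dominating functions for limits in x.\<close>

lemma heat_shift_le:
  fixes x :: "'a::euclidean_space"
  assumes t: "t > 0" and x: "norm (x - x0) \<le> R"
  shows "heat t (x - \<xi>) \<le> sqrt 2 ^ DIM('a) * exp (R\<^sup>2 / (4 * t)) * heat (2 * t) (x0 - \<xi>)"
proof -
  have "(norm (x0 - \<xi>))\<^sup>2 \<le> (R + norm (x - \<xi>))\<^sup>2"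
    using x norm_triangle_ineq4[of "x - \<xi>" "x - x0"] by (intro power_mono) (auto simp: algebra_simps)
  also have "\<dots> \<le> 2 * (norm (x - \<xi>))\<^sup>2 + 2 * R\<^sup>2"
    using sum_squares_ge_zero[of "R - norm (x - \<xi>)" 0] by (simp add: power2_eq_square algebra_simps)
  finally have "(norm (x0 - \<xi>))\<^sup>2 / (8 * t) \<le> (2 * (norm (x - \<xi>))\<^sup>2 + 2 * R\<^sup>2) / (8 * t)"
    using t by (intro divide_right_mono) auto
  also have "\<dots> = (norm (x - \<xi>))\<^sup>2 / (4 * t) + R\<^sup>2 / (4 * t)" using t by (simp add: field_simps)
  finally have "- (norm (x - \<xi>))\<^sup>2 / (4 * t) \<le> R\<^sup>2 / (4 * t) + - (norm (x0 - \<xi>))\<^sup>2 / (4 * (2 * t))" by simp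
  then have "exp (- (norm (x - \<xi>))\<^sup>2 / (4 * t)) \<le> exp (R\<^sup>2 / (4 * t)) * exp (- (norm (x0 - \<xi>))\<^sup>2 / (4 * (2 * t)))"
    by (simp only: exp_add[symmetric] exp_le_cancel_iff)
  moreover have "sqrt (4 * pi * (2 * t)) = sqrt 2 * sqrt (4 * pi * t)"
    by (simp add: real_sqrt_mult[symmetric] mult_ac)
  ultimately show ?thesis using t
    by (simp add: heat_def power_mult_distrib divide_right_mono)
qed

locale bounded_datum =
  fixes w :: "'a::euclidean_space \<Rightarrow> real" and B :: real
  assumes w_meas [measurable]: "w \<in> borel_measurable borel"
    and w_bound: "\<And>x. \<bar>w x\<bar> \<le> B"
begin

lemma B_nonneg: "B \<ge> 0" using w_bound[of 0] by simp

lemma conv_le: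
  assumes "\<bar>a\<bar> \<le> A * r"
  shows "\<bar>a * w \<xi>\<bar> \<le> A * B * r"
proof -
  have "\<bar>a * w \<xi>\<bar> \<le> (A * r) * B"
    unfolding abs_mult using assms w_bound[of \<xi>] by (intro mult_mono) (auto intro: order_trans[OF abs_ge_zero])
  then show ?thesis by (simp add: mult_ac)
qed

lemma conv_integrable:
  assumes [measurable]: "\<kappa> \<in> borel_measurable borel" and "\<And>y. \<bar>\<kappa> y\<bar> \<le> A * heat t y"
  shows "integrable lborel (\<lambda>\<xi>. \<kappa> (x - \<xi>) * w \<xi>)"
proof (rule Bochner_Integration.integrable_bound)
  show "integrable lborel (\<lambda>\<xi>. A * B * heat t (x - \<xi>))" by (intro integrable_mult_right heat_integrable)
  show "AE \<xi> in lborel. norm (\<kappa> (x - \<xi>) * w \<xi>) \<le> norm (A * B * heat t (x - \<xi>))"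
    using conv_le[OF assms(2)] by (intro AE_I2) (auto intro: order_trans[OF _ abs_ge_self])
qed measurable

lemma conv_bound:
  assumes "\<kappa> \<in> borel_measurable borel" and "\<And>y. \<bar>\<kappa> y\<bar> \<le> A * heat t y" and "t > 0"
  shows "\<bar>\<integral>\<xi>. \<kappa> (x - \<xi>) * w \<xi> \<partial>lborel\<bar> \<le> A * B"
proof -
  have "\<bar>\<integral>\<xi>. \<kappa> (x - \<xi>) * w \<xi> \<partial>lborel\<bar> \<le> (\<integral>\<xi>. \<bar>\<kappa> (x - \<xi>) * w \<xi>\<bar> \<partial>lborel)" by (rule integral_abs_bound)
  also have "\<dots> \<le> (\<integral>\<xi>. A * B * heat t (x - \<xi>) \<partial>lborel)"
    by (intro integral_mono integrable_abs conv_integrable[OF assms(1,2)] integrable_mult_right heat_integrable conv_le assms)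
  also have "\<dots> = A * B" using heat_integral[OF assms(3), of x] by simp
  finally show ?thesis .
qed

lemma conv_has_derivative:
  fixes D :: "'a \<Rightarrow> 'a \<Rightarrow> real"
  assumes t: "t > 0" and \<kappa>: "\<kappa> \<in> borel_measurable borel" "\<And>y. \<bar>\<kappa> y\<bar> \<le> A * heat t y"
    and D: "\<And>y. (\<kappa> has_derivative D y) (at y)" "\<And>y h. \<bar>D y h\<bar> \<le> norm h * A' * heat t y"
    and D_meas [measurable]: "\<And>h. (\<lambda>y. D y h) \<in> borel_measurable borel" and A': "A' \<ge> 0"
  shows "((\<lambda>x. \<integral>\<xi>. \<kappa> (x - \<xi>) * w \<xi> \<partial>lborel) has_derivative (\<lambda>h. \<integral>\<xi>. D (x - \<xi>) h * w \<xi> \<partial>lborel)) (at x)"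
proof (rule has_derivative_integral_parametric[where r = 1 and g = "\<lambda>\<xi>. A' * B * (sqrt 2 ^ DIM('a) * exp (1 / (4 * t))) * heat (2 * t) (x - \<xi>)"])
  fix \<xi> y assume "y \<in> ball x 1"
  have "((\<lambda>y. y - \<xi>) has_derivative (\<lambda>h. h)) (at y)"
    by (auto intro!: derivative_eq_intros)
  then have "((\<lambda>y. \<kappa> (y - \<xi>)) has_derivative D (y - \<xi>)) (at y)"
    using has_derivative_compose[of "\<lambda>y. y - \<xi>" "\<lambda>h. h" y UNIV \<kappa> "D (y - \<xi>)"] D(1)[of "y - \<xi>"]
    by simp
  then show "((\<lambda>y. \<kappa> (y - \<xi>) * w \<xi>) has_derivative (\<lambda>h. D (y - \<xi>) h * w \<xi>)) (at y)"
    by (rule has_derivative_mult_left)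
next
  fix \<xi> y h assume y: "y \<in> ball x 1"
  have "\<bar>D (y - \<xi>) h * w \<xi>\<bar> \<le> norm h * A' * B * heat t (y - \<xi>)"
    by (rule conv_le[OF D(2)])
  also have "\<dots> \<le> norm h * A' * B * (sqrt 2 ^ DIM('a) * exp (1\<^sup>2 / (4 * t)) * heat (2 * t) (x - \<xi>))"
    using y A' B_nonneg
    by (intro mult_left_mono heat_shift_le t mult_nonneg_nonneg) (auto simp: dist_norm norm_minus_commute)
  finally show "\<bar>D (y - \<xi>) h * w \<xi>\<bar> \<le> A' * B * (sqrt 2 ^ DIM('a) * exp (1 / (4 * t))) * heat (2 * t) (x - \<xi>) * norm h"
    by (simp add: mult_ac)
qed (auto intro!: conv_integrable[OF \<kappa>] integrable_mult_right heat_integrable)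

lemma conv_continuous:
  assumes t: "t > 0" and \<kappa>: "continuous_on UNIV \<kappa>" "\<And>y. \<bar>\<kappa> y\<bar> \<le> A * heat t y" and A: "A \<ge> 0"
  shows "continuous_on UNIV (\<lambda>x. \<integral>\<xi>. \<kappa> (x - \<xi>) * w \<xi> \<partial>lborel)"
  unfolding continuous_on_sequentially
proof (intro allI ballI impI)
  fix X x0 assume X: "(\<forall>n. X n \<in> (UNIV :: 'a set)) \<and> X \<longlonglongrightarrow> x0"
  have \<kappa>m [measurable]: "\<kappa> \<in> borel_measurable borel" using \<kappa>(1) by (rule borel_measurable_continuous_onI)
  have "bounded (range (\<lambda>n. X n - x0))"
    using X by (intro convergent_imp_bounded[of _ 0]) (auto simp: LIM_zero_iff)
  then obtain R where R: "\<And>n. norm (X n - x0) \<le> R" by (auto simp: bounded_iff)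
  show "((\<lambda>x. \<integral>\<xi>. \<kappa> (x - \<xi>) * w \<xi> \<partial>lborel) \<circ> X) \<longlonglongrightarrow> (\<integral>\<xi>. \<kappa> (x0 - \<xi>) * w \<xi> \<partial>lborel)"
    unfolding o_def
  proof (rule integral_dominated_convergence[where w = "\<lambda>\<xi>. A * B * (sqrt 2 ^ DIM('a) * exp (R\<^sup>2 / (4 * t)) * heat (2 * t) (x0 - \<xi>))"])
    show "integrable lborel (\<lambda>\<xi>. A * B * (sqrt 2 ^ DIM('a) * exp (R\<^sup>2 / (4 * t)) * heat (2 * t) (x0 - \<xi>)))"
      by (intro integrable_mult_right heat_integrable)
    show "AE \<xi> in lborel. (\<lambda>n. \<kappa> (X n - \<xi>) * w \<xi>) \<longlonglongrightarrow> \<kappa> (x0 - \<xi>) * w \<xi>"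
      using X by (intro AE_I2 tendsto_intros continuous_on_tendsto_compose[OF \<kappa>(1)]) auto
    show "AE \<xi> in lborel. norm (\<kappa> (X n - \<xi>) * w \<xi>) \<le> A * B * (sqrt 2 ^ DIM('a) * exp (R\<^sup>2 / (4 * t)) * heat (2 * t) (x0 - \<xi>))" for n
    proof (rule AE_I2)
      fix \<xi>
      have "norm (\<kappa> (X n - \<xi>) * w \<xi>) \<le> A * B * heat t (X n - \<xi>)" using conv_le[OF \<kappa>(2)] by simp
      also have "\<dots> \<le> A * B * (sqrt 2 ^ DIM('a) * exp (R\<^sup>2 / (4 * t)) * heat (2 * t) (x0 - \<xi>))"
        using A B_nonneg by (intro mult_left_mono heat_shift_le[OF t R]) auto
      finally show "norm (\<kappa> (X n - \<xi>) * w \<xi>) \<le> A * B * (sqrt 2 ^ DIM('a) * exp (R\<^sup>2 / (4 * t)) * heat (2 * t) (x0 - \<xi>))" .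
    qed
  qed measurable
qed

end

section \<open>Gaussian bounds for derivatives of the heat kernel\<close>

definition heat1 :: "'a::euclidean_space \<Rightarrow> real \<Rightarrow> 'a \<Rightarrow> real" where
  "heat1 h s y = - (y \<bullet> h) / (2 * s) * heat s y"

definition heat2 :: "'a::euclidean_space \<Rightarrow> 'a \<Rightarrow> real \<Rightarrow> 'a \<Rightarrow> real" where
  "heat2 h k s y = ((y \<bullet> h) * (y \<bullet> k) / (4 * s\<^sup>2) - (h \<bullet> k) / (2 * s)) * heat s y"

lemma heat1_measurable [measurable]: "(\<lambda>(s, y). heat1 h s y) \<in> borel_measurable (borel \<Otimes>\<^sub>M borel)"
  unfolding heat1_def by measurable
lemma heat2_measurable [measurable]: "(\<lambda>(s, y). heat2 h k s y) \<in> borel_measurable (borel \<Otimes>\<^sub>M borel)"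
  unfolding heat2_def by measurable

lemma heat_has_derivative: "(heat s has_derivative (\<lambda>h. heat1 h s y)) (at y)"
  unfolding heat1_def by (rule heat_deriv)

lemma heat1_has_derivative: "(heat1 h s has_derivative (\<lambda>k. heat2 h k s y)) (at y)"
proof (cases "s = 0")
  case True
  then have "heat1 h s = (\<lambda>y. 0)" "heat2 h k s y = 0" for k by (auto simp: heat1_def heat2_def fun_eq_iff)
  then show ?thesis by simp
next
  case False
  have "((\<lambda>y. - (y \<bullet> h) / (2 * s) * heat s y) has_derivative
     (\<lambda>k. - (y \<bullet> h) / (2 * s) * heat1 k s y + - (k \<bullet> h) / (2 * s) * heat s y)) (at y)"
    by (rule has_derivative_mult[OF _ heat_has_derivative]) (use False in \<open>auto intro!: derivative_eq_intros\<close>)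
  then show ?thesis
    unfolding heat1_def[abs_def] heat2_def
    by (rule has_derivative_eq_rhs) (auto simp: fun_eq_iff inner_commute power2_eq_square field_simps)
qed

lemma heat_le_double:
  fixes y :: "'a::euclidean_space"
  assumes s: "s > 0"
  shows "heat s y \<le> sqrt 2 ^ DIM('a) * heat (2 * s) y"
proof -
  have "exp (- (norm y)\<^sup>2 / (8 * s)) \<le> 1" using s by simp
  then show ?thesis unfolding heat_double[OF s] using heat_nonneg[of "2 * s" y]
    by (auto simp: mult.assoc intro!: mult_left_mono mult_left_le_one_le)
qed

text \<open>With z = |y|^2 / (4 s) the factor |y| / (2 s) is sqrt z / sqrt s, and sqrt z exp(- z /
  2) \<le> 1, where the exponential is what doubling the time releases. The same substitution gives
  order 1/s for the second derivative.\<close>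

lemma heat1_bound:
  fixes y :: "'a::euclidean_space"
  assumes s: "s > 0"
  shows "\<bar>heat1 h s y\<bar> \<le> norm h * (sqrt 2 ^ DIM('a) / sqrt s) * heat (2 * s) y"
proof -
  define z where "z = (norm y)\<^sup>2 / (4 * s)"
  have z: "z \<ge> 0" "(norm y)\<^sup>2 / (8 * s) = z / 2" using s by (auto simp: z_def)
  have sz: "norm y / (2 * s) = sqrt z / sqrt s"
    using s by (simp add: z_def real_sqrt_divide real_sqrt_mult real_div_sqrt field_simps)
  have "sqrt z \<le> 1 + z / 2"
    using sum_squares_ge_zero[of "sqrt z - 1" 0] z by (simp add: algebra_simps)
  also have "\<dots> \<le> exp (z / 2)" by (rule exp_ge_add_one_self)
  finally have e: "sqrt z * exp (- (z / 2)) \<le> 1" by (simp add: exp_minus field_simps)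
  have "\<bar>heat1 h s y\<bar> \<le> (norm y * norm h) / (2 * s) * heat s y"
    unfolding heat1_def using s Cauchy_Schwarz_ineq2[of y h] heat_nonneg[of s y]
    by (simp add: abs_mult mult_right_mono divide_right_mono)
  also have "\<dots> = norm h * (norm y / (2 * s)) * (sqrt 2 ^ DIM('a) * exp (- (z / 2)) * heat (2 * s) y)"
    using heat_double[OF s, of y] z by simp
  also have "\<dots> = (sqrt z * exp (- (z / 2))) * (norm h * (sqrt 2 ^ DIM('a) / sqrt s) * heat (2 * s) y)"
    unfolding sz by simp
  also have "\<dots> \<le> 1 * (norm h * (sqrt 2 ^ DIM('a) / sqrt s) * heat (2 * s) y)"
    using e s by (intro mult_right_mono) (auto simp: heat_nonneg)
  finally show ?thesis by simp
qed

lemma heat2_bound: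
  fixes y :: "'a::euclidean_space"
  assumes s: "s > 0"
  shows "\<bar>heat2 h k s y\<bar> \<le> norm k * (norm h * (2 * sqrt 2 ^ DIM('a) / s)) * heat (2 * s) y"
proof -
  define z where "z = (norm y)\<^sup>2 / (4 * s)"
  have z: "z \<ge> 0" "(norm y)\<^sup>2 / (8 * s) = z / 2" "(norm y)\<^sup>2 / (4 * s\<^sup>2) = z / s"
    using s by (auto simp: z_def power2_eq_square)
  have "z + 1 / 2 \<le> 2 * (1 + z / 2)" by simp
  also have "\<dots> \<le> 2 * exp (z / 2)" using exp_ge_add_one_self[of "z / 2"] by (intro mult_left_mono) auto
  finally have e: "(z + 1 / 2) * exp (- (z / 2)) \<le> 2" by (simp add: exp_minus field_simps)
  have "\<bar>(y \<bullet> h) * (y \<bullet> k)\<bar> \<le> (norm y * norm h) * (norm y * norm k)"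
    unfolding abs_mult by (intro mult_mono Cauchy_Schwarz_ineq2) auto
  then have "\<bar>(y \<bullet> h) * (y \<bullet> k) / (4 * s\<^sup>2)\<bar> \<le> norm h * norm k * ((norm y)\<^sup>2 / (4 * s\<^sup>2))"
    using s by (simp add: abs_divide divide_right_mono power2_eq_square mult_ac)
  moreover have "\<bar>(h \<bullet> k) / (2 * s)\<bar> \<le> norm h * norm k * (1 / 2 / s)"
    using s Cauchy_Schwarz_ineq2[of h k] by (simp add: divide_right_mono)
  ultimately have "\<bar>(y \<bullet> h) * (y \<bullet> k) / (4 * s\<^sup>2) - (h \<bullet> k) / (2 * s)\<bar> \<le> norm h * norm k * (z / s) + norm h * norm k * (1 / 2 / s)"
    unfolding z(3) by (intro order_trans[OF abs_triangle_ineq4]) auto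
  also have "\<dots> = norm h * norm k / s * (z + 1 / 2)" using s by (simp add: field_simps)
  finally have "\<bar>heat2 h k s y\<bar> \<le> norm h * norm k / s * (z + 1 / 2) * heat s y"
    unfolding heat2_def abs_mult[of _ "heat s y"] abs_of_nonneg[OF heat_nonneg] by (rule mult_right_mono[OF _ heat_nonneg])
  also have "\<dots> = ((z + 1 / 2) * exp (- (z / 2))) * (norm h * norm k / s * sqrt 2 ^ DIM('a) * heat (2 * s) y)"
    using heat_double[OF s, of y] z by simp
  also have "\<dots> \<le> 2 * (norm h * norm k / s * sqrt 2 ^ DIM('a) * heat (2 * s) y)"
    using e s by (intro mult_right_mono) (auto simp: heat_nonneg)
  finally show ?thesis by (simp add: mult_ac)
qed

text \<open>A second doubling of time, from 2 s to 4 s, converts the Hoelder weight |y|^g into the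
  gain s^(g/2). The constant 8 is 2, from 4^(g/2), times 4, from (1 + z) exp(- z / 4) \<le>
  4.\<close>

lemma heat_powr_bound:
  fixes y :: "'a::euclidean_space"
  assumes s: "s > 0" and g: "0 < g" "g \<le> 1"
  shows "norm y powr g * heat (2 * s) y \<le> 8 * sqrt 2 ^ DIM('a) * s powr (g / 2) * heat (4 * s) y"
proof -
  define z where "z = (norm y)\<^sup>2 / (4 * s)"
  have z: "z \<ge> 0" "(norm y)\<^sup>2 / (16 * s) = z / 4" "(norm y)\<^sup>2 = 4 * s * z" using s by (auto simp: z_def)
  have "norm y powr g = ((norm y)\<^sup>2) powr (g / 2)"
    by (simp add: powr_powr powr_realpow'[symmetric, of 2] del: powr_numeral flip: powr_numeral)
  also have "\<dots> = 4 powr (g / 2) * s powr (g / 2) * z powr (g / 2)"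
    unfolding z(3) using s z by (simp add: powr_mult)
  also have "\<dots> \<le> 2 * s powr (g / 2) * (1 + z)"
  proof (intro mult_mono)
    have "(4::real) powr (g / 2) \<le> 4 powr (1 / 2)" using g by (intro powr_mono) auto
    also have "\<dots> = 2" by (simp add: powr_half_sqrt)
    finally show "(4::real) powr (g / 2) \<le> 2" .
    show "z powr (g / 2) \<le> 1 + z"
    proof (cases "z \<le> 1")
      case True
      then have "z powr (g / 2) \<le> 1" using z g by (intro powr_le1) auto
      then show ?thesis using z by simp
    next
      case False
      then have "z powr (g / 2) \<le> z powr 1" using g by (intro powr_mono) auto
      then show ?thesis using False by simp
    qed
  qed auto
  finally have n: "norm y powr g \<le> 2 * s powr (g / 2) * (1 + z)" .
  have "1 + z \<le> 4 * (1 + z / 4)" by simp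
  also have "\<dots> \<le> 4 * exp (z / 4)" using exp_ge_add_one_self[of "z / 4"] by (intro mult_left_mono) auto
  finally have e: "(1 + z) * exp (- (z / 4)) \<le> 4" by (simp add: exp_minus field_simps)
  have "norm y powr g * heat (2 * s) y \<le> 2 * s powr (g / 2) * (1 + z) * heat (2 * s) y"
    by (intro mult_right_mono n heat_nonneg)
  also have "\<dots> = ((1 + z) * exp (- (z / 4))) * (2 * s powr (g / 2) * sqrt 2 ^ DIM('a) * heat (4 * s) y)"
    using heat_double[of "2 * s" y] s z by simp
  also have "\<dots> \<le> 4 * (2 * s powr (g / 2) * sqrt 2 ^ DIM('a) * heat (4 * s) y)"
    using e by (intro mult_right_mono) (auto simp: heat_nonneg)
  finally show ?thesis by (simp add: mult_ac)
qed

text \<open>The heat equation, obtained by writing the kernel as a constant times exp(- |y|^2 / (4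
  s)) s^(- n/2) and comparing with the trace of \<open>heat2\<close>.\<close>

lemma heat_time_deriv:
  fixes y :: "'a::euclidean_space"
  assumes s: "s > 0"
  shows "((\<lambda>s. heat s y) has_real_derivative (\<Sum>b\<in>Basis. heat2 b b s y)) (at s)"
proof -
  let ?n = "DIM('a)"
  define c where "c = sqrt (4 * pi) ^ ?n"
  have c: "c > 0" by (simp add: c_def)
  have sum: "(\<Sum>b\<in>Basis. heat2 b b s y) = ((norm y)\<^sup>2 / (4 * s\<^sup>2) - real ?n / (2 * s)) * heat s y"
  proof -
    have "(norm y)\<^sup>2 = (\<Sum>b\<in>Basis. (y \<bullet> b) * (y \<bullet> b))"
      by (simp only: power2_norm_eq_inner euclidean_inner[of y y])
    then show ?thesis
      by (simp add: heat2_def sum_distrib_right[symmetric] sum_subtractf sum_divide_distrib[symmetric] inner_Basis)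
  qed
  have "((\<lambda>s. exp (- (norm y)\<^sup>2 / 4 * inverse s) * s powr a / c) has_real_derivative
      ((norm y)\<^sup>2 / (4 * s\<^sup>2) + a / s) * (exp (- (norm y)\<^sup>2 / 4 * inverse s) * s powr a / c)) (at s)" for a
    using s c by (auto intro!: derivative_eq_intros simp: powr_diff field_simps power2_eq_square)
  from this[of "- real ?n / 2"] have "((\<lambda>s. exp (- (norm y)\<^sup>2 / 4 * inverse s) * s powr (- real ?n / 2) / c) has_real_derivative
      ((norm y)\<^sup>2 / (4 * s\<^sup>2) - real ?n / (2 * s)) * (exp (- (norm y)\<^sup>2 / 4 * inverse s) * s powr (- real ?n / 2) / c)) (at s)"
    by simp
  moreover have h: "heat r y = exp (- (norm y)\<^sup>2 / 4 * inverse r) * r powr (- real ?n / 2) / c" if "r > 0" for r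
  proof -
    have 1: "sqrt (4 * pi * r) ^ ?n = c * r powr (real ?n / 2)"
      using that by (simp add: c_def real_sqrt_mult power_mult_distrib powr_half_sqrt[symmetric] powr_powr powr_realpow[symmetric])
    have 2: "r powr (- real ?n / 2) = inverse (r powr (real ?n / 2))"
      by (simp flip: powr_minus)
    have 3: "- (norm y)\<^sup>2 / (4 * r) = - (norm y)\<^sup>2 / 4 * inverse r" by (simp add: field_simps)
    have "heat r y = exp (- (norm y)\<^sup>2 / (4 * r)) / sqrt (4 * pi * r) ^ ?n"
      using that by (simp add: heat_def)
    also have "\<dots> = exp (- (norm y)\<^sup>2 / 4 * inverse r) * inverse (r powr (real ?n / 2)) / c"
      unfolding 1 3 by (simp add: field_simps)
    finally show ?thesis unfolding 2 .
  qed
  have "((\<lambda>r. heat r y) has_real_derivative ((norm y)\<^sup>2 / (4 * s\<^sup>2) - real ?n / (2 * s)) * heat s y) (at s)"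
    unfolding h[OF s]
    by (rule DERIV_cong_ev[THEN iffD1, OF refl _ refl calculation])
      (use eventually_nhds_in_open[of "{0<..}" s] s h in \<open>auto elim!: eventually_mono\<close>)
  then show ?thesis by (simp add: sum)
qed

lemma heat_measurable_raw [measurable (raw)]:
  "f \<in> borel_measurable M \<Longrightarrow> g \<in> borel_measurable M \<Longrightarrow> (\<lambda>x. heat (f x) (g x)) \<in> borel_measurable M"
  using measurable_compose[OF measurable_Pair heat_measurable, of f M g] by simp

lemma heat1_measurable_raw [measurable (raw)]:
  "f \<in> borel_measurable M \<Longrightarrow> g \<in> borel_measurable M \<Longrightarrow> (\<lambda>x. heat1 h (f x) (g x)) \<in> borel_measurable M"
  using measurable_compose[OF measurable_Pair heat1_measurable, of f M g h] by simp

lemma heat2_measurable_raw [measurable (raw)]: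
  "f \<in> borel_measurable M \<Longrightarrow> g \<in> borel_measurable M \<Longrightarrow> (\<lambda>x. heat2 h k (f x) (g x)) \<in> borel_measurable M"
  using measurable_compose[OF measurable_Pair heat2_measurable, of f M g h k] by simp

lemma heat2_continuous: "continuous_on UNIV (heat2 h k s)"
proof -
  have "continuous_on UNIV (heat s :: 'a \<Rightarrow> real)"
    using heat_has_derivative has_derivative_continuous by (intro continuous_at_imp_continuous_on) blast
  then show ?thesis unfolding heat2_def[abs_def] divide_inverse by (intro continuous_intros)
qed

text \<open>One dominating kernel for all times r near s, as needed to differentiate the convolution
  in time.\<close>

lemma heat_time_le:
  fixes y :: "'a::euclidean_space"
  assumes s: "s > 0" and r: "s / 2 \<le> r" "r \<le> 3 / 2 * s"
  shows "heat (2 * r) y \<le> sqrt 3 ^ DIM('a) * heat (3 * s) y"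
proof -
  have r0: "r > 0" using assms by simp
  have "(norm y)\<^sup>2 / (12 * s) \<le> (norm y)\<^sup>2 / (8 * r)"
    using r r0 by (intro divide_left_mono) auto
  then have e: "exp (- (norm y)\<^sup>2 / (4 * (2 * r))) \<le> exp (- (norm y)\<^sup>2 / (4 * (3 * s)))" by simp
  have "sqrt (4 * pi * s) \<le> sqrt (4 * pi * (2 * r))" using r by simp
  then have "sqrt (4 * pi * s) ^ DIM('a) \<le> sqrt (4 * pi * (2 * r)) ^ DIM('a)" using s by (intro power_mono) auto
  then have "heat (2 * r) y \<le> exp (- (norm y)\<^sup>2 / (4 * (3 * s))) / sqrt (4 * pi * s) ^ DIM('a)"
    using e r0 s by (simp add: heat_def frac_le)
  also have "\<dots> = sqrt 3 ^ DIM('a) * heat (3 * s) y"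
  proof -
    have "sqrt (4 * pi * (3 * s)) = sqrt 3 * sqrt (4 * pi * s)"
      by (simp add: real_sqrt_mult[symmetric] mult_ac)
    then show ?thesis using s by (simp add: heat_def power_mult_distrib)
  qed
  finally show ?thesis .
qed

context bounded_datum
begin

text \<open>The heat semigroup, extended by the datum itself to s \<le> 0. This makes s -> P s x
  continuous at 0 for Hoelder data, and integration over the point mass \<open>nu 0\<close> returns
  the datum.\<close>

definition P where "P s x = (if s > 0 then (\<integral>\<xi>. heat s (x - \<xi>) * w \<xi> \<partial>lborel) else w x)"
definition P1 where "P1 h s x = (\<integral>\<xi>. heat1 h s (x - \<xi>) * w \<xi> \<partial>lborel)"
definition P2 where "P2 h k s x = (\<integral>\<xi>. heat2 h k s (x - \<xi>) * w \<xi> \<partial>lborel)"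

lemma P_measurable [measurable]: "(\<lambda>s. P s x) \<in> borel_measurable borel"
  and P1_measurable [measurable]: "(\<lambda>s. P1 h s x) \<in> borel_measurable borel"
  and P2_measurable [measurable]: "(\<lambda>s. P2 h k s x) \<in> borel_measurable borel"
  unfolding P_def P1_def P2_def by measurable

lemma P_has_derivative:
  assumes s: "s > 0"
  shows "(P s has_derivative (\<lambda>h. P1 h s x)) (at x)"
proof -
  have "((\<lambda>x. \<integral>\<xi>. heat s (x - \<xi>) * w \<xi> \<partial>lborel) has_derivative (\<lambda>h. \<integral>\<xi>. heat1 h s (x - \<xi>) * w \<xi> \<partial>lborel)) (at x)"
  proof (rule conv_has_derivative[where t = "2 * s" and A = "sqrt 2 ^ DIM('a)" and A' = "sqrt 2 ^ DIM('a) / sqrt s"])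
    show "\<bar>heat s y\<bar> \<le> sqrt 2 ^ DIM('a) * heat (2 * s) y" for y :: 'a
      using heat_le_double[OF s] heat_nonneg[of s y] by simp
  qed (use s heat_has_derivative heat1_bound in auto)
  moreover have "P s = (\<lambda>x. \<integral>\<xi>. heat s (x - \<xi>) * w \<xi> \<partial>lborel)" using s by (auto simp: P_def)
  ultimately show ?thesis by (simp add: P1_def)
qed

lemma P1_has_derivative:
  assumes s: "s > 0"
  shows "(P1 h s has_derivative (\<lambda>k. P2 h k s x)) (at x)"
  unfolding P1_def[abs_def] P2_def
  by (rule conv_has_derivative[where t = "2 * s" and A = "norm h * (sqrt 2 ^ DIM('a) / sqrt s)" and A' = "norm h * (2 * sqrt 2 ^ DIM('a) / s)"])
    (use s heat1_has_derivative heat1_bound heat2_bound in auto)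

lemma P2_continuous: assumes s: "s > 0" shows "continuous_on UNIV (P2 h k s)"
  unfolding P2_def[abs_def]
  by (rule conv_continuous[where t = "2 * s" and A = "norm k * (norm h * (2 * sqrt 2 ^ DIM('a) / s))"])
    (use s heat2_continuous heat2_bound in auto)

lemma P_bound: "\<bar>P s x\<bar> \<le> B"
proof (cases "s > 0")
  case True
  then show ?thesis
    using conv_bound[of "heat s" 1 s x] by (simp add: P_def heat_nonneg)
qed (simp add: P_def w_bound)

lemma P1_bound: "s > 0 \<Longrightarrow> \<bar>P1 h s x\<bar> \<le> norm h * (sqrt 2 ^ DIM('a) / sqrt s) * B"
  unfolding P1_def by (rule conv_bound[where t = "2 * s"]) (use heat1_bound in auto)

lemma P_time_derivative:
  assumes s: "s > 0"
  shows "((\<lambda>s. P s x) has_real_derivative (\<Sum>b\<in>Basis. P2 b b s x)) (at s)"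
proof -
  let ?c = "sqrt 2 ^ DIM('a)" and ?d = "sqrt 3 ^ DIM('a)"
  have int2: "integrable lborel (\<lambda>\<xi>. heat2 b b s (x - \<xi>) * w \<xi>)" for b
    by (rule conv_integrable[OF _ heat2_bound[OF s]]) simp
  have "((\<lambda>s. \<integral>\<xi>. heat s (x - \<xi>) * w \<xi> \<partial>lborel) has_derivative
      (\<lambda>h. \<integral>\<xi>. h * (\<Sum>b\<in>Basis. heat2 b b s (x - \<xi>)) * w \<xi> \<partial>lborel)) (at s)"
  proof (rule has_derivative_integral_parametric[where r = "s / 2" and
      g = "\<lambda>\<xi>. real DIM('a) * (4 * ?c / s) * ?d * heat (3 * s) (x - \<xi>) * B"])
    fix \<xi> r assume "r \<in> ball s (s / 2)"
    then have "\<bar>s - r\<bar> < s / 2" by (simp add: dist_real_def)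
    then have r: "r > 0" "s / 2 \<le> r" "r \<le> 3 / 2 * s" using s by linarith+
    have "((\<lambda>r. heat r (x - \<xi>)) has_derivative (\<lambda>h. h * (\<Sum>b\<in>Basis. heat2 b b r (x - \<xi>)))) (at r)"
      using heat_time_deriv[OF r(1), of "x - \<xi>"] by (simp add: has_field_derivative_def mult.commute[of _ "sum _ _"])
    then show "((\<lambda>r. heat r (x - \<xi>) * w \<xi>) has_derivative (\<lambda>h. h * (\<Sum>b\<in>Basis. heat2 b b r (x - \<xi>)) * w \<xi>)) (at r)"
      by (rule has_derivative_mult_left)
    fix h
    have "\<bar>\<Sum>b\<in>Basis. heat2 b b r (x - \<xi>)\<bar> \<le> (\<Sum>b\<in>(Basis::'a set). \<bar>heat2 b b r (x - \<xi>)\<bar>)" by (rule sum_abs)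
    also have "\<dots> \<le> (\<Sum>b\<in>(Basis::'a set). (4 * ?c / s) * (?d * heat (3 * s) (x - \<xi>)))"
    proof (rule sum_mono)
      fix b :: 'a assume b: "b \<in> Basis"
      have "\<bar>heat2 b b r (x - \<xi>)\<bar> \<le> 2 * ?c / r * heat (2 * r) (x - \<xi>)"
        using heat2_bound[OF r(1), of b b "x - \<xi>"] b by simp
      also have "\<dots> \<le> (4 * ?c / s) * (?d * heat (3 * s) (x - \<xi>))"
      proof (rule mult_mono)
        have "2 * ?c / r \<le> 2 * ?c / (s / 2)" using r s by (intro divide_left_mono) auto
        then show "2 * ?c / r \<le> 4 * ?c / s" by simp
      qed (use heat_time_le[OF s r(2,3)] s heat_nonneg in auto)
      finally show "\<bar>heat2 b b r (x - \<xi>)\<bar> \<le> (4 * ?c / s) * (?d * heat (3 * s) (x - \<xi>))" .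
    qed
    finally have "\<bar>\<Sum>b\<in>Basis. heat2 b b r (x - \<xi>)\<bar> \<le> real DIM('a) * ((4 * ?c / s) * (?d * heat (3 * s) (x - \<xi>)))"
      by simp
    then have "\<bar>\<Sum>b\<in>Basis. heat2 b b r (x - \<xi>)\<bar> * \<bar>w \<xi>\<bar> \<le> real DIM('a) * ((4 * ?c / s) * (?d * heat (3 * s) (x - \<xi>))) * B"
      using w_bound[of \<xi>] by (intro mult_mono) (auto intro: order_trans[OF abs_ge_zero])
    then have "\<bar>h\<bar> * (\<bar>\<Sum>b\<in>Basis. heat2 b b r (x - \<xi>)\<bar> * \<bar>w \<xi>\<bar>) \<le> \<bar>h\<bar> * (real DIM('a) * ((4 * ?c / s) * (?d * heat (3 * s) (x - \<xi>))) * B)"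
      by (intro mult_left_mono) auto
    then show "\<bar>h * (\<Sum>b\<in>Basis. heat2 b b r (x - \<xi>)) * w \<xi>\<bar> \<le> real DIM('a) * (4 * ?c / s) * ?d * heat (3 * s) (x - \<xi>) * B * norm h"
      unfolding abs_mult real_norm_def by (simp only: mult_ac)
  next
    fix r assume "r \<in> ball s (s / 2)"
    show "integrable lborel (\<lambda>\<xi>. heat r (x - \<xi>) * w \<xi>)"
      by (rule conv_integrable[where t = r and A = 1]) (auto simp: heat_nonneg)
  next
    show "integrable lborel (\<lambda>\<xi>. real DIM('a) * (4 * ?c / s) * ?d * heat (3 * s) (x - \<xi>) * B)"
      by (intro integrable_mult_left integrable_mult_right heat_integrable)
  qed (use s in auto)
  moreover have "(\<integral>\<xi>. h * (\<Sum>b\<in>Basis. heat2 b b s (x - \<xi>)) * w \<xi> \<partial>lborel) = (\<Sum>b\<in>Basis. P2 b b s x) * h" for h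
  proof -
    have "(\<integral>\<xi>. h * (\<Sum>b\<in>Basis. heat2 b b s (x - \<xi>)) * w \<xi> \<partial>lborel) = (\<integral>\<xi>. h * (\<Sum>b\<in>Basis. heat2 b b s (x - \<xi>) * w \<xi>) \<partial>lborel)"
      by (simp add: sum_distrib_right mult.assoc)
    also have "\<dots> = h * (\<Sum>b\<in>Basis. P2 b b s x)"
      unfolding P2_def using int2 by (subst integral_mult_right_zero, subst Bochner_Integration.integral_sum) auto
    finally show ?thesis by (simp add: mult.commute)
  qed
  ultimately have "((\<lambda>s. \<integral>\<xi>. heat s (x - \<xi>) * w \<xi> \<partial>lborel) has_real_derivative (\<Sum>b\<in>Basis. P2 b b s x)) (at s)"
    by (simp add: has_field_derivative_def)
  then show ?thesis
    by (rule has_field_derivative_transform_within_open[of _ _ _ "{0<..}"]) (use s in \<open>auto simp: P_def\<close>)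
qed

end

section \<open>Cancellation for Hoelder data\<close>

text \<open>For the constant datum 1 the semigroup is constant in x, so its second derivatives
  vanish. This cancellation is the point at which Hoelder regularity can enter.\<close>

lemma heat2_integral_zero:
  fixes x :: "'a::euclidean_space"
  assumes s: "s > 0" shows "(\<integral>\<xi>. heat2 h k s (x - \<xi>) \<partial>lborel) = 0"
proof -
  interpret one: bounded_datum "\<lambda>x::'a. 1" 1 by unfold_locales auto
  have "one.P s = (\<lambda>x. 1)" using s by (simp add: one.P_def fun_eq_iff heat_integral)
  then have "((\<lambda>x::'a. 1::real) has_derivative (\<lambda>h. one.P1 h s x)) (at x)" for x
    using one.P_has_derivative[OF s, of x] by simp
  from has_derivative_unique[OF this has_derivative_const] have "one.P1 h s = (\<lambda>x. 0)"
    by (auto simp: fun_eq_iff)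
  then have "((\<lambda>x::'a. 0::real) has_derivative (\<lambda>k. one.P2 h k s x)) (at x)"
    using one.P1_has_derivative[OF s, of h x] by simp
  from has_derivative_unique[OF this has_derivative_const] show ?thesis
    by (auto simp: fun_eq_iff one.P2_def)
qed

locale hoelder_datum =
  fixes w :: "'a::euclidean_space \<Rightarrow> real" and B C \<gamma> :: real
  assumes w_bounded: "\<And>x. \<bar>w x\<bar> \<le> B"
    and gamma: "0 < \<gamma>" "\<gamma> \<le> 1"
    and hoelder: "\<And>x y. \<bar>w x - w y\<bar> \<le> C * norm (x - y) powr \<gamma>"
    and C_nonneg: "C \<ge> 0"
begin

lemma w_continuous: "continuous_on UNIV w"
proof (rule continuous_at_imp_continuous_on, intro ballI)
  fix x :: 'a
  have "((\<lambda>y. w y - w x) \<longlongrightarrow> 0) (at x)"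
  proof (rule Lim_null_comparison)
    show "eventually (\<lambda>y. norm (w y - w x) \<le> C * norm (y - x) powr \<gamma>) (at x)"
      using hoelder by (intro always_eventually) auto
    have "((\<lambda>y. norm (y - x)) \<longlongrightarrow> 0) (at x)" by (auto intro!: tendsto_eq_intros)
    then have "((\<lambda>y. norm (y - x) powr \<gamma>) \<longlongrightarrow> 0) (at x)"
      by (rule tendsto_zero_powrI[OF _ tendsto_const _ gamma(1)]) simp
    then show "((\<lambda>y. C * norm (y - x) powr \<gamma>) \<longlongrightarrow> 0) (at x)" by (rule tendsto_mult_right_zero)
  qed
  then show "isCont w x" by (simp add: isCont_def LIM_zero_iff)
qed

sublocale bounded_datum w B
  by unfold_locales (auto intro: borel_measurable_continuous_onI w_continuous w_bounded)

lemma conv_hoelder_bound: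
  assumes s: "s > 0" and [measurable]: "\<kappa> \<in> borel_measurable borel"
    and \<kappa>: "\<And>y. \<bar>\<kappa> y\<bar> \<le> A * heat (2 * s) y" and A: "A \<ge> 0"
  shows "\<bar>\<integral>\<xi>. \<kappa> (x - \<xi>) * (w \<xi> - w x) \<partial>lborel\<bar> \<le> A * (8 * (sqrt 2 ^ DIM('a)) * C) * s powr (\<gamma> / 2)"
proof -
  have 1: "\<bar>\<kappa> (x - \<xi>) * (w \<xi> - w x)\<bar> \<le> A * (8 * (sqrt 2 ^ DIM('a)) * C) * s powr (\<gamma> / 2) * heat (4 * s) (x - \<xi>)" for \<xi>
  proof -
    have "\<bar>\<kappa> (x - \<xi>) * (w \<xi> - w x)\<bar> \<le> (A * heat (2 * s) (x - \<xi>)) * (C * norm (x - \<xi>) powr \<gamma>)"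
      unfolding abs_mult using \<kappa> hoelder[of \<xi> x] A
      by (intro mult_mono) (auto simp: norm_minus_commute heat_nonneg)
    also have "\<dots> = (A * C) * (norm (x - \<xi>) powr \<gamma> * heat (2 * s) (x - \<xi>))" by simp
    also have "\<dots> \<le> (A * C) * (8 * (sqrt 2 ^ DIM('a)) * s powr (\<gamma> / 2) * heat (4 * s) (x - \<xi>))"
      using heat_powr_bound[OF s gamma] A C_nonneg by (intro mult_left_mono) auto
    finally show ?thesis by (simp add: mult_ac)
  qed
  have int: "integrable lborel (\<lambda>\<xi>. A * (8 * (sqrt 2 ^ DIM('a)) * C) * s powr (\<gamma> / 2) * heat (4 * s) (x - \<xi>))"
    by (intro integrable_mult_right heat_integrable)
  have int': "integrable lborel (\<lambda>\<xi>. \<kappa> (x - \<xi>) * (w \<xi> - w x))"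
    by (rule Bochner_Integration.integrable_bound[OF int])
      (use 1 in \<open>auto intro!: AE_I2 intro: order_trans[OF _ abs_ge_self]\<close>)
  have "\<bar>\<integral>\<xi>. \<kappa> (x - \<xi>) * (w \<xi> - w x) \<partial>lborel\<bar> \<le> (\<integral>\<xi>. \<bar>\<kappa> (x - \<xi>) * (w \<xi> - w x)\<bar> \<partial>lborel)" by (rule integral_abs_bound)
  also have "\<dots> \<le> (\<integral>\<xi>. A * (8 * (sqrt 2 ^ DIM('a)) * C) * s powr (\<gamma> / 2) * heat (4 * s) (x - \<xi>) \<partial>lborel)"
    by (intro integral_mono integrable_abs int int' 1)
  also have "\<dots> = A * (8 * (sqrt 2 ^ DIM('a)) * C) * s powr (\<gamma> / 2)" using heat_integral[of "4 * s" x] s by simp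
  finally show ?thesis .
qed

text \<open>By \<open>heat2_integral_zero\<close> the datum may be replaced by its difference from w
  x, which gains s^(gamma/2) over the order 1/s of the kernel. The exponent gamma/2 - 1 is
  integrable at 0, whereas 1/s would not be.\<close>

lemma P2_bound_explicit:
  assumes s: "s > 0"
  shows "\<bar>P2 h k s x\<bar> \<le> norm h * norm k * (2 * (sqrt 2 ^ DIM('a)) * (8 * (sqrt 2 ^ DIM('a)) * C)) * s powr (\<gamma> / 2 - 1)"
proof -
  have int: "integrable lborel (\<lambda>\<xi>. heat2 h k s (x - \<xi>) * w \<xi>)"
    by (rule conv_integrable[OF _ heat2_bound[OF s]]) simp
  interpret one: bounded_datum "\<lambda>x::'a. 1" 1 by unfold_locales auto
  have int1: "integrable lborel (\<lambda>\<xi>. heat2 h k s (x - \<xi>))"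
    using one.conv_integrable[OF _ heat2_bound[OF s], of h k x] by simp
  have "P2 h k s x = (\<integral>\<xi>. heat2 h k s (x - \<xi>) * w \<xi> \<partial>lborel) - (\<integral>\<xi>. heat2 h k s (x - \<xi>) * w x \<partial>lborel)"
    unfolding P2_def using heat2_integral_zero[OF s, of h k x] by simp
  also have "\<dots> = (\<integral>\<xi>. heat2 h k s (x - \<xi>) * (w \<xi> - w x) \<partial>lborel)"
    using int int1 by (subst Bochner_Integration.integral_diff[symmetric]) (auto simp: right_diff_distrib)
  finally have "\<bar>P2 h k s x\<bar> \<le> (norm k * (norm h * (2 * (sqrt 2 ^ DIM('a)) / s))) * (8 * (sqrt 2 ^ DIM('a)) * C) * s powr (\<gamma> / 2)"
    using conv_hoelder_bound[OF s _ heat2_bound[OF s], of h k x] s by simp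
  also have "\<dots> = norm h * norm k * (2 * (sqrt 2 ^ DIM('a)) * (8 * (sqrt 2 ^ DIM('a)) * C)) * s powr (\<gamma> / 2 - 1)"
    using s by (simp add: powr_diff)
  finally show ?thesis .
qed

lemma P2_bound: "\<exists>Q\<ge>0. \<forall>h k s x. s > 0 \<longrightarrow> \<bar>P2 h k s x\<bar> \<le> norm h * norm k * Q * s powr (\<gamma> / 2 - 1)"
  using P2_bound_explicit C_nonneg by (intro exI[of _ "2 * (sqrt 2 ^ DIM('a)) * (8 * (sqrt 2 ^ DIM('a)) * C)"]) auto

lemma P_minus_w:
  assumes s: "s > 0"
  shows "\<bar>P s x - w x\<bar> \<le> (sqrt 2 ^ DIM('a)) * (8 * (sqrt 2 ^ DIM('a)) * C) * s powr (\<gamma> / 2)"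
proof -
  have "integrable lborel (\<lambda>\<xi>. heat s (x - \<xi>) * w \<xi>)"
    by (rule conv_integrable[where t = s and A = 1]) (auto simp: heat_nonneg)
  moreover have "P s x - w x = (\<integral>\<xi>. heat s (x - \<xi>) * w \<xi> \<partial>lborel) - (\<integral>\<xi>. heat s (x - \<xi>) * w x \<partial>lborel)"
    unfolding P_def using heat_integral[OF s, of x] s by simp
  ultimately have "P s x - w x = (\<integral>\<xi>. heat s (x - \<xi>) * (w \<xi> - w x) \<partial>lborel)"
    using heat_integrable[of s x] by (subst (asm) Bochner_Integration.integral_diff[symmetric]) (auto simp: right_diff_distrib)
  then show ?thesis
    using conv_hoelder_bound[OF s, of "heat s" "sqrt 2 ^ DIM('a)" x] by (simp add: heat_nonneg heat_le_double[OF s])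
qed

text \<open>Integrating |dP/ds| \<le> n Q s^(gamma/2 - 1) gives an increment of s^(gamma/2) with a
  constant independent of x. The integration is carried out as monotonicity of the power function
  plus or minus P.\<close>

lemma P_time_modulus: "\<exists>H\<ge>0. \<forall>x. \<forall>r\<ge>0. \<forall>s\<ge>0. \<bar>P s x - P r x\<bar> \<le> H * \<bar>s powr (\<gamma> / 2) - r powr (\<gamma> / 2)\<bar>"
proof -
  obtain Q where Q: "Q \<ge> 0" "\<And>h k s x. s > 0 \<Longrightarrow> \<bar>P2 h k s x\<bar> \<le> norm h * norm k * Q * s powr (\<gamma> / 2 - 1)"
    using P2_bound by blast
  define H where "H = max ((sqrt 2 ^ DIM('a)) * (8 * (sqrt 2 ^ DIM('a)) * C)) (2 / \<gamma> * (real DIM('a) * Q))"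
  have H: "H \<ge> 0" using C_nonneg by (simp add: H_def le_max_iff_disj)
  have aux: "\<bar>P s x - P r x\<bar> \<le> H * (s powr (\<gamma> / 2) - r powr (\<gamma> / 2))" if r: "0 < r" "r \<le> s" for r s x
  proof -
    let ?d = "\<lambda>u. real DIM('a) * Q * u powr (\<gamma> / 2 - 1)"
    let ?g = "\<lambda>u. (2 / \<gamma> * (real DIM('a) * Q)) * u powr (\<gamma> / 2)"
    have der: "(?g has_real_derivative ?d u) (at u)" if "u > 0" for u
      using that gamma by (auto intro!: derivative_eq_intros)
    have L: "\<bar>\<Sum>b\<in>Basis. P2 b b u x\<bar> \<le> ?d u" if "u > 0" for u
    proof -
      have "\<bar>\<Sum>b\<in>Basis. P2 b b u x\<bar> \<le> (\<Sum>b\<in>(Basis::'a set). \<bar>P2 b b u x\<bar>)" by (rule sum_abs)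
      also have "\<dots> \<le> (\<Sum>b\<in>(Basis::'a set). Q * u powr (\<gamma> / 2 - 1))"
        using Q(2)[OF that] by (intro sum_mono) (metis mult_1 norm_Basis)
      finally show ?thesis by simp
    qed
    have "?g r - P r x \<le> ?g s - P s x"
    proof (rule DERIV_nonneg_imp_nondecreasing[OF r(2)])
      fix u assume "r \<le> u" "u \<le> s"
      then have u: "u > 0" using r by simp
      have "((\<lambda>u. ?g u - P u x) has_real_derivative (?d u - (\<Sum>b\<in>Basis. P2 b b u x))) (at u)"
        by (rule DERIV_diff[OF der[OF u] P_time_derivative[OF u]])
      then show "\<exists>y. ((\<lambda>u. ?g u - P u x) has_real_derivative y) (at u) \<and> 0 \<le> y"
        using L[OF u] by (intro exI conjI) (assumption, simp)
    qed
    moreover have "?g r + P r x \<le> ?g s + P s x"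
    proof (rule DERIV_nonneg_imp_nondecreasing[OF r(2)])
      fix u assume "r \<le> u" "u \<le> s"
      then have u: "u > 0" using r by simp
      have "((\<lambda>u. ?g u + P u x) has_real_derivative (?d u + (\<Sum>b\<in>Basis. P2 b b u x))) (at u)"
        by (rule DERIV_add[OF der[OF u] P_time_derivative[OF u]])
      then show "\<exists>y. ((\<lambda>u. ?g u + P u x) has_real_derivative y) (at u) \<and> 0 \<le> y"
        using L[OF u] by (intro exI conjI) (assumption, simp)
    qed
    ultimately have "\<bar>P s x - P r x\<bar> \<le> ?g s - ?g r" by linarith
    also have "\<dots> = (2 / \<gamma> * (real DIM('a) * Q)) * (s powr (\<gamma> / 2) - r powr (\<gamma> / 2))"
      by (simp only: right_diff_distrib)
    also have "\<dots> \<le> H * (s powr (\<gamma> / 2) - r powr (\<gamma> / 2))"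
      using r gamma by (intro mult_right_mono) (auto simp: H_def powr_mono2)
    finally show ?thesis .
  qed
  have *: "\<bar>P s x - P r x\<bar> \<le> H * \<bar>s powr (\<gamma> / 2) - r powr (\<gamma> / 2)\<bar>" if "0 \<le> r" "r \<le> s" for r s x
  proof -
    consider "r > 0" | "r = 0" "s = 0" | "r = 0" "s > 0" using \<open>0 \<le> r\<close> \<open>r \<le> s\<close> by linarith
    then show ?thesis
    proof cases
      case 1
      then show ?thesis using aux[OF 1 \<open>r \<le> s\<close>, of x] H
        by (smt (verit) mult_left_mono abs_ge_self)
    next
      case 3
      have "\<bar>P s x - w x\<bar> \<le> (sqrt 2 ^ DIM('a)) * (8 * (sqrt 2 ^ DIM('a)) * C) * s powr (\<gamma> / 2)" by (rule P_minus_w[OF 3(2)])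
      also have "\<dots> \<le> H * s powr (\<gamma> / 2)" by (intro mult_right_mono) (auto simp: H_def)
      finally show ?thesis using 3 by (simp add: P_def[of 0])
    qed simp
  qed
  have "\<bar>P s x - P r x\<bar> \<le> H * \<bar>s powr (\<gamma> / 2) - r powr (\<gamma> / 2)\<bar>" if "0 \<le> r" "0 \<le> s" for r s x
    using *[of r s x] *[of s r x] that by (cases "r \<le> s") (auto simp: abs_minus_commute)
  then show ?thesis using H by blast
qed

end

section \<open>The resolvent on Hoelder data\<close>

abbreviation damped :: "real \<Rightarrow> real \<Rightarrow> real \<Rightarrow> real" where
  "damped q s y \<equiv> indicator {0<..} s *\<^sub>R (exp (- q * s) * y)"

lemma integrable_powr_exp:
  fixes a q :: real
  assumes a: "a > 0" and q: "q > 0"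
  shows "integrable lborel (\<lambda>s. damped q s (s powr (a - 1)))"
proof -
  have G: "integrable lborel (\<lambda>s. indicator {0..} s * s powr (a - 1) / exp s)"
  proof (rule integrableI_nonneg)
    show "(\<integral>\<^sup>+s. ennreal (indicator {0..} s * s powr (a - 1) / exp s) \<partial>lborel) < \<infinity>"
      using Gamma_conv_nn_integral_real[OF a] by (metis ennreal_less_top infinity_ennreal_def)
  qed auto
  define m where "m = min q 1"
  have m: "0 < m" "m \<le> q" "m \<le> 1" using q by (auto simp: m_def)
  have "integrable lborel (\<lambda>s. indicator {0..} (0 + m * s) * (0 + m * s) powr (a - 1) / exp (0 + m * s))"
    using m by (intro lborel_integrable_real_affine[OF G]) auto
  then have "integrable lborel (\<lambda>s. inverse (m powr (a - 1)) * (indicator {0..} (m * s) * (m * s) powr (a - 1) / exp (m * s)))"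
    by (intro integrable_mult_right) simp
  then show ?thesis
  proof (rule Bochner_Integration.integrable_bound)
    show "AE s in lborel. norm (damped q s (s powr (a - 1)))
       \<le> norm (inverse (m powr (a - 1)) * (indicator {0..} (m * s) * (m * s) powr (a - 1) / exp (m * s)))"
    proof (rule AE_I2)
      fix s :: real
      show "norm (damped q s (s powr (a - 1)))
       \<le> norm (inverse (m powr (a - 1)) * (indicator {0..} (m * s) * (m * s) powr (a - 1) / exp (m * s)))"
      proof (cases "s > 0")
        case True
        then have "exp (- q * s) \<le> exp (- m * s)" using m by (simp add: mult_right_mono)
        then have "exp (- q * s) * s powr (a - 1) \<le> exp (- m * s) * s powr (a - 1)" by (intro mult_right_mono) auto
        then show ?thesis using True m by (simp add: powr_mult exp_minus field_simps)
      qed simp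
    qed
  qed simp
qed

context hoelder_datum
begin

definition V where "V q x = (LINT s:{0<..}|lborel. exp (- q * s) * P s x)"
definition V1 where "V1 q h x = (LINT s:{0<..}|lborel. exp (- q * s) * P1 h s x)"
definition V2 where "V2 q h k x = (LINT s:{0<..}|lborel. exp (- q * s) * P2 h k s x)"

lemma P_integrable: assumes q: "q > 0" shows "integrable lborel (\<lambda>s. damped q s (P s x))"
proof (rule Bochner_Integration.integrable_bound)
  show "integrable lborel (\<lambda>s. (damped q s (s powr (1 - 1))) * B)"
    by (intro integrable_mult_left integrable_powr_exp q) simp
  show "AE s in lborel. norm (damped q s (P s x)) \<le> norm ((damped q s (s powr (1 - 1))) * B)"
    using P_bound B_nonneg by (intro AE_I2) (auto simp: abs_mult split: split_indicator)
qed measurable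

text \<open>The singularity is s^(- 1/2), integrable at 0, written as a power to match
  \<open>integrable_powr_exp\<close>.\<close>

lemma P1_le: "s > 0 \<Longrightarrow> \<bar>exp (- q * s) * P1 h s x\<bar> \<le> (exp (- q * s) * s powr (1 / 2 - 1)) * (sqrt 2 ^ DIM('a) * B) * norm h"
proof -
  assume s: "s > 0"
  have "1 / sqrt s = s powr (1 / 2 - 1)" using s by (simp add: powr_half_sqrt[symmetric] powr_minus_divide)
  moreover have "\<bar>exp (- q * s) * P1 h s x\<bar> \<le> exp (- q * s) * (norm h * (sqrt 2 ^ DIM('a) / sqrt s) * B)"
    unfolding abs_mult abs_exp_cancel by (intro mult_left_mono P1_bound s) simp
  moreover have "exp (- q * s) * (norm h * (sqrt 2 ^ DIM('a) / sqrt s) * B) = (exp (- q * s) * (1 / sqrt s)) * (sqrt 2 ^ DIM('a) * B) * norm h"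
    by simp
  ultimately show ?thesis by simp
qed

lemma P1_integrable: assumes q: "q > 0" shows "integrable lborel (\<lambda>s. damped q s (P1 h s x))"
proof (rule Bochner_Integration.integrable_bound)
  show "integrable lborel (\<lambda>s. (damped q s (s powr (1 / 2 - 1))) * ((sqrt 2 ^ DIM('a) * B) * norm h))"
    by (intro integrable_mult_left integrable_powr_exp q) simp
  show "AE s in lborel. norm (damped q s (P1 h s x)) \<le> norm ((damped q s (s powr (1 / 2 - 1))) * ((sqrt 2 ^ DIM('a) * B) * norm h))"
  proof (rule AE_I2)
    fix s
    show "norm (damped q s (P1 h s x)) \<le> norm ((damped q s (s powr (1 / 2 - 1))) * ((sqrt 2 ^ DIM('a) * B) * norm h))"
      using P1_le[of s q h x] by (cases "s > 0") (simp_all add: mult.assoc order_trans[OF _ abs_ge_self])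
  qed
qed measurable

lemma V_has_derivative:
  assumes q: "q > 0"
  shows "(V q has_derivative (\<lambda>h. V1 q h x)) (at x)"
  unfolding V_def[abs_def] V1_def set_lebesgue_integral_def
proof (rule has_derivative_integral_parametric[where r = 1 and g = "\<lambda>s. (damped q s (s powr (1 / 2 - 1))) * (sqrt 2 ^ DIM('a) * B)"])
  show "((\<lambda>x. damped q s (P s x)) has_derivative (\<lambda>h. damped q s (P1 h s y))) (at y)" for s y
    by (cases "s > 0") (auto intro!: has_derivative_mult_right P_has_derivative)
  show "\<bar>damped q s (P1 h s y)\<bar>
     \<le> (damped q s (s powr (1 / 2 - 1))) * (sqrt 2 ^ DIM('a) * B) * norm h" for s y h
    using P1_le[of s q h y] by (cases "s > 0") simp_all
  show "integrable lborel (\<lambda>s. (damped q s (s powr (1 / 2 - 1))) * (sqrt 2 ^ DIM('a) * B))"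
    by (intro integrable_mult_left integrable_powr_exp q) simp
qed (use P_integrable[OF q] in auto)

lemma V1_has_derivative:
  assumes q: "q > 0"
  shows "(V1 q h has_derivative (\<lambda>k. V2 q h k x)) (at x)"
    and "continuous_on UNIV (V2 q h k)"
    and "integrable lborel (\<lambda>s. damped q s (P2 h k s x))"
proof -
  obtain Q where Q: "Q \<ge> 0" "\<And>h k s x. s > 0 \<Longrightarrow> \<bar>P2 h k s x\<bar> \<le> norm h * norm k * Q * s powr (\<gamma> / 2 - 1)"
    using P2_bound by blast
  define g where "g h s = (damped q s (s powr (\<gamma> / 2 - 1))) * (Q * norm h)" for s and h :: 'a
  have g_int: "integrable lborel (g h)" for h
    unfolding g_def using gamma by (intro integrable_mult_left integrable_powr_exp q) simp
  have g: "\<bar>damped q s (P2 h k s y)\<bar> \<le> g h s * norm k" for h k s y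
  proof (cases "s > 0")
    case True
    have "\<bar>exp (- q * s) * P2 h k s y\<bar> \<le> exp (- q * s) * (norm h * norm k * Q * s powr (\<gamma> / 2 - 1))"
      unfolding abs_mult using Q(2)[OF True] by (simp add: mult_left_mono)
    then show ?thesis using True by (simp add: g_def mult_ac)
  qed (simp add: g_def)
  have int: "integrable lborel (\<lambda>s. damped q s (P2 h k s x))" for h k x
    by (rule Bochner_Integration.integrable_bound[OF integrable_mult_left[OF g_int[of h], of "norm k"]])
      (use g[of _ h k x] in \<open>auto intro!: AE_I2 intro: order_trans[OF _ abs_ge_self]\<close>)
  then show "integrable lborel (\<lambda>s. damped q s (P2 h k s x))" .
  show "(V1 q h has_derivative (\<lambda>k. V2 q h k x)) (at x)"
    unfolding V1_def[abs_def] V2_def set_lebesgue_integral_def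
  proof (rule has_derivative_integral_parametric[where r = 1 and g = "g h"])
    show "((\<lambda>x. damped q s (P1 h s x)) has_derivative (\<lambda>k. damped q s (P2 h k s y))) (at y)" for s y
      by (cases "s > 0") (auto intro!: has_derivative_mult_right P1_has_derivative)
  qed (use P1_integrable[OF q] g g_int in auto)
  show "continuous_on UNIV (V2 q h k)"
    unfolding continuous_on_sequentially V2_def[abs_def] set_lebesgue_integral_def o_def
  proof (intro allI ballI impI)
    fix X x assume X: "(\<forall>n. X n \<in> (UNIV :: 'a set)) \<and> X \<longlonglongrightarrow> x"
    show "(\<lambda>n. \<integral>s. damped q s (P2 h k s (X n)) \<partial>lborel) \<longlonglongrightarrow> (\<integral>s. damped q s (P2 h k s x) \<partial>lborel)"
    proof (rule integral_dominated_convergence[where w = "\<lambda>s. g h s * norm k"])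
      show "AE s in lborel. (\<lambda>n. damped q s (P2 h k s (X n))) \<longlonglongrightarrow> damped q s (P2 h k s x)"
      proof (rule AE_I2)
        fix s :: real
        show "(\<lambda>n. damped q s (P2 h k s (X n))) \<longlonglongrightarrow> damped q s (P2 h k s x)"
          using X by (cases "s > 0") (auto intro!: tendsto_intros continuous_on_tendsto_compose[OF P2_continuous])
      qed
    qed (use g g_int in auto)
  qed
qed

lemma P_tendsto_w: "((\<lambda>s. P s x) \<longlongrightarrow> w x) (at_right 0)"
proof -
  let ?A = "sqrt 2 ^ DIM('a) * (8 * sqrt 2 ^ DIM('a) * C)"
  have "((\<lambda>s. P s x - w x) \<longlongrightarrow> 0) (at_right 0)"
  proof (rule Lim_null_comparison)
    show "eventually (\<lambda>s. norm (P s x - w x) \<le> ?A * s powr (\<gamma> / 2)) (at_right 0)"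
      using eventually_at_right_less[of 0] by eventually_elim (use P_minus_w in auto)
    have "((\<lambda>s. s powr (\<gamma> / 2)) \<longlongrightarrow> 0) (at_right 0)"
      using gamma by (intro tendsto_zero_powrI[OF tendsto_ident_at tendsto_const])
        (auto intro: eventually_mono[OF eventually_at_right_less])
    then show "((\<lambda>s. ?A * s powr (\<gamma> / 2)) \<longlongrightarrow> 0) (at_right 0)" by (rule tendsto_mult_right_zero)
  qed
  then show ?thesis by (simp add: LIM_zero_iff)
qed

text \<open>By the heat equation, exp(- q s) times (Laplacian of P minus q P) is the time derivative
  of exp(- q s) P s x. Its integral is the difference of the boundary values: 0 at infinity, since P
  is bounded, minus w x at 0.\<close>

lemma V_equation:
  assumes q: "q > 0"
  shows "(\<Sum>b\<in>Basis. V2 q b b x) = q * V q x - w x"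
proof -
  let ?L = "\<lambda>s. \<Sum>b\<in>Basis. P2 b b s x"
  define f where "f s = exp (- q * s) * (?L s) - q * (exp (- q * s) * P s x)" for s
  define F where "F s = exp (- q * s) * P s x" for s
  have f_eq: "indicator {0<..} s *\<^sub>R f s = (\<Sum>b\<in>Basis. damped q s (P2 b b s x)) - q * (damped q s (P s x))" for s
    by (simp add: f_def sum_distrib_left right_diff_distrib)
  have f_int: "integrable lborel (\<lambda>s. indicator {0<..} s *\<^sub>R f s)"
    unfolding f_eq
    by (intro Bochner_Integration.integrable_diff Bochner_Integration.integrable_sum integrable_mult_right V1_has_derivative(3) P_integrable q)
  have f_val: "(LINT s:{0<..}|lborel. f s) = (\<Sum>b\<in>Basis. V2 q b b x) - q * V q x"
    unfolding set_lebesgue_integral_def f_eq V2_def V_def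
    by (subst Bochner_Integration.integral_diff Bochner_Integration.integral_sum;
        (intro Bochner_Integration.integrable_sum integrable_mult_right V1_has_derivative(3) P_integrable q)?)+ simp
  have [measurable]: "f \<in> borel_measurable borel" unfolding f_def by measurable
  have der: "(F has_real_derivative f s) (at s)" if "s > 0" for s
  proof -
    have "((\<lambda>s. exp (- q * s)) has_real_derivative (- q * exp (- q * s))) (at s)"
      by (auto intro!: derivative_eq_intros)
    from DERIV_mult[OF this P_time_derivative[OF that, of x]]
    show ?thesis unfolding F_def[abs_def] f_def by (simp add: algebra_simps)
  qed
  have FTC: "(LINT s:{a..b}|lborel. f s) = F b - F a" if ab: "0 < a" "a \<le> b" for a b
  proof -
    have "(f has_integral F b - F a) {a..b}"
    proof (rule fundamental_theorem_of_calculus[OF ab(2)])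
      fix s assume "s \<in> {a..b}"
      then have "(F has_real_derivative f s) (at s within {a..b})"
        using ab by (intro has_field_derivative_at_within[OF der]) auto
      then show "(F has_vector_derivative f s) (at s within {a..b})"
        by (simp only: has_real_derivative_iff_has_vector_derivative)
    qed
    moreover have "set_integrable lborel {a..b} f"
      by (rule set_integrable_subset[of lborel "{0<..}"]) (use f_int ab in \<open>auto simp: set_integrable_def\<close>)
    ultimately show ?thesis
      using set_borel_integral_eq_integral(2) by (metis integral_unique)
  qed
  \<comment> \<open>Compact intervals exhausting (0, oo), because \<open>der\<close> is available
    for s > 0 only.\<close>
  let ?a = "\<lambda>n. 1 / (real n + 1)" and ?b = "\<lambda>n. real n + 1"
  have "(\<lambda>n. LINT s:{?a n..?b n}|lborel. f s) \<longlonglongrightarrow> (LINT s:{0<..}|lborel. f s)"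
    unfolding set_lebesgue_integral_def
  proof (rule integral_dominated_convergence[where w = "\<lambda>s. \<bar>indicator {0<..} s *\<^sub>R f s\<bar>"])
    show "integrable lborel (\<lambda>s. \<bar>indicator {0<..} s *\<^sub>R f s\<bar>)" using f_int by (rule integrable_abs)
    show "AE s in lborel. norm (indicator {?a n..?b n} s *\<^sub>R f s) \<le> \<bar>indicator {0<..} s *\<^sub>R f s\<bar>" for n
    proof (rule AE_I2)
      fix s :: real
      have "0 < s" if "?a n \<le> s" using that by (smt (verit) divide_pos_pos of_nat_0_le_iff)
      then show "norm (indicator {?a n..?b n} s *\<^sub>R f s) \<le> \<bar>indicator {0<..} s *\<^sub>R f s\<bar>"
        by (auto split: split_indicator)
    qed
    show "AE s in lborel. (\<lambda>n. indicator {?a n..?b n} s *\<^sub>R f s) \<longlonglongrightarrow> indicator {0<..} s *\<^sub>R f s"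
    proof (rule AE_I2, rule tendsto_eventually)
      fix s :: real
      show "\<forall>\<^sub>F n in sequentially. indicator {?a n..?b n} s *\<^sub>R f s = indicator {0<..} s *\<^sub>R f s"
      proof (cases "s > 0")
        case True
        obtain N :: nat where N: "max s (1 / s) \<le> real N" using real_arch_simple by blast
        have "indicator {?a n..?b n} s = (indicator {0<..} s :: real)" if "n \<ge> N" for n
        proof -
          have n: "s \<le> real n" "1 / s \<le> real n" using N that by (auto intro: order_trans)
          then have "1 \<le> s * (real n + 1)" using True by (simp add: pos_divide_le_eq distrib_left mult.commute)
          then have "?a n \<le> s" by (simp add: pos_divide_le_eq)
          then show ?thesis using n True by simp
        qed
        then show ?thesis by (auto simp: eventually_sequentially)
      next
        case False
        have "\<not> ?a n \<le> s" for n using False by (smt (verit) divide_pos_pos of_nat_0_le_iff)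
        then show ?thesis using False by simp
      qed
    qed
  qed measurable
  moreover have "(LINT s:{?a n..?b n}|lborel. f s) = F (?b n) - F (?a n)" for n
  proof (rule FTC)
    have "?a n \<le> 1" by simp
    then show "?a n \<le> ?b n" by (rule order_trans) simp
  qed simp
  moreover have "(\<lambda>n. F (?b n) - F (?a n)) \<longlonglongrightarrow> 0 - w x"
  proof (rule tendsto_diff)
    show "(\<lambda>n. F (?b n)) \<longlonglongrightarrow> 0"
    proof (rule Lim_null_comparison)
      show "\<forall>\<^sub>F n in sequentially. norm (F (?b n)) \<le> exp (- q * ?b n) * B"
        using P_bound by (intro always_eventually) (auto simp: F_def abs_mult)
      show "(\<lambda>n. exp (- q * ?b n) * B) \<longlonglongrightarrow> 0" using q by real_asymp
    qed
    have "((\<lambda>s. F s) \<longlongrightarrow> exp (- q * 0) * w x) (at_right 0)"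
      unfolding F_def by (intro tendsto_mult P_tendsto_w tendsto_intros)
    then have F0: "(F \<longlongrightarrow> w x) (at_right 0)" by simp
    have "filterlim ?a (at_right 0) sequentially" by real_asymp
    from filterlim_compose[OF F0 this] show "(\<lambda>n. F (?a n)) \<longlonglongrightarrow> w x" .
  qed
  ultimately have "(LINT s:{0<..}|lborel. f s) = 0 - w x"
    using LIMSEQ_unique by auto
  then show ?thesis using f_val by simp
qed

lemma resolvent_C2:
  assumes q: "q > 0"
  shows "C2 (\<lambda>x. c * V q x)" and "laplacian (\<lambda>x. c * V q x) x = c * (q * V q x - w x)"
proof -
  have 1: "((\<lambda>x. c * V q x) has_derivative (\<lambda>h. c * V1 q h x)) (at x)" for x
    by (rule has_derivative_mult_right[OF V_has_derivative[OF q]])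
  have fd1: "frechet_derivative (\<lambda>x. c * V q x) (at x) = (\<lambda>h. c * V1 q h x)" for x
    using frechet_derivative_at[OF 1] by simp
  have 2: "((\<lambda>x. c * V1 q h x) has_derivative (\<lambda>k. c * V2 q h k x)) (at x)" for x h
    by (rule has_derivative_mult_right[OF V1_has_derivative(1)[OF q]])
  have fd2: "frechet_derivative (\<lambda>x. c * V1 q h x) (at x) = (\<lambda>k. c * V2 q h k x)" for x h
    using frechet_derivative_at[OF 2] by simp
  show "C2 (\<lambda>x. c * V q x)"
    unfolding C2_def fd1 fd2 using 1 2
    by (auto simp: differentiable_def intro!: continuous_intros V1_has_derivative(2)[OF q])
  show "laplacian (\<lambda>x. c * V q x) x = c * (q * V q x - w x)"
    unfolding laplacian_def fd1 fd2 by (simp add: V_equation[OF q, symmetric] sum_distrib_left)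
qed

end

section \<open>The fundamental solution\<close>

context hoelder_datum
begin

lemma P_max: "P s x = P (max 0 s) x"
  by (cases "s > 0") (auto simp: P_def)

lemma powr_max_isCont: "isCont (\<lambda>s. (max 0 s) powr (\<gamma> / 2)) s"
proof -
  have "continuous_on UNIV (\<lambda>s::real. (max 0 s) powr (\<gamma> / 2))"
    using gamma by (intro continuous_on_powr' continuous_intros) auto
  then show ?thesis by (simp add: continuous_on_eq_continuous_at)
qed

lemma P_isCont: "isCont (\<lambda>s. P s x) s"
proof -
  obtain H where H: "\<And>x r s. 0 \<le> r \<Longrightarrow> 0 \<le> s \<Longrightarrow> \<bar>P s x - P r x\<bar> \<le> H * \<bar>s powr (\<gamma> / 2) - r powr (\<gamma> / 2)\<bar>"
    using P_time_modulus by blast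
  have "((\<lambda>r. P r x - P s x) \<longlongrightarrow> 0) (at s)"
  proof (rule Lim_null_comparison)
    show "\<forall>\<^sub>F r in at s. norm (P r x - P s x) \<le> H * \<bar>max 0 r powr (\<gamma> / 2) - max 0 s powr (\<gamma> / 2)\<bar>"
      using H[of "max 0 s" "max 0 _" x] P_max by (intro always_eventually) (metis max.cobounded1 real_norm_def)
    have "((\<lambda>r. max 0 r powr (\<gamma> / 2) - max 0 s powr (\<gamma> / 2)) \<longlongrightarrow> 0) (at s)"
      using powr_max_isCont[of s] by (simp only: isCont_def LIM_zero_iff)
    then show "((\<lambda>r. H * \<bar>max 0 r powr (\<gamma> / 2) - max 0 s powr (\<gamma> / 2)\<bar>) \<longlongrightarrow> 0) (at s)"
      by (intro tendsto_mult_right_zero tendsto_rabs_zero)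
  qed
  then show ?thesis by (simp add: isCont_def LIM_zero_iff)
qed

end

context stieltjes_kernel
begin

text \<open>Weak convergence says nothing uniform over the functions s -> P s x. A Skorohod coupling
  replaces it by pathwise convergence, and the modulus \<open>P_time_modulus\<close> then bounds the
  difference by a random variable free of x, whose mean tends to 0.\<close>

lemma nu_uniform_continuity:
  assumes hd: "hoelder_datum w B C \<gamma>" and t: "t \<ge> 0" and \<epsilon>: "\<epsilon> > 0"
  shows "\<exists>\<delta>>0. \<forall>s\<ge>0. \<bar>s - t\<bar> < \<delta> \<longrightarrow>
    (\<forall>x. \<bar>(\<integral>r. bounded_datum.P w r x \<partial>nu s) - (\<integral>r. bounded_datum.P w r x \<partial>nu t)\<bar> < \<epsilon>)"
proof (rule ccontr)
  interpret h: hoelder_datum w B C \<gamma> by (rule hd)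
  obtain H where H: "H \<ge> 0" "\<And>x r s. 0 \<le> r \<Longrightarrow> 0 \<le> s \<Longrightarrow> \<bar>h.P s x - h.P r x\<bar> \<le> H * \<bar>s powr (\<gamma> / 2) - r powr (\<gamma> / 2)\<bar>"
    using h.P_time_modulus by blast
  let ?d = "\<lambda>s x. \<bar>(\<integral>r. h.P r x \<partial>nu s) - (\<integral>r. h.P r x \<partial>nu t)\<bar>"
  assume neg: "\<not> ?thesis"
  have "\<exists>s x. s \<ge> 0 \<and> \<bar>s - t\<bar> < 1 / real (Suc n) \<and> \<epsilon> \<le> ?d s x" for n
  proof -
    have "1 / real (Suc n) > 0" by simp
    then show ?thesis using neg not_le by metis
  qed
  then obtain a X where a: "\<And>n. a n \<ge> 0" "\<And>n. \<bar>a n - t\<bar> < 1 / real (Suc n)" and X: "\<And>n. \<epsilon> \<le> ?d (a n) (X n)"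
    by metis
  have "(\<lambda>n. a n - t) \<longlonglongrightarrow> 0"
    by (rule Lim_null_comparison[OF _ LIMSEQ_inverse_real_of_nat])
      (use a(2) in \<open>auto intro!: always_eventually less_imp_le simp: divide_inverse simp del: of_nat_Suc\<close>)
  then have "a \<longlonglongrightarrow> t" by (simp add: LIM_zero_iff)
  then have wc: "weak_conv_m (\<lambda>n. nu (a n)) (nu t)" by (intro nu_weak_conv a t)
  obtain \<Omega> :: "real measure" and Y Y' where \<Omega>: "prob_space \<Omega>"
    and sk: "\<forall>n. Y n \<in> borel_measurable \<Omega>" "\<forall>n. distr \<Omega> borel (Y n) = nu (a n)"
    "Y' \<in> measurable \<Omega> lborel" "distr \<Omega> borel Y' = nu t" "\<forall>\<omega>\<in>space \<Omega>. (\<lambda>n. Y n \<omega>) \<longlonglongrightarrow> Y' \<omega>"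
    using Skorohod[OF nu_rd[OF a(1)] nu_rd[OF t] wc] by blast
  then have Y: "\<And>n. Y n \<in> borel_measurable \<Omega>" "\<And>n. distr \<Omega> borel (Y n) = nu (a n)"
    and Y': "Y' \<in> borel_measurable \<Omega>" "distr \<Omega> borel Y' = nu t"
    and lim: "\<And>\<omega>. \<omega> \<in> space \<Omega> \<Longrightarrow> (\<lambda>n. Y n \<omega>) \<longlonglongrightarrow> Y' \<omega>" by auto
  note [measurable] = Y(1) Y'(1)
  interpret prob_space \<Omega> by fact
  define \<phi> where "\<phi> s = (max 0 s) powr (\<gamma> / 2)" for s
  have \<phi>_meas [measurable]: "\<phi> \<in> borel_measurable borel" unfolding \<phi>_def by measurable
  \<comment> \<open>The modulus gives convergence to 0, the cap 2 B the integrable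
    domination.\<close>
  define D where "D n \<omega> = min (2 * B) (H * \<bar>\<phi> (Y n \<omega>) - \<phi> (Y' \<omega>)\<bar>)" for n \<omega>
  have [measurable]: "D n \<in> borel_measurable \<Omega>" for n unfolding D_def by measurable
  have "(\<lambda>n. \<integral>\<omega>. D n \<omega> \<partial>\<Omega>) \<longlonglongrightarrow> (\<integral>\<omega>. 0 \<partial>\<Omega>)"
  proof (rule integral_dominated_convergence[where w = "\<lambda>_. 2 * B"])
    show "AE \<omega> in \<Omega>. (\<lambda>n. D n \<omega>) \<longlonglongrightarrow> 0"
    proof (rule AE_I2)
      fix \<omega> assume "\<omega> \<in> space \<Omega>"
      then have "(\<lambda>n. \<phi> (Y n \<omega>)) \<longlonglongrightarrow> \<phi> (Y' \<omega>)"
        unfolding \<phi>_def by (intro isCont_tendsto_compose[OF h.powr_max_isCont lim])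
      then have "(\<lambda>n. H * \<bar>\<phi> (Y n \<omega>) - \<phi> (Y' \<omega>)\<bar>) \<longlonglongrightarrow> 0"
        by (intro tendsto_mult_right_zero tendsto_rabs_zero) (simp add: LIM_zero_iff)
      from tendsto_min[OF tendsto_const this, of "2 * B"] show "(\<lambda>n. D n \<omega>) \<longlonglongrightarrow> 0"
        using h.B_nonneg by (simp add: D_def)
    qed
    show "AE \<omega> in \<Omega>. norm (D n \<omega>) \<le> 2 * B" for n
      using h.B_nonneg H(1) by (intro AE_I2) (simp add: D_def abs_le_iff)
  qed auto
  then have "eventually (\<lambda>n. (\<integral>\<omega>. D n \<omega> \<partial>\<Omega>) < \<epsilon>) sequentially"
    using \<epsilon> by (intro order_tendstoD(2)[of _ 0]) auto
  then obtain n where n: "(\<integral>\<omega>. D n \<omega> \<partial>\<Omega>) < \<epsilon>" by (auto simp: eventually_sequentially)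
  have Pint: "integrable \<Omega> (\<lambda>\<omega>. h.P (Z \<omega>) x)" if [measurable]: "Z \<in> borel_measurable \<Omega>" for Z x
    by (rule integrable_const_bound[where B = B])
      (auto simp: h.P_bound intro: measurable_compose[OF that h.P_measurable])
  have "?d (a n) (X n) = \<bar>(\<integral>\<omega>. h.P (Y n \<omega>) (X n) \<partial>\<Omega>) - (\<integral>\<omega>. h.P (Y' \<omega>) (X n) \<partial>\<Omega>)\<bar>"
    unfolding Y(2)[symmetric] Y'(2)[symmetric] by (subst (1 2) integral_distr) auto
  also have "\<dots> = \<bar>\<integral>\<omega>. h.P (Y n \<omega>) (X n) - h.P (Y' \<omega>) (X n) \<partial>\<Omega>\<bar>"
    by (subst Bochner_Integration.integral_diff) (auto intro: Pint)
  also have "\<dots> \<le> (\<integral>\<omega>. \<bar>h.P (Y n \<omega>) (X n) - h.P (Y' \<omega>) (X n)\<bar> \<partial>\<Omega>)" by (rule integral_abs_bound)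
  also have "\<dots> \<le> (\<integral>\<omega>. D n \<omega> \<partial>\<Omega>)"
  proof (rule integral_mono)
    show "integrable \<Omega> (\<lambda>\<omega>. \<bar>h.P (Y n \<omega>) (X n) - h.P (Y' \<omega>) (X n)\<bar>)"
      by (intro integrable_abs Bochner_Integration.integrable_diff Pint) auto
    show "integrable \<Omega> (D n)"
      by (rule integrable_const_bound[where B = "2 * B"])
        (use h.B_nonneg H(1) in \<open>auto simp: D_def abs_le_iff\<close>)
    fix \<omega>
    have "\<bar>h.P (Y n \<omega>) (X n) - h.P (Y' \<omega>) (X n)\<bar> \<le> H * \<bar>\<phi> (Y n \<omega>) - \<phi> (Y' \<omega>)\<bar>"
      using H(2)[of "max 0 (Y' \<omega>)" "max 0 (Y n \<omega>)" "X n"] h.P_max[of "Y n \<omega>" "X n"] h.P_max[of "Y' \<omega>" "X n"] by (simp add: \<phi>_def)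
    moreover have "\<bar>h.P (Y n \<omega>) (X n) - h.P (Y' \<omega>) (X n)\<bar> \<le> 2 * B"
      using h.P_bound[of "Y n \<omega>" "X n"] h.P_bound[of "Y' \<omega>" "X n"] by linarith
    ultimately show "\<bar>h.P (Y n \<omega>) (X n) - h.P (Y' \<omega>) (X n)\<bar> \<le> D n \<omega>" by (simp add: D_def)
  qed
  finally show False using X[of n] n by linarith
qed

lemma LT_solution_nu:
  assumes hd: "hoelder_datum w B C \<gamma>" and W0: "\<And>x. W 0 x = w x"
    and W: "\<And>t x. t > 0 \<Longrightarrow> W t x = (\<integral>s. bounded_datum.P w s x \<partial>nu t)"
  shows "LT_solution K w W"
proof -
  interpret h: hoelder_datum w B C \<gamma> by (rule hd)
  \<comment> \<open>\<open>nu 0\<close> is the point mass at 0 and \<open>P 0\<close> is the datum,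
    so one formula covers t = 0 as well.\<close>
  have W': "W t x = (\<integral>s. h.P s x \<partial>nu t)" if "t \<ge> 0" for t x
  proof (cases "t = 0")
    case True
    then show ?thesis by (simp add: W0 integral_return h.P_def[of 0])
  qed (use W that in auto)
  have bound: "\<bar>W t x\<bar> \<le> B" if "t \<ge> 0" for t x
  proof -
    interpret real_distribution "nu t" by (rule nu_rd[OF that])
    have "\<bar>W t x\<bar> \<le> (\<integral>s. \<bar>h.P s x\<bar> \<partial>nu t)" unfolding W'[OF that] by (rule integral_abs_bound)
    also have "\<dots> \<le> (\<integral>s. B \<partial>nu t)"
      using h.P_bound h.B_nonneg by (intro integral_mono integrable_abs integrable_const_bound[where B = B]) auto
    finally show ?thesis using prob_space by simp
  qed
  have cont: "continuous_on {0..} (\<lambda>t. W t x)" for x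
  proof -
    have "continuous_on {0..} (\<lambda>t. W t x) \<longleftrightarrow> continuous_on {0..} (\<lambda>t. \<integral>s. h.P s x \<partial>nu t)"
      by (rule continuous_on_cong[OF refl W']) simp
    then show ?thesis using nu_continuous[OF h.P_isCont h.P_bound, of x] by simp
  qed
  have "set_integrable lborel {0<..} (\<lambda>t. exp (- p * t) * W t x)" if p: "p > 0" for p x
  proof -
    have [measurable]: "(\<lambda>t. indicator {0<..} t *\<^sub>R W t x) \<in> borel_measurable borel"
      by (intro borel_measurable_continuous_on_indicator continuous_on_subset[OF cont]) auto
    have m: "(\<lambda>t. indicator {0<..} t *\<^sub>R (exp (- p * t) * W t x)) = (\<lambda>t. exp (- p * t) * (indicator {0<..} t *\<^sub>R W t x))"
      by (simp add: mult_ac)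
    show ?thesis
      unfolding set_integrable_def
    proof (rule Bochner_Integration.integrable_bound)
      show "integrable lborel (\<lambda>s. (indicator {0<..} s *\<^sub>R (exp (- p * s) * s powr (1 - 1))) * B)"
        by (intro integrable_mult_left integrable_powr_exp p) simp
      show "AE s in lborel. norm (indicator {0<..} s *\<^sub>R (exp (- p * s) * W s x)) \<le> norm ((indicator {0<..} s *\<^sub>R (exp (- p * s) * s powr (1 - 1))) * B)"
        using bound h.B_nonneg by (intro AE_I2) (auto simp: abs_mult split: split_indicator)
      show "(\<lambda>t. indicator {0<..} t *\<^sub>R (exp (- p * t) * W t x)) \<in> borel_measurable lborel" unfolding m by measurable
    qed
  qed
  moreover have lap: "laplace (\<lambda>t. W t x) p = K p * h.V (p * K p) x" if p: "p > 0" for p x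
  proof -
    have "laplace (\<lambda>t. W t x) p = (LINT t:{0<..}|lborel. exp (- p * t) * (\<integral>s. h.P s x \<partial>nu t))"
      unfolding laplace_def by (rule set_lebesgue_integral_cong) (auto simp: W')
    also have "\<dots> = K p * h.V (p * K p) x"
      unfolding h.V_def by (rule nu_time_laplace[OF p h.P_isCont h.P_bound])
    finally show ?thesis .
  qed
  moreover have "C2 (\<lambda>x. laplace (\<lambda>t. W t x) p) \<and>
        (\<forall>x. p * K p * laplace (\<lambda>t. W t x) p - K p * w x = laplacian (\<lambda>y. laplace (\<lambda>t. W t y) p) x)" if p: "p > 0" for p
  proof -
    have q: "p * K p > 0" using p K_pos[OF p] by simp
    show ?thesis
      unfolding lap[OF p] h.resolvent_C2(2)[OF q] using h.resolvent_C2(1)[OF q] by (simp add: algebra_simps)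
  qed
  moreover have "bounded ((\<lambda>(t, x). W t x) ` ({0..} \<times> UNIV))"
    using bound by (auto simp: bounded_iff)
  moreover have "\<forall>t\<ge>0. \<forall>\<epsilon>>0. \<exists>\<delta>>0. \<forall>s\<ge>0. \<bar>s - t\<bar> < \<delta> \<longrightarrow> (\<forall>x. \<bar>W s x - W t x\<bar> < \<epsilon>)"
    using nu_uniform_continuity[OF hd] by (auto simp: W')
  ultimately show ?thesis unfolding LT_solution_def using W0 by blast
qed

section \<open>Properties of the kernel \<open>Z\<close>\<close>

definition Z :: "real \<Rightarrow> 'a::euclidean_space \<Rightarrow> real" where
  "Z t x = (\<integral>s. heat s x \<partial>nu t)"

lemma Z_nonneg: "0 \<le> Z t x"
  unfolding Z_def by (intro integral_nonneg_AE AE_I2 heat_nonneg)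

text \<open>For x \<noteq> 0 the heat kernel is bounded and continuous in s, so Z is even continuous
  in t down to t = 0.\<close>

lemma Z_locally_integrable:
  assumes "x \<noteq> 0" shows "set_integrable lborel {0<..T} (\<lambda>t. Z t x)"
proof -
  obtain B where B: "\<And>s. \<bar>heat s x\<bar> \<le> B" using heat_bounded_time[OF assms] by blast
  have "continuous_on {0..} (\<lambda>t. Z t x)"
    unfolding Z_def by (rule nu_continuous[OF heat_isCont_time[OF assms] B])
  then have "continuous_on {0..T} (\<lambda>t. Z t x)" by (rule continuous_on_subset) auto
  then have "set_integrable lborel {0..T} (\<lambda>t. Z t x)" by (rule borel_integrable_atLeastAtMost')
  then show ?thesis by (rule set_integrable_subset) auto
qed

lemma Z_smooth: assumes "t > 0" shows "smooth_on (- {0}) (Z t)"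
proof -
  interpret real_distribution "nu t" by (rule nu_rd) (use assms in simp)
  interpret heat_mixture "nu t" by unfold_locales simp
  show ?thesis
    using smooth_on_heat_poly_integral[OF heat_poly_const[of 1]] by (simp add: Z_def[abs_def])
qed

text \<open>Absolute integrability for Fubini: the integral over space is at most B for every s > 0,
  and \<open>nu t\<close> is a probability measure.\<close>

lemma heat_product_integrable:
  assumes t: "t > 0" and w: "w \<in> borel_measurable borel" "\<And>x. \<bar>w x\<bar> \<le> B"
  shows "integrable (nu t \<Otimes>\<^sub>M lborel) (\<lambda>(s, \<xi>). heat s (x - \<xi>) * w \<xi>)"
proof -
  interpret real_distribution "nu t" by (rule nu_rd) (use t in simp)
  interpret pair_sigma_finite "nu t" lborel ..
  note [measurable] = w(1)
  interpret d: bounded_datum w B by unfold_locales (use w in auto)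
  show ?thesis
  proof (rule Fubini_integrable)
    have [measurable_cong]: "sets (nu t) = sets borel" using t by simp
    show "(\<lambda>(s, \<xi>). heat s (x - \<xi>) * w \<xi>) \<in> borel_measurable (nu t \<Otimes>\<^sub>M lborel)" by measurable
    have int: "integrable lborel (\<lambda>\<xi>. heat s (x - \<xi>) * w \<xi>)" for s
      by (rule d.conv_integrable[where t = s and A = 1]) (auto simp: heat_nonneg)
    then show "AE s in nu t. integrable lborel (\<lambda>\<xi>. case (s, \<xi>) of (s, \<xi>) \<Rightarrow> heat s (x - \<xi>) * w \<xi>)" by simp
    show "integrable (nu t) (\<lambda>s. \<integral>\<xi>. norm (case (s, \<xi>) of (s, \<xi>) \<Rightarrow> heat s (x - \<xi>) * w \<xi>) \<partial>lborel)"
    proof (rule integrable_const_bound[where B = B])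
      show "AE s in nu t. norm (\<integral>\<xi>. norm (case (s, \<xi>) of (s, \<xi>) \<Rightarrow> heat s (x - \<xi>) * w \<xi>) \<partial>lborel) \<le> B"
        using nu_pos[OF t]
      proof eventually_elim
        case (elim s)
        have "(\<integral>\<xi>. \<bar>heat s (x - \<xi>) * w \<xi>\<bar> \<partial>lborel) \<le> (\<integral>\<xi>. B * heat s (x - \<xi>) \<partial>lborel)"
          using w(2) by (intro integral_mono integrable_abs int integrable_mult_right heat_integrable)
            (simp add: abs_mult heat_nonneg mult.commute[of B] mult_left_mono)
        also have "\<dots> = B" using heat_integral[OF elim, of x] by simp
        finally show ?case by simp
      qed
      show "(\<lambda>s. \<integral>\<xi>. norm (case (s, \<xi>) of (s, \<xi>) \<Rightarrow> heat s (x - \<xi>) * w \<xi>) \<partial>lborel) \<in> borel_measurable (nu t)"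
        by measurable
    qed
  qed
qed

lemma Z_convolution:
  assumes t: "t > 0" and w: "w \<in> borel_measurable borel" "\<And>x. \<bar>w x\<bar> \<le> B"
  shows "integrable lborel (\<lambda>\<xi>. Z t (x - \<xi>) * w \<xi>)"
    and "(\<integral>\<xi>. Z t (x - \<xi>) * w \<xi> \<partial>lborel) = (\<integral>s. bounded_datum.P w s x \<partial>nu t)"
proof -
  interpret real_distribution "nu t" by (rule nu_rd) (use t in simp)
  interpret pair_sigma_finite "nu t" lborel ..
  interpret d: bounded_datum w B by unfold_locales (use w in auto)
  have int: "integrable (nu t \<Otimes>\<^sub>M lborel) (\<lambda>(s, \<xi>). heat s (x - \<xi>) * w \<xi>)"
    by (rule heat_product_integrable[OF t w])
  show "integrable lborel (\<lambda>\<xi>. Z t (x - \<xi>) * w \<xi>)"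
    using integrable_snd[OF int] by (simp add: Z_def)
  have "(\<integral>\<xi>. Z t (x - \<xi>) * w \<xi> \<partial>lborel) = (\<integral>\<xi>. (\<integral>s. heat s (x - \<xi>) * w \<xi> \<partial>nu t) \<partial>lborel)"
    by (simp add: Z_def)
  also have "\<dots> = (\<integral>s. (\<integral>\<xi>. heat s (x - \<xi>) * w \<xi> \<partial>lborel) \<partial>nu t)"
    by (rule Fubini_integral[OF int])
  also have "\<dots> = (\<integral>s. d.P s x \<partial>nu t)"
  proof (rule integral_cong_AE)
    show "AE s in nu t. (\<integral>\<xi>. heat s (x - \<xi>) * w \<xi> \<partial>lborel) = d.P s x"
      using nu_pos[OF t] by eventually_elim (simp add: d.P_def)
    have [measurable_cong]: "sets (nu t) = sets borel" using t by simp
    note [measurable] = w(1)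
    show "(\<lambda>s. \<integral>\<xi>. heat s (x - \<xi>) * w \<xi> \<partial>lborel) \<in> borel_measurable (nu t)" by measurable
    show "(\<lambda>s. d.P s x) \<in> borel_measurable (nu t)" by measurable
  qed
  finally show "(\<integral>\<xi>. Z t (x - \<xi>) * w \<xi> \<partial>lborel) = (\<integral>s. d.P s x \<partial>nu t)" .
qed

lemma Z_minus: "Z t (- x) = Z t x"
  by (simp add: Z_def)

lemma Z_integral:
  assumes t: "t > 0"
  shows "integrable lborel (Z t :: 'a::euclidean_space \<Rightarrow> real)" "(\<integral>x. Z t (x::'a) \<partial>lborel) = 1"
proof -
  interpret real_distribution "nu t" by (rule nu_rd) (use t in simp)
  interpret one: bounded_datum "\<lambda>x::'a. 1" 1 by unfold_locales auto
  have 1: "(\<lambda>\<xi>::'a. Z t (0 - \<xi>) * 1) = Z t" by (simp add: Z_minus fun_eq_iff)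
  show "integrable lborel (Z t :: 'a \<Rightarrow> real)"
    using Z_convolution(1)[OF t, of "\<lambda>x::'a. 1" 1 0] unfolding 1 by simp
  have "(\<integral>x. Z t (x::'a) \<partial>lborel) = (\<integral>s. one.P s 0 \<partial>nu t)"
    using Z_convolution(2)[OF t, of "\<lambda>x::'a. 1" 1 0] unfolding 1 by simp
  \<comment> \<open>At s \<le> 0 the value of \<open>P\<close> is the datum 1, so the integrands
    agree for every s and not only almost everywhere.\<close>
  also have "\<dots> = (\<integral>s. 1 \<partial>nu t)"
    using heat_integral[of _ "0 :: 'a"] by (intro Bochner_Integration.integral_cong refl) (simp add: one.P_def)
  finally show "(\<integral>x. Z t (x::'a) \<partial>lborel) = 1" using prob_space by simp
qed

end

section \<open>From the hypotheses to the locale\<close>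

text \<open>All parts of the representation are nonnegative, so the limits bound them from above:
  K(p) \<ge> b and K -> 0 force b = 0, while p K(p) \<ge> a + m, with m the mass of sigma at 0, and
  p K -> 0 force a = m = 0. What remains lives on (0, oo).\<close>

lemma stieltjes_kernelI:
  fixes K :: "real \<Rightarrow> real"
  assumes st: "stieltjes_fun K"
    and K_inf: "(K \<longlongrightarrow> 0) at_top"
    and pK_0: "((\<lambda>p. p * K p) \<longlongrightarrow> 0) (at_right 0)"
    and pK_inf: "filterlim (\<lambda>p. p * K p) at_top at_top"
  shows "\<exists>\<sigma>. stieltjes_kernel \<sigma> K"
proof -
  obtain a b \<sigma> where ab: "a \<ge> 0" "b \<ge> 0" and s [measurable_cong]: "sets \<sigma> = sets borel"
    and neg: "emeasure \<sigma> {..<0} = 0" and int: "set_integrable \<sigma> {0..} (\<lambda>t. 1 / (1 + t))"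
    and K: "\<And>p. p > 0 \<Longrightarrow> K p = a / p + b + (\<integral>t\<in>{0..}. 1 / (p + t) \<partial>\<sigma>)"
    using st unfolding stieltjes_fun_def by blast
  have int_p: "set_integrable \<sigma> {0..} (\<lambda>t. 1 / (p + t))" if p: "p > 0" for p
    unfolding set_integrable_def
  proof (rule Bochner_Integration.integrable_bound)
    show "integrable \<sigma> (\<lambda>t. (1 + 1 / p) * (indicator {0..} t *\<^sub>R (1 / (1 + t))))"
      using int unfolding set_integrable_def by (rule integrable_mult_right)
    show "AE t in \<sigma>. norm (indicator {0..} t *\<^sub>R (1 / (p + t))) \<le> norm ((1 + 1 / p) * (indicator {0..} t *\<^sub>R (1 / (1 + t))))"
      using p stieltjes_kernel_le[OF p] by (intro AE_I2) (auto split: split_indicator)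
  qed measurable
  define J where "J p = (\<integral>t\<in>{0<..}. 1 / (p + t) \<partial>\<sigma>)" for p
  have J: "J p \<ge> 0" if "p > 0" for p
    unfolding J_def set_lebesgue_integral_def using that
    by (intro integral_nonneg_AE AE_I2) (auto split: split_indicator)
  define m where "m = measure \<sigma> {0}"
  have split: "(\<integral>t\<in>{0..}. 1 / (p + t) \<partial>\<sigma>) = m / p + J p" if p: "p > 0" for p
  proof -
    have "{(0::real)..} = {0} \<union> {0<..}" by auto
    then have "(\<integral>t\<in>{0..}. 1 / (p + t) \<partial>\<sigma>) = (\<integral>t\<in>({0} \<union> {0<..}). 1 / (p + t) \<partial>\<sigma>)" by simp
    also have "\<dots> = (\<integral>t\<in>{0}. 1 / (p + t) \<partial>\<sigma>) + J p"
      unfolding J_def using p by (intro set_integral_Un set_integrable_subset[OF int_p[OF p]]) (auto simp: s)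
    also have "(\<integral>t\<in>{0}. 1 / (p + t) \<partial>\<sigma>) = (\<integral>t. indicator {0} t * (1 / p) \<partial>\<sigma>)"
      unfolding set_lebesgue_integral_def by (intro Bochner_Integration.integral_cong) (auto split: split_indicator)
    also have "\<dots> = m / p" using sets_eq_imp_space_eq[OF s] by (simp add: m_def)
    finally show ?thesis .
  qed
  have m0: "m \<ge> 0" by (simp add: m_def)
  have "b \<le> 0"
  proof (rule tendsto_lowerbound[OF K_inf])
    show "\<forall>\<^sub>F p in at_top. b \<le> K p"
      using eventually_gt_at_top[of 0] by eventually_elim (use K split J ab m0 in auto)
  qed simp
  moreover have am: "a + m \<le> 0"
  proof (rule tendsto_lowerbound[OF pK_0])
    show "\<forall>\<^sub>F p in at_right 0. a + m \<le> p * K p"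
      using eventually_at_right_less[of 0]
    proof eventually_elim
      case (elim p)
      have "p * K p = a + m + p * (b + J p)" using elim K[OF elim] split[OF elim] by (simp add: field_simps)
      then show ?case using elim ab J[OF elim] by simp
    qed
  qed simp
  ultimately have abm: "a = 0" "b = 0" "m = 0" using ab m0 by auto
  define \<sigma>' where "\<sigma>' = density \<sigma> (indicator {0<..})"
  have int': "integrable \<sigma>' (\<lambda>t. 1 / (1 + t))"
  proof -
    have "set_integrable \<sigma> {0<..} (\<lambda>t. 1 / (1 + t))"
      by (rule set_integrable_subset[OF int]) (auto simp: s)
    then have "integrable \<sigma> (\<lambda>t. indicator {0<..} t *\<^sub>R (1 / (1 + t)))"
      by (simp only: set_integrable_def)
    then show ?thesis unfolding \<sigma>'_def ennreal_indicator[symmetric] by (subst integrable_density) auto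
  qed
  have "K p = (\<integral>t. 1 / (p + t) \<partial>\<sigma>')" if "p > 0" for p
    using K[OF that] split[OF that] abm unfolding \<sigma>'_def ennreal_indicator[symmetric]
    by (subst integral_density) (auto simp: J_def set_lebesgue_integral_def)
  moreover have "AE t in \<sigma>'. t > 0"
    unfolding \<sigma>'_def by (subst AE_density) (auto split: split_indicator)
  ultimately have "stieltjes_kernel \<sigma>' K"
    using int' pK_inf by unfold_locales (auto simp: \<sigma>'_def s)
  then show ?thesis by blast
qed

theorem theorem3:
  fixes k :: "real \<Rightarrow> real"
  assumes k_nonneg: "\<forall>t>0. k t \<ge> 0"
    and k_loc: "\<forall>T>0. set_integrable lborel {0<..T} k"
    and K_exists: "\<forall>p>0. set_integrable lborel {0<..} (\<lambda>t. exp (- p * t) * k t)"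
    and K_stieltjes: "stieltjes_fun (laplace k)"
    and K_0: "filterlim (laplace k) at_top (at_right 0)"
    and K_inf: "(laplace k \<longlongrightarrow> 0) at_top"
    and pK_0: "((\<lambda>p. p * laplace k p) \<longlongrightarrow> 0) (at_right 0)"
    and pK_inf: "filterlim (\<lambda>p. p * laplace k p) at_top at_top"
  shows "\<exists>Z :: real \<Rightarrow> 'a::euclidean_space \<Rightarrow> real.
     (\<forall>t>0. \<forall>x. x \<noteq> 0 \<longrightarrow> Z t x \<ge> 0) \<and>
     (\<forall>x. x \<noteq> 0 \<longrightarrow> (\<forall>T>0. set_integrable lborel {0<..T} (\<lambda>t. Z t x))) \<and>
     (\<forall>t>0. smooth_on (- {0}) (Z t)) \<and>
     (\<forall>t>0. integrable lborel (Z t) \<and> (\<integral>x. Z t x \<partial>lborel) = 1) \<and>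
     (\<forall>w0 :: 'a \<Rightarrow> real.
        bounded (range w0) \<and>
        (\<exists>C \<gamma>. 0 < \<gamma> \<and> \<gamma> \<le> 1 \<and> (\<forall>\<xi> \<eta>. \<bar>w0 \<xi> - w0 \<eta>\<bar> \<le> C * norm (\<xi> - \<eta>) powr \<gamma>))
        \<longrightarrow> LT_solution (laplace k) w0
              (\<lambda>t x. if t = 0 then w0 x else (\<integral>\<xi>. Z t (x - \<xi>) * w0 \<xi> \<partial>lborel)))"
proof -
  obtain \<sigma> where "stieltjes_kernel \<sigma> (laplace k)"
    using stieltjes_kernelI[OF K_stieltjes K_inf pK_0 pK_inf] by blast
  then interpret S: stieltjes_kernel \<sigma> "laplace k" .
  have LT: "LT_solution (laplace k) w0 (\<lambda>t x. if t = 0 then w0 x else (\<integral>\<xi>. S.Z t (x - \<xi>) * w0 \<xi> \<partial>lborel))"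
    if bdd: "bounded (range w0)" and g: "0 < \<gamma>" "\<gamma> \<le> 1"
      and C: "\<forall>\<xi> \<eta>. \<bar>w0 \<xi> - w0 \<eta>\<bar> \<le> C * norm (\<xi> - \<eta>) powr \<gamma>" for w0 :: "'a \<Rightarrow> real" and C \<gamma>
  proof -
    obtain B where B: "\<And>x. \<bar>w0 x\<bar> \<le> B" using bdd by (auto simp: bounded_iff)
    \<comment> \<open>The Hoelder constant comes without a sign; its absolute value serves as the
      nonnegative constant of \<open>hoelder_datum\<close>.\<close>
    have "\<bar>w0 x - w0 y\<bar> \<le> \<bar>C\<bar> * norm (x - y) powr \<gamma>" for x y
    proof -
      have "C * norm (x - y) powr \<gamma> \<le> \<bar>C\<bar> * norm (x - y) powr \<gamma>" by (intro mult_right_mono) auto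
      then show ?thesis using C order_trans by blast
    qed
    then have hd: "hoelder_datum w0 B \<bar>C\<bar> \<gamma>"
      using B g by unfold_locales auto
    interpret h: hoelder_datum w0 B "\<bar>C\<bar>" \<gamma> by (rule hd)
    show ?thesis
      by (rule S.LT_solution_nu[OF hd]) (use S.Z_convolution(2)[OF _ h.w_meas h.w_bound] in auto)
  qed
  show ?thesis
  proof (intro exI[of _ S.Z] conjI allI impI)
    fix w0 :: "'a \<Rightarrow> real"
    assume "bounded (range w0) \<and> (\<exists>C \<gamma>. 0 < \<gamma> \<and> \<gamma> \<le> 1 \<and> (\<forall>\<xi> \<eta>. \<bar>w0 \<xi> - w0 \<eta>\<bar> \<le> C * norm (\<xi> - \<eta>) powr \<gamma>))"
    then show "LT_solution (laplace k) w0 (\<lambda>t x. if t = 0 then w0 x else (\<integral>\<xi>. S.Z t (x - \<xi>) * w0 \<xi> \<partial>lborel))"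
      using LT by (elim conjE exE)
  qed (rule S.Z_nonneg S.Z_locally_integrable S.Z_smooth S.Z_integral; assumption?)+
qed

end
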